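(* Let $r>a\ge1$ be coprime integers with $\frac ra=[\alpha_1,\dots,\alpha_n]$. The reconstruction algebra $A=A_{r,a}$ is a prime ring of PI degree $n+1$.
   Context: Ground field $\mathbb{C}$; $pq$ for paths means $p$ followed by $q$. $\frac ra=[\alpha_1,\dots,\alpha_n]:=\alpha_1-\frac{1}{\alpha_2-\frac{1}{\alpha_3-\cdots}}$ with all $\alpha_i\ge2$. The algebra $A_{r,a}$ is a finitely generated module over its centre $R\cong\mathbb{C}[x,y]^{\frac1r(1,a)}$ (invariants of the group generated by $\mathrm{diag}(\varepsilon,\varepsilon^a)$, $\varepsilon$ a primitive $r$-th root of unity). Reconstruction algebra. $A_{r,a}$ is the path algebra over $\mathbb{C}$ of the following quiver $Q$ modulo the following relations. Put $\gamma=\sum_{i=1}^n(\alpha_i-2)$. If $n=1$: vertices $0,1$; arrows $a_1,a_2:0\to1$; $c_1,c_2:1\to0$; $k_1,\dots,k_{\alpha_1-2}:1\to0$. Relations: $c_2a_1=c_1a_2$, $a_1c_2=a_2c_1$; (if $\alpha_1>2$) $k_1a_1=c_2a_2$, $a_1k_1=a_2c_2$; $k_ta_1=k_{t-1}a_2$, $a_1k_t=a_2k_{t-1}$ for $2\le t\le\alpha_1-2$. If $n\ge2$: vertices $0,1,\dots,n$; clockwise arrows $c_{0n}:0\to n$ and $c_{t,t-1}:t\to t-1$ ($1\le t\le n$); anticlockwise arrows $a_{t,t+1}:t\to t+1$ ($0\le t\le n-1$) and $a_{n0}:n\to0$; and for each $1\le i\le n$, $\alpha_i-2$ extra arrows $i\to0$;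 the extra arrows are labelled $k_1,\dots,k_\gamma$ with weakly increasing tails. Put $k_0:=c_{10}$, $k_{\gamma+1}:=a_{n0}$. Let $l_s$ be the tail of $k_s$, $u_i=\max\{j:l_j=i\}$, $v_i=\min\{j:l_j=i\}$, $V_1=0$, $V_i=\max\{j:l_j<i\}$ for $2\le i\le n$. For $i\ne j$, $C_{ij}$ (resp. $A_{ij}$) is the shortest path from $i$ to $j$ consisting of clockwise (resp. anticlockwise) arrows. Relations: Step 1: if $\alpha_1=2$: $c_{10}a_{01}=a_{12}c_{21}$. If $\alpha_1>2$: $k_sa_{01}=k_{s+1}C_{01}$ and $a_{01}k_s=C_{01}k_{s+1}$ for $0\le s<u_1$; $k_{u_1}a_{01}=a_{12}c_{21}$. Step $t$ ($1<t<n$): if $\alpha_t=2$: $c_{t,t-1}a_{t-1,t}=a_{t,t+1}c_{t+1,t}$. If $\alpha_t>2$: $c_{t,t-1}a_{t-1,t}=k_{v_t}C_{0t}$; $C_{0t}k_{v_t}=A_{0l_{V_t}}k_{V_t}$; $k_sA_{0t}=k_{s+1}C_{0t}$ and $A_{0t}k_s=C_{0t}k_{s+1}$ for $v_t\le s<u_t$; $k_{u_t}A_{0t}=a_{t,t+1}c_{t+1,t}$. Step $n$: if $\alpha_n=2$: $c_{n,n-1}a_{n-1,n}=a_{n0}c_{0n}$; $c_{0n}a_{n0}=A_{0l_{V_n}}k_{V_n}$. If $\alpha_n>2$: $c_{n,n-1}a_{n-1,n}=k_{v_n}c_{0n}$; $c_{0n}k_{v_n}=A_{0l_{V_n}}k_{V_n}$;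 $k_sA_{0n}=k_{s+1}c_{0n}$ and $A_{0n}k_s=c_{0n}k_{s+1}$ for $v_n\le s<u_n$. *)

theory Defs
  imports
    "Graph_Theory.Arc_Walk"
    "HOL-Algebra.Ideal_Product"
    "HOL-Algebra.Embedded_Algebras"
    "HOL-Algebra.QuotRing"
    Complex_Main
begin

section \<open>Path algebras\<close>

text \<open>
  A quiver is a \<^typ>\<open>('v, 'e) pre_digraph\<close>.  A path is a pair of its start vertex and the list
  of its arrows in the order in which they are traversed; the pair \<open>(u, [])\<close> is the trivial path
  at \<open>u\<close>.  Thus \<open>pq\<close> means \<open>p\<close> followed by \<open>q\<close>.
\<close>

definition quiver_paths :: "('v, 'e) pre_digraph \<Rightarrow> ('v \<times> 'e list) set" where
  "quiver_paths Q = {(u, p) |u p. \<exists>v. pre_digraph.awalk Q u p v}"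

text \<open>
  An element of the complex path algebra is the finitely supported coefficient function of a
  linear combination of paths.  The coefficient of a path in a product is a sum over all ways of
  cutting that path into an initial and a final part.
\<close>

definition path_algebra :: "('v, 'e) pre_digraph \<Rightarrow> ('v \<times> 'e list \<Rightarrow> complex) ring" where
  "path_algebra Q =
    \<lparr>carrier = {f. finite {x. f x \<noteq> 0} \<and> {x. f x \<noteq> 0} \<subseteq> quiver_paths Q},
     mult = (\<lambda>f g (u, p).
       \<Sum>k\<le>length p. f (u, take k p) * g (pre_digraph.awlast Q u (take k p), drop k p)),
     one = (\<lambda>(u, p). if u \<in> verts Q \<and> p = [] then 1 else 0),
     zero = (\<lambda>_. 0),
     add = (\<lambda>f g x. f x + g x)\<rparr>"

definition path_elem :: "('v, 'e) pre_digraph \<Rightarrow> 'e list \<Rightarrow> ('v \<times> 'e list \<Rightarrow> complex)" where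
  "path_elem Q p = (\<lambda>x. if x = (tail Q (hd p), p) then 1 else 0)"
  \<comment> \<open>only meaningful for nontrivial paths, which are determined by their arrows\<close>

definition path_algebra_mod ::
    "('v, 'e) pre_digraph \<Rightarrow> ('e list \<times> 'e list) set \<Rightarrow> ('v \<times> 'e list \<Rightarrow> complex) set ring" where
  "path_algebra_mod Q S =
    path_algebra Q Quot
      (Idl\<^bsub>path_algebra Q\<^esub>
        {path_elem Q p \<ominus>\<^bsub>path_algebra Q\<^esub> path_elem Q q |p q. (p, q) \<in> S})"


section \<open>Reconstruction algebras of type A\<close>

fun hj_frac :: "nat list \<Rightarrow> rat" where
  "hj_frac [x] = of_nat x"
| "hj_frac (x # y # ys) = of_nat x - 1 / hj_frac (y # ys)"

text \<open>
  Lists of continued fraction entries are indexed from 0, so \<open>\<alpha>\<^sub>i\<close> is \<^term>\<open>\<alpha> ! (i - 1)\<close>.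

  Arrows when \<^term>\<open>length \<alpha> = n\<close> with \<open>n \<ge> 2\<close>: the clockwise and anticlockwise arrows are
  indexed by their tails, i.e. \<open>Cw 0\<close> is \<open>c\<^sub>0\<^sub>n\<close>, \<open>Cw t\<close> is the arrow \<open>t \<rightarrow> t-1\<close> for \<open>t \<ge> 1\<close>,
  \<open>Acw t\<close> is the arrow \<open>t \<rightarrow> t+1\<close> for \<open>t < n\<close>, and \<open>Acw n\<close> is \<open>a\<^sub>n\<^sub>0\<close>;
  \<open>Ex s\<close> is the extra arrow \<open>k\<^sub>s\<close>.

  Arrows when \<open>n = 1\<close>: \<open>Cw i\<close>, \<open>Acw i\<close>, \<open>Ex t\<close> are the arrows called \<open>c\<^sub>i\<close>, \<open>a\<^sub>i\<close>
  (\<open>i = 1, 2\<close>) and \<open>k\<^sub>t\<close>.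
\<close>

datatype arrow = Cw nat | Acw nat | Ex nat

subsection \<open>The case of one entry\<close>

definition quiver_one :: "nat \<Rightarrow> (nat, arrow) pre_digraph" where
  "quiver_one m =
    \<lparr>verts = {0, 1},
     arcs = Cw ` {1, 2} \<union> Acw ` {1, 2} \<union> Ex ` {1..m - 2},
     tail = (\<lambda>e. case e of Acw i \<Rightarrow> 0 | Cw i \<Rightarrow> 1 | Ex t \<Rightarrow> 1),
     head = (\<lambda>e. case e of Acw i \<Rightarrow> 1 | Cw i \<Rightarrow> 0 | Ex t \<Rightarrow> 0)\<rparr>"

definition rels_one :: "nat \<Rightarrow> (arrow list \<times> arrow list) set" where
  "rels_one m =
    {([Cw 2, Acw 1], [Cw 1, Acw 2]), ([Acw 1, Cw 2], [Acw 2, Cw 1])} \<union>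
    (if m > 2 then {([Ex 1, Acw 1], [Cw 2, Acw 2]), ([Acw 1, Ex 1], [Acw 2, Cw 2])} else {}) \<union>
    (\<Union>t\<in>{2..m - 2}. {([Ex t, Acw 1], [Ex (t - 1), Acw 2]),
                      ([Acw 1, Ex t], [Acw 2, Ex (t - 1)])})"

subsection \<open>The case of at least two entries\<close>

definition num_extra :: "nat list \<Rightarrow> nat" where
  "num_extra \<alpha> = (\<Sum>x\<leftarrow>\<alpha>. x - 2)"

text \<open>
  The numbers \<open>l\<^sub>s\<close> for \<open>0 \<le> s \<le> \<gamma> + 1\<close>, including the tails \<open>l\<^sub>0 = 1\<close> of \<open>k\<^sub>0 = c\<^sub>1\<^sub>0\<close> and
  \<open>l\<^bsub>\<gamma>+1\<^esub> = n\<close> of \<open>k\<^bsub>\<gamma>+1\<^esub> = a\<^sub>n\<^sub>0\<close>.  The latter matters for \<open>u\<^sub>n\<close>, which is \<open>\<gamma> + 1\<close>.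
\<close>

definition extra_tail :: "nat list \<Rightarrow> nat \<Rightarrow> nat" where
  "extra_tail \<alpha> s =
    ([1] @ concat (map (\<lambda>i. replicate (\<alpha> ! (i - 1) - 2) i) [1..<length \<alpha> + 1]) @ [length \<alpha>]) ! s"

definition extra :: "nat list \<Rightarrow> nat \<Rightarrow> arrow" where
  "extra \<alpha> s =
    (if s = 0 then Cw 1 else if s = num_extra \<alpha> + 1 then Acw (length \<alpha>) else Ex s)"

definition quiver_many :: "nat list \<Rightarrow> (nat, arrow) pre_digraph" where
  "quiver_many \<alpha> = (let n = length \<alpha> in
    \<lparr>verts = {0..n},
     arcs = Cw ` {0..n} \<union> Acw ` {0..n} \<union> Ex ` {1..num_extra \<alpha>},
     tail = (\<lambda>e. case e of Cw t \<Rightarrow> t | Acw t \<Rightarrow> t | Ex s \<Rightarrow> extra_tail \<alpha> s),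
     head = (\<lambda>e. case e of Cw t \<Rightarrow> (if t = 0 then n else t - 1)
                         | Acw t \<Rightarrow> (if t = n then 0 else t + 1)
                         | Ex s \<Rightarrow> 0)\<rparr>)"

definition u_idx :: "nat list \<Rightarrow> nat \<Rightarrow> nat" where
  "u_idx \<alpha> i = Max {j. j \<le> num_extra \<alpha> + 1 \<and> extra_tail \<alpha> j = i}"

definition v_idx :: "nat list \<Rightarrow> nat \<Rightarrow> nat" where
  "v_idx \<alpha> i = Min {j. j \<le> num_extra \<alpha> + 1 \<and> extra_tail \<alpha> j = i}"

definition V_idx :: "nat list \<Rightarrow> nat \<Rightarrow> nat" where
  "V_idx \<alpha> i = (if i = 1 then 0 else Max {j. j \<le> num_extra \<alpha> + 1 \<and> extra_tail \<alpha> j < i})"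

text \<open>
  The paths \<open>C\<^sub>0\<^sub>t\<close>, going \<open>0 \<rightarrow> n \<rightarrow> n-1 \<rightarrow> \<dots> \<rightarrow> t\<close>, and \<open>A\<^sub>0\<^sub>t\<close>, going \<open>0 \<rightarrow> 1 \<rightarrow> \<dots> \<rightarrow> t\<close>,
  for \<open>1 \<le> t \<le> n\<close>.
\<close>

definition cw_path :: "nat list \<Rightarrow> nat \<Rightarrow> arrow list" where
  "cw_path \<alpha> t = Cw 0 # map Cw (rev [t + 1..<length \<alpha> + 1])"

definition acw_path :: "nat \<Rightarrow> arrow list" where
  "acw_path t = map Acw [0..<t]"

definition step_first :: "nat list \<Rightarrow> (arrow list \<times> arrow list) set" where
  "step_first \<alpha> =
    (if \<alpha> ! 0 = 2 then {([Cw 1, Acw 0], [Acw 1, Cw 2])}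
     else (\<Union>s\<in>{0..<u_idx \<alpha> 1}.
            {([extra \<alpha> s, Acw 0], [extra \<alpha> (s + 1)] @ cw_path \<alpha> 1),
             ([Acw 0, extra \<alpha> s], cw_path \<alpha> 1 @ [extra \<alpha> (s + 1)])}) \<union>
          {([extra \<alpha> (u_idx \<alpha> 1), Acw 0], [Acw 1, Cw 2])})"

definition step_mid :: "nat list \<Rightarrow> nat \<Rightarrow> (arrow list \<times> arrow list) set" where
  "step_mid \<alpha> t =
    (if \<alpha> ! (t - 1) = 2 then {([Cw t, Acw (t - 1)], [Acw t, Cw (t + 1)])}
     else {([Cw t, Acw (t - 1)], [extra \<alpha> (v_idx \<alpha> t)] @ cw_path \<alpha> t),
           (cw_path \<alpha> t @ [extra \<alpha> (v_idx \<alpha> t)],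
            acw_path (extra_tail \<alpha> (V_idx \<alpha> t)) @ [extra \<alpha> (V_idx \<alpha> t)])} \<union>
          (\<Union>s\<in>{v_idx \<alpha> t..<u_idx \<alpha> t}.
            {([extra \<alpha> s] @ acw_path t, [extra \<alpha> (s + 1)] @ cw_path \<alpha> t),
             (acw_path t @ [extra \<alpha> s], cw_path \<alpha> t @ [extra \<alpha> (s + 1)])}) \<union>
          {([extra \<alpha> (u_idx \<alpha> t)] @ acw_path t, [Acw t, Cw (t + 1)])})"

definition step_last :: "nat list \<Rightarrow> (arrow list \<times> arrow list) set" where
  "step_last \<alpha> = (let n = length \<alpha> in
    if \<alpha> ! (n - 1) = 2 then
      {([Cw n, Acw (n - 1)], [Acw n, Cw 0]),
       ([Cw 0, Acw n], acw_path (extra_tail \<alpha> (V_idx \<alpha> n)) @ [extra \<alpha> (V_idx \<alpha> n)])}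
    else
      {([Cw n, Acw (n - 1)], [extra \<alpha> (v_idx \<alpha> n), Cw 0]),
       ([Cw 0, extra \<alpha> (v_idx \<alpha> n)],
        acw_path (extra_tail \<alpha> (V_idx \<alpha> n)) @ [extra \<alpha> (V_idx \<alpha> n)])} \<union>
      (\<Union>s\<in>{v_idx \<alpha> n..<u_idx \<alpha> n}.
        {([extra \<alpha> s] @ acw_path n, [extra \<alpha> (s + 1), Cw 0]),
         (acw_path n @ [extra \<alpha> s], [Cw 0, extra \<alpha> (s + 1)])}))"

definition rels_many :: "nat list \<Rightarrow> (arrow list \<times> arrow list) set" where
  "rels_many \<alpha> = step_first \<alpha> \<union> (\<Union>t\<in>{1<..<length \<alpha>}. step_mid \<alpha> t) \<union> step_last \<alpha>"

subsection \<open>The algebra\<close>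

definition reconstruction_algebra :: "nat list \<Rightarrow> (nat \<times> arrow list \<Rightarrow> complex) set ring" where
  "reconstruction_algebra \<alpha> =
    (if length \<alpha> = 1 then path_algebra_mod (quiver_one (\<alpha> ! 0)) (rels_one (\<alpha> ! 0))
     else path_algebra_mod (quiver_many \<alpha>) (rels_many \<alpha>))"


section \<open>Prime rings and PI degree\<close>

definition prime_ring :: "('a, 'b) ring_scheme \<Rightarrow> bool" where
  "prime_ring R \<longleftrightarrow> ring R \<and> carrier R \<noteq> {\<zero>\<^bsub>R\<^esub>} \<and>
    (\<forall>I J. ideal I R \<longrightarrow> ideal J R \<longrightarrow> ideal_prod R I J = {\<zero>\<^bsub>R\<^esub>} \<longrightarrow>
      I = {\<zero>\<^bsub>R\<^esub>} \<or> J = {\<zero>\<^bsub>R\<^esub>})"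

definition ring_centre :: "('a, 'b) ring_scheme \<Rightarrow> 'a set" where
  "ring_centre R = {z \<in> carrier R. \<forall>x\<in>carrier R. z \<otimes>\<^bsub>R\<^esub> x = x \<otimes>\<^bsub>R\<^esub> z}"

text \<open>
  \<open>Q\<close>, with the embedding \<open>\<phi>\<close>, is the localisation of the prime ring \<open>R\<close> at the set of nonzero
  elements of its centre (which are regular, as \<open>R\<close> is prime).
\<close>

definition central_quotient_ring ::
    "('a, 'b) ring_scheme \<Rightarrow> ('c, 'd) ring_scheme \<Rightarrow> ('a \<Rightarrow> 'c) \<Rightarrow> bool" where
  "central_quotient_ring R Q \<phi> \<longleftrightarrow>
    ring Q \<and> \<phi> \<in> ring_hom R Q \<and> inj_on \<phi> (carrier R) \<and>
    (\<forall>z \<in> ring_centre R - {\<zero>\<^bsub>R\<^esub>}. \<phi> z \<in> Units Q) \<and>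
    carrier Q = {\<phi> x \<otimes>\<^bsub>Q\<^esub> inv\<^bsub>Q\<^esub> (\<phi> z) |x z. x \<in> carrier R \<and> z \<in> ring_centre R - {\<zero>\<^bsub>R\<^esub>}}"

text \<open>
  By Posner's theorem the quotient ring \<open>Q\<close> of a prime PI ring is its central localisation, a
  central simple algebra of dimension \<open>d\<^sup>2\<close> over its centre; \<open>d\<close> is the PI degree.
  Conversely a prime ring for which this dimension is finite is PI, being a
  subring of \<open>Q\<close>.  The localisation is unique up to isomorphism and can always be realised on
  classes of fractions, i.e. with elements of type \<^typ>\<open>('a \<times> 'a) set\<close>, so that the type chosen
  for \<open>Q\<close> is no restriction.
\<close>

definition has_PI_degree :: "('a, 'b) ring_scheme \<Rightarrow> nat \<Rightarrow> bool" where
  "has_PI_degree R d \<longleftrightarrow> prime_ring R \<and>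
    (\<exists>(Q :: ('a \<times> 'a) set ring) \<phi>. central_quotient_ring R Q \<phi> \<and>
      subfield (ring_centre Q) Q \<and>
      ring.dimension Q (d\<^sup>2) (ring_centre Q) (carrier Q))"

end

theory Submission
  imports Defs "HOL-Algebra.Weak_Morphisms" "HOL-Computational_Algebra.Polynomial_Factorial"
begin

text \<open>
  Give every arrow the exponents of the monomial by which it acts between the special
  Cohen-Macaulay modules: the clockwise arrows are powers of \<open>x\<close>, the anticlockwise ones powers of
  \<open>y\<close>, and the arrows out of a vertex, ordered from clockwise to anticlockwise, form a staircase of
  monomials.  All relations identify parallel paths of equal weight.  Conversely, if the weight of a
  path is divisible by a later step of the staircase at its starting vertex, then the relations move
  its first arrow there; hence parallel paths of equal weight are equal in the algebra.

  So the algebra embeds into the matrices over \<open>\<complex>(x, y)\<close>, with an image that contains the diagonal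
  idempotents and hits every entry position.  Such a subring is prime because the field has no zero
  divisors.  Its centre consists of scalar matrices, and multiplying by a product of cycles
  through all vertices moves every diagonal entry into the centre.  Therefore the central
  localisation has the scaled matrix units as a basis over its centre.
\<close>

section \<open>Congruence of paths\<close>

text \<open>The exponents are forced. Let \<open>C_0t\<close> act as x^(i_t) and \<open>A_0t\<close>
  as y^(j_t). Both sequences solve s_(t+1) = \<alpha>_t s_t - s_(t-1), with j_0 = 0, j_1 = 1 and i_n
  = 1, i_(n+1) = 0; the arrows between neighbouring vertices t, t+1 carry the differences, and
  passing to the next extra arrow at t trades x^(i_t) for y^(j_t).

  The obstacle is that a relation moves a first arrow only if the rest of the path begins with a
  prescribed path, so the rest has to be rewritten beforehand. Its y-weight is large enough for
  this, and it has smaller total weight, which makes an induction on total weight close. Vertex 0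
  needs its own argument: to replace \<open>c_0n\<close> by \<open>a_01\<close>, the path is
  followed clockwise until some other arrow closes a cycle at 0.

  The quivers for n = 1 and n \<ge> 2 are presented differently, so the rewriting is carried out for
  an abstract family of arrows \<open>e t m\<close> that covers both.\<close>

inductive path_cong :: "('e list \<times> 'e list) set \<Rightarrow> 'e list \<Rightarrow> 'e list \<Rightarrow> bool" for S where
  path_cong_rel: "(x, y) \<in> S \<Longrightarrow> path_cong S (u @ x @ v) (u @ y @ v)"
| path_cong_refl [simp, intro]: "path_cong S x x"
| path_cong_sym: "path_cong S x y \<Longrightarrow> path_cong S y x"
| path_cong_trans [trans]: "path_cong S x y \<Longrightarrow> path_cong S y z \<Longrightarrow> path_cong S x z"

lemma path_cong_ctxt: "path_cong S x y \<Longrightarrow> path_cong S (u @ x @ v) (u @ y @ v)"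
proof (induction rule: path_cong.induct)
  case (path_cong_rel x y u' v')
  then show ?case
    using path_cong.path_cong_rel[of x y S "u @ u'" "v' @ v"] by simp
qed (auto intro: path_cong_sym path_cong_trans)

lemma path_cong_append_left: "path_cong S x y \<Longrightarrow> path_cong S (u @ x) (u @ y)"
  using path_cong_ctxt[of S x y u "[]"] by simp

lemma path_cong_append_right: "path_cong S x y \<Longrightarrow> path_cong S (x @ v) (y @ v)"
  using path_cong_ctxt[of S x y "[]" v] by simp

lemma path_cong_Cons: "path_cong S x y \<Longrightarrow> path_cong S (e # x) (e # y)"
  using path_cong_ctxt[of S x y "[e]" "[]"] by simp

abbreviation path_weight :: "('e \<Rightarrow> nat) \<Rightarrow> 'e list \<Rightarrow> nat" where
  "path_weight f x \<equiv> sum_list (map f x)"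

text \<open>Nonempty sides matter: a list of arrows determines its end vertices only if it is
  nonempty, and congruence is defined on bare lists without a start vertex.\<close>

locale weighted_relations = wf_digraph G
  for G :: "('v, 'e) pre_digraph" +
  fixes S :: "('e list \<times> 'e list) set" and p q :: "'e \<Rightarrow> nat"
  assumes rel_ne: "(x, y) \<in> S \<Longrightarrow> x \<noteq> [] \<and> y \<noteq> []"
    and rel_parallel: "(x, y) \<in> S \<Longrightarrow> \<exists>u v. awalk u x v \<and> awalk u y v"
    and rel_p: "(x, y) \<in> S \<Longrightarrow> path_weight p x = path_weight p y"
    and rel_q: "(x, y) \<in> S \<Longrightarrow> path_weight q x = path_weight q y"
begin

lemma path_cong_p: "path_cong S x y \<Longrightarrow> path_weight p x = path_weight p y"
  by (induction rule: path_cong.induct) (auto simp: rel_p)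

lemma path_cong_q: "path_cong S x y \<Longrightarrow> path_weight q x = path_weight q y"
  by (induction rule: path_cong.induct) (auto simp: rel_q)

lemma awalk_ne_ends:
  assumes "awalk u x v" "x \<noteq> []"
  shows "u = tail G (hd x)" "v = head G (last x)"
proof -
  show "u = tail G (hd x)"
    using assms by (cases x) (auto simp: awalk_Cons_iff)
  show "v = head G (last x)"
    using assms awlast_if_cas[of u x v] by (auto simp: awalk_def awalk_verts_conv)
qed

text \<open>A nonempty list is a walk between at most one pair of vertices. So two sides that are
  parallel somewhere can be exchanged in every context, including contexts in which neither is a
  walk.\<close>

lemma path_cong_awalk_iff: "path_cong S x y \<Longrightarrow> awalk u x v \<longleftrightarrow> awalk u y v"
proof (induction rule: path_cong.induct)
  case (path_cong_rel x y a b)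
  obtain s t where st: "awalk s x t" "awalk s y t"
    using rel_parallel[OF path_cong_rel] by blast
  have ne: "x \<noteq> []" "y \<noteq> []"
    using rel_ne[OF path_cong_rel] by auto
  have "awalk u' x v' \<longleftrightarrow> awalk u' y v'" for u' v'
    using st ne awalk_ne_ends by metis
  moreover have "awlast u' x = awlast u' y" for u'
    using st ne by (simp add: awalk_ne_ends(2) awalk_verts_conv) (metis awalk_ne_ends(2))
  ultimately show ?case
    by simp
qed auto

end

section \<open>Cyclic quivers with ordered outgoing arrows\<close>

definition cw_path_from :: "(nat \<Rightarrow> nat \<Rightarrow> 'e) \<Rightarrow> nat \<Rightarrow> nat \<Rightarrow> 'e list" where
  "cw_path_from e n t = e 0 0 # map (\<lambda>s. e s 0) (rev [t + 1..<n + 1])"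

definition acw_path_from :: "(nat \<Rightarrow> nat \<Rightarrow> 'e) \<Rightarrow> (nat \<Rightarrow> nat) \<Rightarrow> nat \<Rightarrow> 'e list" where
  "acw_path_from e d t = map (\<lambda>s. e s (d s)) [0..<t]"

lemma cw_path_from_top [simp]: "cw_path_from e n n = [e 0 0]"
  by (simp add: cw_path_from_def)

lemma cw_path_from_step: "t < n \<Longrightarrow> cw_path_from e n t = cw_path_from e n (t + 1) @ [e (t + 1) 0]"
  by (simp add: cw_path_from_def upt_rec[of "Suc t"] del: upt_Suc)

lemma acw_path_from_0 [simp]: "acw_path_from e d 0 = []"
  and acw_path_from_Suc [simp]: "acw_path_from e d (Suc t) = acw_path_from e d t @ [e t (d t)]"
  by (simp_all add: acw_path_from_def)

text \<open>
  \<open>e t 0, \<dots>, e t (d t)\<close> are the arrows out of the vertex \<open>t\<close>: first the clockwise one, then the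
  extra ones, finally the anticlockwise one.
\<close>

locale staircase_arrows = wf_digraph G
  for G :: "(nat, 'e) pre_digraph" +
  fixes n :: nat and d :: "nat \<Rightarrow> nat" and e :: "nat \<Rightarrow> nat \<Rightarrow> 'e"
  assumes n_pos: "1 \<le> n"
    and verts_eq: "verts G = {0..n}"
    and arcs_eq: "arcs G = {e t m |t m. t \<le> n \<and> m \<le> d t}"
    and d_0: "d 0 = 1"
    and d_pos: "t \<le> n \<Longrightarrow> 1 \<le> d t"
    and tail_e: "t \<le> n \<Longrightarrow> m \<le> d t \<Longrightarrow> tail G (e t m) = t"
    and head_cw_0: "head G (e 0 0) = n"
    and head_cw: "1 \<le> t \<Longrightarrow> t \<le> n \<Longrightarrow> head G (e t 0) = t - 1"
    and head_acw: "t < n \<Longrightarrow> head G (e t (d t)) = t + 1"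
    and head_extra: "1 \<le> t \<Longrightarrow> t \<le> n \<Longrightarrow> 0 < m \<Longrightarrow> m \<le> d t \<Longrightarrow> (t < n \<Longrightarrow> m < d t) \<Longrightarrow>
        head G (e t m) = 0"
begin

lemma awalk_arrow: "t \<le> n \<Longrightarrow> m \<le> d t \<Longrightarrow> awalk t (e t m # x) v \<longleftrightarrow> awalk (head G (e t m)) x v"
  using tail_e[of t m] by (auto simp: awalk_Cons_iff arcs_eq)

lemma awalk_acw: "t \<le> n \<Longrightarrow> awalk 0 (acw_path_from e d t) t"
proof (induction t)
  case (Suc t)
  have "awlast 0 (acw_path_from e d t) = t"
    using Suc by (auto elim: awalkE)
  moreover have "awalk t [e t (d t)] (Suc t)"
    using Suc.prems awalk_arrow[of t "d t" "[]"] head_acw[of t] by (simp add: awalk_Nil_iff verts_eq)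
  ultimately show ?case
    using Suc by simp
qed (simp add: awalk_Nil_iff verts_eq)

lemma awalk_cw: "t \<le> n \<Longrightarrow> awalk 0 (cw_path_from e n t) t"
proof (induction t rule: inc_induct)
  case base
  then show ?case
    using awalk_arrow[of 0 0 "[]"] head_cw_0 by (simp add: awalk_Nil_iff verts_eq)
next
  case (step t)
  have "awlast 0 (cw_path_from e n (Suc t)) = Suc t"
    using step by (auto elim: awalkE)
  moreover have "awalk (Suc t) [e (Suc t) 0] t"
    using step awalk_arrow[of "Suc t" 0 "[]"] head_cw[of "Suc t"] by (simp add: awalk_Nil_iff verts_eq)
  ultimately show ?case
    using step cw_path_from_step[of t n e] by simp
qed

text \<open>Clockwise arrows lead down to 0, anticlockwise ones from 0 up to any vertex.\<close>

lemma strongly_connected: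
  assumes "u \<in> verts G" "v \<in> verts G"
  shows "\<exists>x. awalk u x v"
proof -
  have "\<exists>x. awalk u x 0" if "u \<le> n"
    using that
  proof (induction u)
    case (Suc u)
    then obtain x where "awalk u x 0"
      by auto
    then have "awalk (Suc u) (e (Suc u) 0 # x) 0"
      using Suc.prems awalk_arrow[of "Suc u" 0] head_cw[of "Suc u"] by simp
    then show ?case
      by blast
  qed (auto intro: exI[of _ "[]"] simp: awalk_Nil_iff verts_eq)
  then obtain x where x: "awalk u x 0"
    using assms(1) verts_eq by auto
  moreover have "awalk 0 (acw_path_from e d v) v"
    using assms(2) awalk_acw verts_eq by simp
  moreover have "awlast u x = 0"
    using x by (auto elim: awalkE)
  ultimately have "awalk u (x @ acw_path_from e d v) v"
    by simp
  then show ?thesis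
    by blast
qed

end

text \<open>Of a rewriting only the first arrow of the result is recorded, the remainder being an
  unspecified \<open>x\<close>: the induction merely aligns first arrows and then compares tails.
  The conditions on \<open>q\<close> say that raising an arrow by one step increases
  \<open>q\<close> by exactly the weight of the path that has to follow it.\<close>

locale staircase_quiver = weighted_relations G S p q + staircase_arrows G n d e
  for G :: "(nat, 'e) pre_digraph" and S :: "('e list \<times> 'e list) set" and p q :: "'e \<Rightarrow> nat"
    and n :: nat and d :: "nat \<Rightarrow> nat" and e :: "nat \<Rightarrow> nat \<Rightarrow> 'e" +
  assumes pq_pos: "t \<le> n \<Longrightarrow> m \<le> d t \<Longrightarrow> 0 < p (e t m) + q (e t m)"
    and q_cw: "t \<le> n \<Longrightarrow> q (e t 0) = 0"
    and q_0: "q (e 0 1) = 1"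
    and q_Suc_0: "1 \<le> t \<Longrightarrow> t \<le> n \<Longrightarrow> q (e t 1) = q (e (t - 1) (d (t - 1)))"
    and q_Suc: "1 \<le> t \<Longrightarrow> t \<le> n \<Longrightarrow> 0 < m \<Longrightarrow> m < d t \<Longrightarrow>
        q (e t (Suc m)) = q (e t m) + path_weight q (acw_path_from e d t)"
    and step_0: "1 \<le> t \<Longrightarrow> t \<le> n \<Longrightarrow>
        \<exists>x. path_cong S [e t 0, e (t - 1) (d (t - 1))] (e t 1 # x)"
    and step_Suc: "1 \<le> t \<Longrightarrow> t \<le> n \<Longrightarrow> 0 < m \<Longrightarrow> m < d t \<Longrightarrow>
        \<exists>x. path_cong S (e t m # acw_path_from e d t) (e t (Suc m) # x)"
    and cycle_0: "1 \<le> t \<Longrightarrow> t \<le> n \<Longrightarrow> 0 < m \<Longrightarrow> m \<le> d t \<Longrightarrow> (t < n \<Longrightarrow> m < d t) \<Longrightarrow>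
        \<exists>x. path_cong S (cw_path_from e n t @ [e t m]) (e 0 1 # x)"
begin

abbreviation cw_to :: "nat \<Rightarrow> 'e list" where
  "cw_to t \<equiv> cw_path_from e n t"

abbreviation acw_to :: "nat \<Rightarrow> 'e list" where
  "acw_to t \<equiv> acw_path_from e d t"

text \<open>Beyond \<open>cycle_0\<close> this covers the anticlockwise arrow at t < n. Together
  with the last arrow of \<open>cw_to t\<close> it forms the left side of \<open>step_0\<close> at t
  + 1, which reduces the claim to the arrow \<open>e (t + 1) 1\<close>; hence the induction on n -
  t.\<close>

lemma cw_to_extra:
  assumes "1 \<le> t" "t \<le> n" "0 < m" "m \<le> d t"
  shows "\<exists>x. path_cong S (cw_to t @ [e t m]) (e 0 1 # x)"
  using assms
proof (induction "n - t" arbitrary: t m)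
  case 0
  then show ?case
    using cycle_0[of t m] by simp
next
  case (Suc k)
  show ?case
  proof (cases "m = d t")
    case False
    then show ?thesis
      using cycle_0[of t m] Suc.prems by simp
  next
    case m: True
    have tn: "t < n"
      using Suc.hyps(2) by simp
    obtain x where x: "path_cong S [e (t + 1) 0, e t (d t)] (e (t + 1) 1 # x)"
      using step_0[of "t + 1"] tn by auto
    obtain y where y: "path_cong S (cw_to (t + 1) @ [e (t + 1) 1]) (e 0 1 # y)"
      using Suc.hyps(1)[of "t + 1" 1] Suc.hyps(2) tn d_pos[of "t + 1"] by fastforce
    have "path_cong S (cw_to t @ [e t m]) (cw_to (t + 1) @ (e (t + 1) 1 # x))"
      using path_cong_append_left[OF x, of "cw_to (t + 1)"] cw_path_from_step[OF tn, of e] m by simp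
    also have "path_cong S \<dots> (e 0 1 # y @ x)"
      using path_cong_append_right[OF y, of x] by simp
    finally show ?thesis
      by blast
  qed
qed

text \<open>Positivity at the top arrow rules out empty paths when a first arrow is to be raised;
  monotonicity lets it be raised one step at a time.\<close>

lemma q_acw_pos: "t \<le> n \<Longrightarrow> 1 \<le> q (e t (d t))" and q_mono: "t \<le> n \<Longrightarrow> m \<le> m' \<Longrightarrow> m' \<le> d t \<Longrightarrow> q (e t m) \<le> q (e t m')"
proof -
  have mono: "q (e t m) \<le> q (e t m')" if "t \<le> n" "m \<le> m'" "m' \<le> d t" for t m m'
    using that(2,3)
  proof (induction m' rule: dec_induct)
    case (step k)
    have "q (e t k) \<le> q (e t (Suc k))"
    proof (cases "t = 0 \<or> k = 0")
      case True
      then show ?thesis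
        using step d_0 q_cw[of t] that(1) by auto
    next
      case False
      then show ?thesis
        using q_Suc[of t k] that(1) step.prems by simp
    qed
    then show ?case
      using step by simp
  qed simp
  then show "t \<le> n \<Longrightarrow> m \<le> m' \<Longrightarrow> m' \<le> d t \<Longrightarrow> q (e t m) \<le> q (e t m')" .
  show "t \<le> n \<Longrightarrow> 1 \<le> q (e t (d t))"
  proof (induction t)
    case 0
    then show ?case
      using d_0 q_0 by simp
  next
    case (Suc t)
    then have "1 \<le> q (e (Suc t) 1)"
      using q_Suc_0[of "Suc t"] by simp
    also have "\<dots> \<le> q (e (Suc t) (d (Suc t)))"
      using mono[of "Suc t" 1 "d (Suc t)"] Suc.prems d_pos[of "Suc t"] by simp
    finally show ?case .
  qed
qed

lemma first_arrow:
  assumes "awalk t (f # x) v"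
  obtains m where "t \<le> n" "m \<le> d t" "f = e t m"
proof -
  have f: "f \<in> arcs G" "tail G f = t"
    using assms by (auto simp: awalk_Cons_iff)
  then obtain s m where sm: "f = e s m" "s \<le> n" "m \<le> d s"
    by (auto simp: arcs_eq)
  then have "s = t"
    using f tail_e by simp
  then show thesis
    using sm that by blast
qed

abbreviation total :: "'e list \<Rightarrow> nat" where
  "total x \<equiv> path_weight p x + path_weight q x"

lemma path_cong_total: "path_cong S x y \<Longrightarrow> total x = total y"
  by (simp add: path_cong_p path_cong_q)

text \<open>
  The arrows out of a vertex form a staircase: the \<open>q\<close>-weight of a path decides how far its first
  arrow can be moved up.
\<close>

lemma raise_first_arrow:
  shows "awalk t f v \<Longrightarrow> f = e t m # f' \<Longrightarrow> 1 \<le> t \<Longrightarrow> m \<le> m' \<Longrightarrow> m' \<le> d t \<Longrightarrow>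
      q (e t m') \<le> path_weight q f \<Longrightarrow> \<exists>x. path_cong S f (e t m' # x)"
    and "awalk 0 f v \<Longrightarrow> 1 \<le> path_weight q f \<Longrightarrow> \<exists>x. path_cong S f (e 0 1 # x)"
proof (induction "total f" arbitrary: f t m m' f' v rule: less_induct)
  case less
  \<comment> \<open>Both claims of the induction hypothesis merged, for raising to the top arrow: at
    s = 0 this is the second claim because \<open>d 0 = 1\<close>, elsewhere the first.\<close>
  have IH: "\<exists>x. path_cong S g (e s (d s) # x)"
    if g: "total g < total f" "awalk s g w" "q (e s (d s)) \<le> path_weight q g" "s \<le> n" for g s w
  proof (cases "s = 0")
    case True
    then show ?thesis
      using less.hyps(2)[of g w] g d_0 q_0 by simp
  next
    case False
    have "g \<noteq> []"
      using g(3) q_acw_pos[OF g(4)] by auto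
    then obtain h g' where g': "g = h # g'"
      by (cases g) auto
    obtain k where k: "k \<le> d s" "h = e s k"
      using first_arrow g(2) unfolding g' by blast
    show ?thesis
      using less.hyps(1)[OF g(1,2), of k g' "d s"] g' k g False by simp
  qed
  \<comment> \<open>The anticlockwise path is split off arrow by arrow; every remainder keeps enough
    \<open>q\<close>-weight for the arrows still missing.\<close>
  have IH_acw: "\<exists>x. path_cong S g (acw_to s @ x)"
    if "total g < total f" "awalk 0 g w" "path_weight q (acw_to s) \<le> path_weight q g" "s \<le> n" for g s w
    using that(3,4)
  proof (induction s)
    case (Suc s)
    then obtain x where x: "path_cong S g (acw_to s @ x)"
      by auto
    have "awalk 0 (acw_to s @ x) w"
      using path_cong_awalk_iff[OF x] that(2) by simp
    moreover have "awlast 0 (acw_to s) = s"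
      using Suc.prems head_acw by (cases s) (auto simp: awalk_verts_conv)
    ultimately have wx: "awalk s x w"
      by (auto simp: awalk_append_iff)
    have "q (e s (d s)) \<le> path_weight q x"
      using Suc.prems path_cong_q[OF x] by simp
    moreover have "total x < total f"
      using path_cong_total[OF x] that(1) by simp
    ultimately obtain y where "path_cong S x (e s (d s) # y)"
      using IH[of x s w] wx Suc.prems by auto
    then have "path_cong S (acw_to s @ x) (acw_to (Suc s) @ y)"
      using path_cong_append_left by fastforce
    then show ?case
      using x path_cong_trans by blast
  qed auto
  {
    case 1
    have tn: "t \<le> n"
      using 1(1) verts_eq by (auto simp: awalk_def)
    have "\<exists>x. path_cong S f (e t k # x)" if "m \<le> k" "k \<le> m'" for k
      using that
    proof (induction k rule: dec_induct)
      case base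
      then show ?case
        using 1(2) by blast
    next
      case (step k)
      then obtain x where x: "path_cong S f (e t k # x)"
        by auto
      \<comment> \<open>\<open>P\<close> is what must follow \<open>e t k\<close> for a relation to
        turn it into \<open>e t (Suc k)\<close>. Its \<open>q\<close>-weight is the increase of
        \<open>q\<close>, so the rest \<open>x\<close> has enough \<open>q\<close>-weight to be
        rewritten to begin with \<open>P\<close>; as \<open>x\<close> has smaller total weight than
        \<open>f\<close>, the induction hypothesis does this.\<close>
      define P where "P = (if k = 0 then [e (t - 1) (d (t - 1))] else acw_to t)"
      have k: "k < d t"
        using step 1(5) by simp
      have wx: "awalk (head G (e t k)) x v"
        using path_cong_awalk_iff[OF x] 1(1) by (simp add: awalk_Cons_iff)
      have qP: "q (e t (Suc k)) = q (e t k) + path_weight q P"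
        using q_Suc[of t k] q_Suc_0[of t] q_cw[of t] 1(3) tn k by (simp add: P_def)
      have "q (e t (Suc k)) \<le> q (e t m')"
        using q_mono[OF tn, of "Suc k" m'] step 1(5) by simp
      then have qx: "path_weight q P \<le> path_weight q x"
        using 1(6) qP path_cong_q[OF x] by simp
      have tot: "total x < total f"
        using path_cong_total[OF x] pq_pos[of t k] tn k by simp
      have "\<exists>y. path_cong S x (P @ y)"
      proof (cases "k = 0")
        case True
        then show ?thesis
          using IH[OF tot, of "t - 1" v] wx head_cw[OF 1(3) tn] qx tn by (simp add: P_def)
      next
        case False
        then have "head G (e t k) = 0"
          using head_extra[of t k] 1(3) tn k by simp
        then show ?thesis
          using IH_acw[OF tot, of v t] wx qx tn False by (simp add: P_def)
      qed
      then obtain y where y: "path_cong S x (P @ y)"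
        by blast
      have "\<exists>z. path_cong S (e t k # P) (e t (Suc k) # z)"
        using step_0[OF 1(3) tn] step_Suc[OF 1(3) tn _ k] by (auto simp: P_def)
      then obtain z where z: "path_cong S (e t k # P) (e t (Suc k) # z)"
        by blast
      note x
      also have "path_cong S (e t k # x) ((e t k # P) @ y)"
        using path_cong_Cons[OF y] by simp
      also have "path_cong S \<dots> (e t (Suc k) # z @ y)"
        using path_cong_append_right[OF z] by simp
      finally show ?case
        by blast
    qed
    then show ?case
      using 1(4) by blast
  next
    case 2
    \<comment> \<open>After a clockwise path from 0 to s, the next arrow either closes a cycle in
      the sense of \<open>cw_to_extra\<close>, or is clockwise and prolongs the path, until a full
      turn arrives at 0 again.\<close>
    have cw: "\<exists>x. path_cong S f (e 0 1 # x)"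
      if "path_cong S f (cw_to s @ g)" "awalk s g w" "1 \<le> path_weight q g" "1 \<le> s" "s \<le> n" for s g w
      using that
    proof (induction g arbitrary: s)
      case (Cons h g)
      obtain k where k: "k \<le> d s" "h = e s k"
        using first_arrow Cons.prems(2) by blast
      show ?case
      proof (cases "k = 0")
        case False
        then obtain x where "path_cong S (cw_to s @ [e s k]) (e 0 1 # x)"
          using cw_to_extra[of s k] Cons.prems k by auto
        from path_cong_append_right[OF this, of g] have "path_cong S (cw_to s @ h # g) (e 0 1 # x @ g)"
          using k by simp
        then show ?thesis
          using Cons.prems(1) path_cong_trans by blast
      next
        case True
        then have wg: "awalk (s - 1) g w"
          using Cons.prems(2,4,5) k head_cw[of s] by (simp add: awalk_Cons_iff)
        have qg: "1 \<le> path_weight q g"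
          using Cons.prems(3,5) k True q_cw[of s] by simp
        have cw1: "cw_to (s - 1) = cw_to s @ [e s 0]"
          using cw_path_from_step[of "s - 1" n e] Cons.prems(4,5) by auto
        show ?thesis
        proof (cases "s = 1")
          case False
          then show ?thesis
            using Cons.IH[of "s - 1"] wg qg Cons.prems cw1 k True by simp
        next
          \<comment> \<open>A full clockwise turn. The rest starts at 0 and is lighter, so it can be
            made to begin with \<open>e 0 1\<close>; then \<open>step_0\<close> at vertex 1 turns
            the last clockwise arrow into \<open>e 1 1\<close>, to which \<open>cw_to_extra\<close>
            applies.\<close>
          case s: True
          have "total g < total f"
            using path_cong_total[OF Cons.prems(1)] pq_pos[of s 0] Cons.prems(5) k True by auto
          then obtain x where x: "path_cong S g (e 0 1 # x)"
            using less.hyps(2)[of g w] wg qg s by auto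
          obtain y where y: "path_cong S [e 1 0, e 0 1] (e 1 1 # y)"
            using step_0[of 1] n_pos d_0 by auto
          obtain z where z: "path_cong S (cw_to 1 @ [e 1 1]) (e 0 1 # z)"
            using cw_to_extra[of 1 1] n_pos d_pos[of 1] by auto
          note Cons.prems(1)
          also have "path_cong S (cw_to s @ h # g) ((cw_to 1 @ [e 1 0]) @ e 0 1 # x)"
            using path_cong_append_left[OF x, of "cw_to 1 @ [e 1 0]"] k s True by simp
          also have "path_cong S \<dots> (cw_to 1 @ (e 1 1 # y) @ x)"
            using path_cong_ctxt[OF y, of "cw_to 1" x] by simp
          also have "path_cong S \<dots> (e 0 1 # z @ y @ x)"
            using path_cong_append_right[OF z, of "y @ x"] by simp
          finally show ?thesis
            by blast
        qed
      qed
    qed auto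
    obtain w where w: "awalk 0 f w"
      using 2(1) by blast
    obtain h g where f: "f = h # g"
      using 2(2) by (cases f) auto
    obtain k where k: "k \<le> d 0" "h = e 0 k"
      using first_arrow 2(1) unfolding f by blast
    show ?case
    proof (cases "k = 0")
      case True
      have "awalk n g w"
        using w head_cw_0 unfolding f k(2) True by (simp add: awalk_Cons_iff)
      moreover have "path_cong S f (cw_to n @ g)"
        using f k True by simp
      moreover have "1 \<le> path_weight q g"
        using 2(2) f k True q_cw[of 0] by simp
      ultimately show ?thesis
        using cw[of n g w] n_pos by simp
    next
      case False
      then have "k = 1"
        using k d_0 by simp
      then show ?thesis
        using f k by blast
    qed
  }
qed

text \<open>If the first arrows differ, the lower one can be raised to the higher one: the common
  \<open>q\<close>-weight is at least that of the higher arrow, which occurs in the other path. With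
  equal first arrows the tails are parallel, of equal weights and lighter.\<close>

theorem parallel_paths_cong:
  assumes "awalk t f v" "awalk t g v"
    and "path_weight p f = path_weight p g" "path_weight q f = path_weight q g"
  shows "path_cong S f g"
  using assms
proof (induction "total f" arbitrary: f g t rule: less_induct)
  case less
  have no_tot: "x = []" if "awalk s x w" "total x = 0" for s x w
  proof (rule ccontr)
    assume "x \<noteq> []"
    then obtain h y where x: "x = h # y"
      by (cases x) auto
    with that(1) have "awalk s (h # y) w"
      by simp
    then obtain m where "s \<le> n" "m \<le> d s" "h = e s m"
      by (rule first_arrow)
    then show False
      using pq_pos[of s m] that(2) x by simp
  qed
  show ?case
  proof (cases "total f = 0")
    case True
    then have "f = []" "g = []"
      using no_tot[OF less.prems(1)] no_tot[OF less.prems(2)] less.prems(3,4) by simp_all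
    then show ?thesis
      by simp
  next
    case False
    then have "f \<noteq> []" "g \<noteq> []"
      using less.prems by auto
    then obtain h1 h2 f' g' where fg: "f = h1 # f'" "g = h2 # g'"
      by (cases f; cases g) auto
    obtain m where m: "t \<le> n" "m \<le> d t" "h1 = e t m"
      using first_arrow less.prems(1) unfolding fg by blast
    obtain k where k: "k \<le> d t" "h2 = e t k"
      using first_arrow less.prems(2) unfolding fg by blast
    have same: "path_cong S (e t i # x) (e t i # y)"
      if "awalk t (e t i # x) v" "awalk t (e t i # y) v" "i \<le> d t"
        "total (e t i # x) = total f"
        "path_weight p (e t i # x) = path_weight p (e t i # y)"
        "path_weight q (e t i # x) = path_weight q (e t i # y)" for i x y
    proof -
      have "total x < total f"
        using that(4) pq_pos[OF m(1) that(3)] by simp linarith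
      then have "path_cong S x y"
        using less.hyps[of x "head G (e t i)" y] that by (auto simp: awalk_Cons_iff)
      then show ?thesis
        by (rule path_cong_Cons)
    qed
    \<comment> \<open>Stated for arbitrary \<open>x\<close>, \<open>y\<close> because it is applied
      to the two paths in either order.\<close>
    have raise: "path_cong S x y"
      if xy: "x = e t i # x'" "y = e t j # y'" "i < j" "j \<le> d t"
        "awalk t x v" "awalk t y v" "total x = total f"
        "path_weight p x = path_weight p y" "path_weight q x = path_weight q y" for x y x' y' i j
    proof -
      have "\<exists>z. path_cong S x (e t j # z)"
      proof (cases "t = 0")
        case True
        then have "j = 1"
          using xy d_0 by simp
        then show ?thesis
          using raise_first_arrow(2)[of x v] xy(2,5,9) True q_0 by simp
      next
        case False
        then show ?thesis
          using raise_first_arrow(1)[OF xy(5,1)] xy(2,3,4,9) by simp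
      qed
      then obtain z where z: "path_cong S x (e t j # z)"
        by blast
      have "path_cong S (e t j # z) (e t j # y')"
      proof (rule same)
        show "awalk t (e t j # z) v"
          using path_cong_awalk_iff[OF z] xy(5) by blast
        show "awalk t (e t j # y') v"
          using xy(2,6) by blast
        show "total (e t j # z) = total f"
          using path_cong_total[OF z] xy(7) by (rule trans[OF sym])
        show "path_weight p (e t j # z) = path_weight p (e t j # y')"
          using path_cong_p[OF z] xy(8) unfolding xy(2) by (rule trans[OF sym])
        show "path_weight q (e t j # z) = path_weight q (e t j # y')"
          using path_cong_q[OF z] xy(9) unfolding xy(2) by (rule trans[OF sym])
      qed (rule xy(4))
      then show ?thesis
        using z xy(2) path_cong_trans by blast
    qed
    note f = fg(1)[unfolded m(3)] and g = fg(2)[unfolded k(2)]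
    note prems = less.prems
    have tot: "total g = total f"
      using prems(3,4) by (rule arg_cong2[OF sym sym])
    consider "m < k" | "m = k" | "k < m"
      by linarith
    then show ?thesis
    proof cases
      case 1
      show ?thesis
        by (rule raise[OF f g 1 k(1) prems(1,2) refl prems(3,4)])
    next
      case 2
      show ?thesis
        using same[of m f' g'] prems m(2) unfolding f g 2 by blast
    next
      case 3
      have "path_cong S g f"
        by (rule raise[OF g f 3 m(2) prems(2,1) tot prems(3,4)[symmetric]])
      then show ?thesis
        by (rule path_cong_sym)
    qed
  qed
qed

end

section \<open>Subrings of matrix rings over a field\<close>

text \<open>Rows and columns are indexed by the vertices themselves. Entries outside
  \<open>V\<close> vanish, so that equality of matrices is equality of functions.\<close>

definition matrix_ring :: "'v set \<Rightarrow> ('v \<Rightarrow> 'v \<Rightarrow> 'f::field) ring" where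
  "matrix_ring V =
    \<lparr>carrier = {M. \<forall>i j. M i j \<noteq> 0 \<longrightarrow> i \<in> V \<and> j \<in> V},
     monoid.mult = (\<lambda>M N i j. \<Sum>k\<in>V. M i k * N k j),
     one = (\<lambda>i j. if i = j \<and> i \<in> V then 1 else 0),
     zero = (\<lambda>_ _. 0),
     add = (\<lambda>M N i j. M i j + N i j)\<rparr>"

definition single_entry :: "'v \<Rightarrow> 'v \<Rightarrow> 'f \<Rightarrow> 'v \<Rightarrow> 'v \<Rightarrow> 'f::field" where
  "single_entry i j c = (\<lambda>k l. if k = i \<and> l = j then c else 0)"

definition scalar_matrix :: "'v set \<Rightarrow> 'f \<Rightarrow> 'v \<Rightarrow> 'v \<Rightarrow> 'f::field" where
  "scalar_matrix V c = (\<lambda>i j. if i = j \<and> i \<in> V then c else 0)"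

lemma matrix_ring_simps [simp]:
  "M \<in> carrier (matrix_ring V) \<longleftrightarrow> (\<forall>i j. M i j \<noteq> 0 \<longrightarrow> i \<in> V \<and> j \<in> V)"
  "M \<otimes>\<^bsub>matrix_ring V\<^esub> N = (\<lambda>i j. \<Sum>k\<in>V. M i k * N k j)"
  "\<one>\<^bsub>matrix_ring V\<^esub> = scalar_matrix V 1"
  "\<zero>\<^bsub>matrix_ring V\<^esub> = (\<lambda>_ _. 0)"
  "M \<oplus>\<^bsub>matrix_ring V\<^esub> N = (\<lambda>i j. M i j + N i j)"
  by (simp_all add: matrix_ring_def scalar_matrix_def)

lemma single_entry_mult:
  "finite V \<Longrightarrow> j \<in> V \<Longrightarrow> (\<Sum>k\<in>V. single_entry i j c a k * M k b) = (if a = i then c * M j b else 0)"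
  "finite V \<Longrightarrow> i \<in> V \<Longrightarrow> (\<Sum>k\<in>V. M a k * single_entry i j c k b) = (if b = j then M a i * c else 0)"
  by (auto simp: single_entry_def if_distrib[of "\<lambda>x. x * _"] if_distrib[of "\<lambda>x. _ * x"] sum.If_cases
      conj_commute cong: if_cong conj_cong)

lemma scalar_matrix_mult:
  "finite V \<Longrightarrow> i \<in> V \<Longrightarrow> (\<Sum>k\<in>V. scalar_matrix V c i k * M k j) = c * M i j"
  "finite V \<Longrightarrow> j \<in> V \<Longrightarrow> (\<Sum>k\<in>V. M i k * scalar_matrix V c k j) = M i j * c"
  by (auto simp: scalar_matrix_def if_distrib[of "\<lambda>x. x * _"] if_distrib[of "\<lambda>x. _ * x"] sum.If_cases
      conj_commute cong: if_cong conj_cong)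

lemma scalar_matrix_central: "finite V \<Longrightarrow> M \<in> carrier (matrix_ring V) \<Longrightarrow>
    scalar_matrix V c \<otimes>\<^bsub>matrix_ring V\<^esub> M = (\<lambda>i j. c * M i j) \<and>
    M \<otimes>\<^bsub>matrix_ring V\<^esub> scalar_matrix V c = (\<lambda>i j. c * M i j)"
proof -
  assume fin: "finite V" and M: "M \<in> carrier (matrix_ring V)"
  have "(\<Sum>k\<in>V. scalar_matrix V c i k * M k j) = c * M i j \<and>
      (\<Sum>k\<in>V. M i k * scalar_matrix V c k j) = c * M i j" for i j
  proof (cases "i \<in> V \<and> j \<in> V")
    case False
    have z: "\<And>a b. \<not> (a \<in> V \<and> b \<in> V) \<Longrightarrow> M a b = 0"
      using M unfolding matrix_ring_simps by blast
    have "(\<Sum>k\<in>V. scalar_matrix V c i k * M k j) = 0" "(\<Sum>k\<in>V. M i k * scalar_matrix V c k j) = 0"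
      using False by (auto intro!: sum.neutral simp: scalar_matrix_def z)
    then show ?thesis
      using z[OF False] by simp
  qed (simp add: scalar_matrix_mult[OF fin])
  then show ?thesis
    by (simp add: fun_eq_iff)
qed

lemma ring_matrix_ring:
  fixes V :: "'v set"
  assumes V: "finite V"
  shows "ring (matrix_ring V :: ('v \<Rightarrow> 'v \<Rightarrow> 'f::field) ring)" (is "ring ?R")
proof (rule ringI)
  show "abelian_group ?R"
  proof (rule abelian_groupI)
    fix M :: "'v \<Rightarrow> 'v \<Rightarrow> 'f" assume "M \<in> carrier (matrix_ring V)"
    then have "(\<lambda>i j. - M i j) \<in> carrier (matrix_ring V)"
      by simp
    then show "\<exists>N\<in>carrier (matrix_ring V). N \<oplus>\<^bsub>matrix_ring V\<^esub> M = \<zero>\<^bsub>matrix_ring V\<^esub>"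
      by (intro bexI[of _ "\<lambda>i j. - M i j"]) auto
  next
    fix M N :: "'v \<Rightarrow> 'v \<Rightarrow> 'f" assume "M \<in> carrier (matrix_ring V)" "N \<in> carrier (matrix_ring V)"
    then show "M \<oplus>\<^bsub>matrix_ring V\<^esub> N \<in> carrier (matrix_ring V)"
      by simp (metis add_0)
  qed (auto simp: add.assoc add.commute fun_eq_iff)
  show "monoid ?R"
  proof (rule monoidI)
    fix M N :: "'v \<Rightarrow> 'v \<Rightarrow> 'f" assume MN: "M \<in> carrier (matrix_ring V)" "N \<in> carrier (matrix_ring V)"
    show "M \<otimes>\<^bsub>matrix_ring V\<^esub> N \<in> carrier (matrix_ring V)"
    proof (simp, intro allI impI)
      fix i j assume "(\<Sum>k\<in>V. M i k * N k j) \<noteq> 0"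
      then obtain k where "M i k * N k j \<noteq> 0"
        by (meson sum.neutral)
      then show "i \<in> V \<and> j \<in> V"
        using MN by auto
    qed
  next
    fix L M N :: "'v \<Rightarrow> 'v \<Rightarrow> 'f"
    have "(\<Sum>k\<in>V. (\<Sum>l\<in>V. L i l * M l k) * N k j) = (\<Sum>l\<in>V. L i l * (\<Sum>k\<in>V. M l k * N k j))" for i j
      unfolding sum_distrib_left sum_distrib_right
      by (subst sum.swap) (simp add: mult.assoc)
    then show "L \<otimes>\<^bsub>matrix_ring V\<^esub> M \<otimes>\<^bsub>matrix_ring V\<^esub> N = L \<otimes>\<^bsub>matrix_ring V\<^esub> (M \<otimes>\<^bsub>matrix_ring V\<^esub> N)"
      by simp
  next
    fix M :: "'v \<Rightarrow> 'v \<Rightarrow> 'f" assume "M \<in> carrier (matrix_ring V)"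
    then show "\<one>\<^bsub>matrix_ring V\<^esub> \<otimes>\<^bsub>matrix_ring V\<^esub> M = M" "M \<otimes>\<^bsub>matrix_ring V\<^esub> \<one>\<^bsub>matrix_ring V\<^esub> = M"
      using scalar_matrix_central[OF V, of M 1] by simp_all
  qed (auto simp: scalar_matrix_def)
qed (auto simp: fun_eq_iff algebra_simps sum.distrib)


text \<open>The Peirce component of \<open>B\<close> at position (i, j), read as a set of
  scalars.\<close>

definition matrix_ent :: "('v \<Rightarrow> 'v \<Rightarrow> 'f::field) set \<Rightarrow> 'v \<Rightarrow> 'v \<Rightarrow> 'f set" where
  "matrix_ent B i j = {c. single_entry i j c \<in> B}"

lemma scalar_matrix_0: "scalar_matrix V 0 = (\<lambda>_ _. 0)"
  by (simp add: scalar_matrix_def fun_eq_iff)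

lemma scalar_matrix_eq_iff: "V \<noteq> {} \<Longrightarrow> scalar_matrix V c = scalar_matrix V c' \<longleftrightarrow> c = c'"
  by (auto simp: scalar_matrix_def fun_eq_iff)

section \<open>Peirce decomposition, centre and central localisation of a matrix subring\<close>

locale matrix_order =
  fixes V :: "'v set" and B :: "('v \<Rightarrow> 'v \<Rightarrow> 'f::field) set"
  assumes fin: "finite V" and ne: "V \<noteq> {}"
    and subring_B: "subring B (matrix_ring V)"
    and diag: "i \<in> V \<Longrightarrow> single_entry i i 1 \<in> B"
    and conn: "i \<in> V \<Longrightarrow> j \<in> V \<Longrightarrow> \<exists>M\<in>B. M i j \<noteq> 0"
begin

sublocale mat: ring "matrix_ring V"
  by (rule ring_matrix_ring[OF fin])

lemma B_carrier: "M \<in> B \<Longrightarrow> M i j \<noteq> 0 \<Longrightarrow> i \<in> V \<and> j \<in> V"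
  using subringE(1)[OF subring_B] by auto

lemma B_zero: "(\<lambda>_ _. 0) \<in> B"
  using subringE(2)[OF subring_B] by simp

lemma B_add: "M \<in> B \<Longrightarrow> N \<in> B \<Longrightarrow> (\<lambda>i j. M i j + N i j) \<in> B"
  using subringE(7)[OF subring_B, of M N] by simp

lemma B_mult: "M \<in> B \<Longrightarrow> N \<in> B \<Longrightarrow> (\<lambda>i j. \<Sum>k\<in>V. M i k * N k j) \<in> B"
  using subringE(6)[OF subring_B, of M N] by simp

lemma mat_minus: "M \<in> carrier (matrix_ring V) \<Longrightarrow> \<ominus>\<^bsub>matrix_ring V\<^esub> M = (\<lambda>i j. - M i j)"
  by (rule mat.minus_equality) auto

lemma B_minus: "M \<in> B \<Longrightarrow> (\<lambda>i j. - M i j) \<in> B"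
  using subringE(5)[OF subring_B, of M] mat_minus[of M] subringE(1)[OF subring_B] by auto

abbreviation ent :: "'v \<Rightarrow> 'v \<Rightarrow> 'f set" where
  "ent \<equiv> matrix_ent B"

lemma ent_0: "0 \<in> ent i j"
proof -
  have "single_entry i j 0 = (\<lambda>_ _. 0 :: 'f)"
    by (simp add: single_entry_def fun_eq_iff)
  then show ?thesis
    using B_zero by (simp add: matrix_ent_def)
qed

lemma ent_add: "c \<in> ent i j \<Longrightarrow> c' \<in> ent i j \<Longrightarrow> c + c' \<in> ent i j"
proof -
  have "(\<lambda>k l. single_entry i j c k l + single_entry i j c' k l) = single_entry i j (c + c')"
    by (auto simp: single_entry_def fun_eq_iff)
  then show "c \<in> ent i j \<Longrightarrow> c' \<in> ent i j \<Longrightarrow> ?thesis"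
    using B_add[of "single_entry i j c" "single_entry i j c'"] by (simp add: matrix_ent_def)
qed

lemma ent_minus: "c \<in> ent i j \<Longrightarrow> - c \<in> ent i j"
proof -
  have "(\<lambda>k l. - single_entry i j c k l) = single_entry i j (- c)"
    by (auto simp: single_entry_def fun_eq_iff)
  then show "c \<in> ent i j \<Longrightarrow> ?thesis"
    using B_minus[of "single_entry i j c"] by (simp add: matrix_ent_def)
qed

lemma ent_1: "i \<in> V \<Longrightarrow> 1 \<in> ent i i"
  by (simp add: matrix_ent_def diag)

lemma ent_mult: "c \<in> ent i j \<Longrightarrow> c' \<in> ent j k \<Longrightarrow> j \<in> V \<Longrightarrow> c * c' \<in> ent i k"
proof -
  assume "c \<in> ent i j" "c' \<in> ent j k" "j \<in> V"
  moreover have "(\<lambda>a b. \<Sum>l\<in>V. single_entry i j c a l * single_entry j k c' l b) = single_entry i k (c * c')"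
    if "j \<in> V"
    using fin that by (auto simp: single_entry_mult fun_eq_iff) (auto simp: single_entry_def)
  ultimately show ?thesis
    using B_mult[of "single_entry i j c" "single_entry j k c'"] by (simp add: matrix_ent_def)
qed

text \<open>Multiplication by the diagonal idempotents from both sides cuts out one entry.\<close>

lemma entry_in_ent: "M \<in> B \<Longrightarrow> i \<in> V \<Longrightarrow> j \<in> V \<Longrightarrow> M i j \<in> ent i j"
proof -
  assume *: "M \<in> B" "i \<in> V" "j \<in> V"
  have "(\<Sum>k\<in>V. single_entry i i 1 a k * M k l) = (if a = i then M i l else 0)" for a l
    by (simp add: single_entry_mult(1)[OF fin *(2)])
  moreover have "(\<Sum>l\<in>V. (if a = i then M i l else 0) * single_entry j j 1 l b)
      = single_entry i j (M i j) a b" for a b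
    using single_entry_mult(2)[OF fin *(3), of "\<lambda>a l. if a = i then M i l else 0" a j 1 b]
    by (simp add: single_entry_def)
  ultimately have "(\<lambda>a b. \<Sum>l\<in>V. (\<Sum>k\<in>V. single_entry i i 1 a k * M k l) * single_entry j j 1 l b)
      = single_entry i j (M i j)"
    by (simp add: fun_eq_iff)
  then show ?thesis
    using B_mult[OF B_mult[OF diag *(1)] diag, of i j] * by (simp add: matrix_ent_def)
qed

lemma ent_nonzero:
  assumes "i \<in> V" "j \<in> V"
  obtains c where "c \<in> ent i j" "c \<noteq> 0"
  using conn[OF assms] entry_in_ent assms by blast

lemma B_sum: "finite T \<Longrightarrow> (\<And>t. t \<in> T \<Longrightarrow> f t \<in> B) \<Longrightarrow> (\<lambda>i j. \<Sum>t\<in>T. f t i j) \<in> B"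
  by (induction T rule: finite_induct) (auto simp: B_zero intro: B_add)

text \<open>Peirce decomposition: \<open>B\<close> is determined by its sets of entries, so
  membership becomes a matter of scalars.\<close>

lemma in_B_iff:
  "M \<in> B \<longleftrightarrow> M \<in> carrier (matrix_ring V) \<and> (\<forall>i\<in>V. \<forall>j\<in>V. M i j \<in> ent i j)" (is "_ \<longleftrightarrow> ?R")
proof
  assume ?R
  then have "(\<lambda>a b. \<Sum>(i, j)\<in>V \<times> V. single_entry i j (M i j) a b) \<in> B"
    using B_sum[of "V \<times> V" "\<lambda>(i, j). single_entry i j (M i j)"] fin
    by (auto simp: matrix_ent_def case_prod_unfold)
  moreover have "(\<Sum>(i, j)\<in>V \<times> V. single_entry i j (M i j) a b) = M a b" for a b
  proof -
    have "(\<Sum>(i, j)\<in>V \<times> V. single_entry i j (M i j) a b) =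
        (\<Sum>x\<in>V \<times> V. if x = (a, b) then M a b else 0)"
      by (rule sum.cong) (auto simp: single_entry_def split: if_splits)
    also have "\<dots> = (if (a, b) \<in> V \<times> V then M a b else 0)"
      using fin by (simp only: sum.delta finite_cartesian_product)
    also have "\<dots> = M a b"
      using \<open>?R\<close> by auto
    finally show ?thesis .
  qed
  ultimately show "M \<in> B"
    by simp
qed (use B_carrier entry_in_ent in auto)

text \<open>These are the scalars whose scalar matrices lie in \<open>B\<close>; by
  \<open>commutant\<close> such matrices make up the centre.\<close>

definition Z :: "'f set" where
  "Z = (\<Inter>i\<in>V. ent i i)"

lemma Z_1: "1 \<in> Z"
  and Z_add: "c \<in> Z \<Longrightarrow> c' \<in> Z \<Longrightarrow> c + c' \<in> Z"
  and Z_mult: "c \<in> Z \<Longrightarrow> c' \<in> Z \<Longrightarrow> c * c' \<in> Z"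
  and Z_minus: "c \<in> Z \<Longrightarrow> - c \<in> Z"
  by (auto simp: Z_def intro: ent_0 ent_1 ent_add ent_mult ent_minus)

lemma Z_ent: "c \<in> Z \<Longrightarrow> c' \<in> ent i j \<Longrightarrow> i \<in> V \<Longrightarrow> c * c' \<in> ent i j"
  by (auto simp: Z_def intro: ent_mult)

lemma Z_scale: "c \<in> Z \<Longrightarrow> M \<in> B \<Longrightarrow> (\<lambda>i j. c * M i j) \<in> B"
  by (auto simp: in_B_iff intro: Z_ent)

lemma scalar_in_B_iff: "scalar_matrix V c \<in> B \<longleftrightarrow> c \<in> Z"
  by (auto simp: in_B_iff Z_def scalar_matrix_def ent_0)

text \<open>\<open>M\<close> ranges over all matrices, not only over \<open>B\<close>, so that the
  lemma yields the centre of \<open>B\<close> and of its localisation alike.\<close>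

lemma commutant:
  assumes M: "M \<in> carrier (matrix_ring V)"
    and comm: "\<And>N. N \<in> B \<Longrightarrow> M \<otimes>\<^bsub>matrix_ring V\<^esub> N = N \<otimes>\<^bsub>matrix_ring V\<^esub> M"
  shows "\<exists>c. M = scalar_matrix V c"
proof -
  \<comment> \<open>The (k, j) entries of both products with \<open>single_entry i j g\<close>.
    Taking j = i and g = 1 kills the off-diagonal entries of \<open>M\<close>; taking k = i and g
    nonzero equates two diagonal entries.\<close>
  have *: "M k i * g = (if k = i then g * M j j else 0)" if "i \<in> V" "j \<in> V" "g \<in> ent i j" for i j k g
    using fun_cong[OF fun_cong[OF comm[of "single_entry i j g"]], of k j] that fin
    by (simp add: matrix_ent_def single_entry_mult)
  have off: "M k i = 0" if "k \<noteq> i" for k i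
  proof (cases "i \<in> V")
    case True
    then show ?thesis
      using *[of i i 1 k] ent_1 that by simp
  qed (use M in auto)
  have eq: "M i i = M j j" if "i \<in> V" "j \<in> V" for i j
  proof -
    obtain g where "g \<in> ent i j" "g \<noteq> 0"
      using ent_nonzero \<open>i \<in> V\<close> \<open>j \<in> V\<close> by blast
    then show ?thesis
      using *[of i j g i] that by simp
  qed
  obtain v where v: "v \<in> V"
    using ne by blast
  have "M = scalar_matrix V (M v v)"
    using off M eq[OF _ v] by (auto simp: scalar_matrix_def fun_eq_iff)
  then show ?thesis
    by blast
qed

text \<open>The field of fractions of \<open>Z\<close>, formed inside the given field.\<close>

definition K :: "'f set" where
  "K = {c / z |c z. c \<in> Z \<and> z \<in> Z \<and> z \<noteq> 0}"

lemma K_I: "c \<in> Z \<Longrightarrow> z \<in> Z \<Longrightarrow> z \<noteq> 0 \<Longrightarrow> c / z \<in> K"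
  by (auto simp: K_def)

lemma K_E:
  assumes "x \<in> K"
  obtains c z where "x = c / z" "c \<in> Z" "z \<in> Z" "z \<noteq> 0"
  using assms by (auto simp: K_def)

lemma K_1: "1 \<in> K"
  using K_I[of 1 1] Z_1 by simp

lemma K_minus: "x \<in> K \<Longrightarrow> - x \<in> K"
  using Z_minus K_I by (metis K_E minus_divide_left)

lemma K_inverse: "x \<in> K \<Longrightarrow> inverse x \<in> K"
proof (cases "x = 0")
  case False
  assume "x \<in> K"
  then obtain c z where x: "x = c / z" "c \<in> Z" "z \<in> Z" "z \<noteq> 0"
    by (rule K_E)
  then show ?thesis
    using K_I[of z c] False by simp
qed auto

lemma K_mult: "x \<in> K \<Longrightarrow> y \<in> K \<Longrightarrow> x * y \<in> K"
proof -
  assume "x \<in> K" "y \<in> K"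
  then obtain c z c' z' where "x = c / z" "c \<in> Z" "z \<in> Z" "z \<noteq> 0" "y = c' / z'" "c' \<in> Z" "z' \<in> Z" "z' \<noteq> 0"
    by (metis K_E)
  then show ?thesis
    using K_I[of "c * c'" "z * z'"] Z_mult by simp
qed

lemma K_add: "x \<in> K \<Longrightarrow> y \<in> K \<Longrightarrow> x + y \<in> K"
proof -
  assume "x \<in> K" "y \<in> K"
  then obtain c z c' z' where "x = c / z" "c \<in> Z" "z \<in> Z" "z \<noteq> 0" "y = c' / z'" "c' \<in> Z" "z' \<in> Z" "z' \<noteq> 0"
    by (metis K_E)
  then show ?thesis
    using K_I[of "c * z' + c' * z" "z * z'"] Z_mult Z_add by (simp add: add_frac_eq)
qed

text \<open>
  Since every entry position is hit, multiplying by a product of cycles through all indices moves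
  each diagonal entry set into the centre.
\<close>

lemma ent_diag_conductor:
  assumes i: "i \<in> V"
  obtains s where "s \<noteq> 0" "\<And>u. u \<in> ent i i \<Longrightarrow> s * u \<in> Z"
proof -
  have "\<forall>j\<in>V. \<exists>g. g \<in> ent i j \<and> g \<noteq> 0" "\<forall>j\<in>V. \<exists>g. g \<in> ent j i \<and> g \<noteq> 0"
    using ent_nonzero i by metis+
  then obtain g h where g: "\<forall>j\<in>V. g j \<in> ent i j \<and> g j \<noteq> 0" and h: "\<forall>j\<in>V. h j \<in> ent j i \<and> h j \<noteq> 0"
    by metis
  have prod: "(\<Prod>j\<in>T. g j * h j) \<in> ent i i" if "T \<subseteq> V" for T
    using finite_subset[OF that fin] that
  proof (induction T rule: finite_induct)
    case (insert j T)
    then have "g j * h j \<in> ent i i"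
      using g h by (auto intro: ent_mult[of _ _ j])
    then show ?case
      using insert i by (auto intro: ent_mult)
  qed (simp add: ent_1 i)
  define s where "s = (\<Prod>j\<in>V. g j * h j)"
  have "s \<noteq> 0"
    using g h fin by (simp add: s_def)
  moreover have "s * u \<in> Z" if u: "u \<in> ent i i" for u
    unfolding Z_def
  proof
    fix j assume j: "j \<in> V"
    \<comment> \<open>The factors of \<open>s * u\<close> are rearranged into a cycle at j: back to
      i, through all other cycles and \<open>u\<close> at i, and out to j again. The field is
      commutative, so the value does not change.\<close>
    have "h j * (((\<Prod>k\<in>V - {j}. g k * h k) * u) * g j) \<in> ent j j"
      using g h j i u prod[of "V - {j}"] by (intro ent_mult[of _ _ i]) auto
    also have "h j * (((\<Prod>k\<in>V - {j}. g k * h k) * u) * g j) = s * u"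
      unfolding s_def by (simp add: prod.remove[OF fin j])
    finally show "s * u \<in> ent j j" .
  qed
  ultimately show thesis
    by (rule that)
qed

text \<open>A common factor g from position (j, i) makes both elements diagonal, and a conductor s
  moves them into \<open>Z\<close> without changing their quotient. Thus every entry set spans at
  most a line over \<open>K\<close>.\<close>

lemma ent_ratio:
  assumes "i \<in> V" "j \<in> V" "c \<in> ent i j" "c' \<in> ent i j" "c' \<noteq> 0"
  shows "c / c' \<in> K"
proof -
  obtain g where g: "g \<in> ent j i" "g \<noteq> 0"
    using ent_nonzero assms by blast
  obtain s where s: "s \<noteq> 0" "\<And>u. u \<in> ent i i \<Longrightarrow> s * u \<in> Z"
    using ent_diag_conductor assms by blast
  have "(s * (c * g)) / (s * (c' * g)) \<in> K"
    using s g assms by (intro K_I s(2) ent_mult[of _ _ j]) auto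
  then show ?thesis
    using s g by simp
qed

text \<open>The central localisation of \<open>B\<close>, realised inside the full matrix
  ring.\<close>

definition Q0 :: "('v \<Rightarrow> 'v \<Rightarrow> 'f) set" where
  "Q0 = {(\<lambda>i j. M i j / z) |M z. M \<in> B \<and> z \<in> Z \<and> z \<noteq> 0}"

lemma Q0_I: "M \<in> B \<Longrightarrow> z \<in> Z \<Longrightarrow> z \<noteq> 0 \<Longrightarrow> (\<lambda>i j. M i j / z) \<in> Q0"
  by (auto simp: Q0_def)

lemma Q0_E:
  assumes "N \<in> Q0"
  obtains M z where "N = (\<lambda>i j. M i j / z)" "M \<in> B" "z \<in> Z" "z \<noteq> 0"
  using assms by (auto simp: Q0_def)

lemma B_subset_Q0: "B \<subseteq> Q0"
  using Q0_I[of _ 1] Z_1 by auto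

lemma Q0_carrier: "Q0 \<subseteq> carrier (matrix_ring V)"
  by (auto simp: Q0_def in_B_iff)

lemma scalar_in_Q0_iff: "scalar_matrix V c \<in> Q0 \<longleftrightarrow> c \<in> K"
proof
  assume "scalar_matrix V c \<in> Q0"
  then obtain M z where M: "scalar_matrix V c = (\<lambda>i j. M i j / z)" "M \<in> B" "z \<in> Z" "z \<noteq> 0"
    by (rule Q0_E)
  have "M = (\<lambda>i j. scalar_matrix V c i j * z)"
    unfolding M(1) using M(4) by simp
  also have "\<dots> = scalar_matrix V (c * z)"
    by (auto simp: scalar_matrix_def fun_eq_iff)
  finally have "c * z \<in> Z"
    using M scalar_in_B_iff by simp
  then show "c \<in> K"
    using K_I[of "c * z" z] M by simp
next
  assume "c \<in> K"
  then obtain x z where x: "c = x / z" "x \<in> Z" "z \<in> Z" "z \<noteq> 0"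
    by (rule K_E)
  then have "(\<lambda>i j. scalar_matrix V x i j / z) \<in> Q0"
    using Q0_I scalar_in_B_iff by blast
  also have "(\<lambda>i j. scalar_matrix V x i j / z) = scalar_matrix V c"
    by (auto simp add: scalar_matrix_def fun_eq_iff x)
  finally show "scalar_matrix V c \<in> Q0" .
qed

lemma subring_Q0: "subring Q0 (matrix_ring V)"
proof (rule mat.subringI[OF Q0_carrier])
  show "\<one>\<^bsub>matrix_ring V\<^esub> \<in> Q0"
    by (simp add: scalar_in_Q0_iff K_1)
next
  fix N assume N: "N \<in> Q0"
  then obtain M z where M: "N = (\<lambda>i j. M i j / z)" "M \<in> B" "z \<in> Z" "z \<noteq> 0"
    by (rule Q0_E)
  have "\<ominus>\<^bsub>matrix_ring V\<^esub> N = (\<lambda>i j. - M i j / z)"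
    using mat_minus[of N] N Q0_carrier M by auto
  then show "\<ominus>\<^bsub>matrix_ring V\<^esub> N \<in> Q0"
    using Q0_I[OF B_minus] M by simp
next
  fix N N' assume "N \<in> Q0" "N' \<in> Q0"
  then obtain M z M' z' where
    M: "N = (\<lambda>i j. M i j / z)" "M \<in> B" "z \<in> Z" "z \<noteq> 0"
      "N' = (\<lambda>i j. M' i j / z')" "M' \<in> B" "z' \<in> Z" "z' \<noteq> 0"
    by (metis Q0_E)
  have "N \<otimes>\<^bsub>matrix_ring V\<^esub> N' = (\<lambda>i j. (\<Sum>k\<in>V. M i k * M' k j) / (z * z'))"
    by (simp add: M sum_divide_distrib)
  then show "N \<otimes>\<^bsub>matrix_ring V\<^esub> N' \<in> Q0"
    using Q0_I[OF B_mult[OF M(2,6)] Z_mult[OF M(3,7)]] M by simp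
  have "N \<oplus>\<^bsub>matrix_ring V\<^esub> N' = (\<lambda>i j. (z' * M i j + z * M' i j) / (z * z'))"
    using M(4,8) by (simp add: M(1,5) fun_eq_iff field_simps)
  then show "N \<oplus>\<^bsub>matrix_ring V\<^esub> N' \<in> Q0"
    using Q0_I[OF B_add[OF Z_scale[OF M(7,2)] Z_scale[OF M(3,6)]] Z_mult[OF M(3,7)]] M by simp
qed

abbreviation Q0_ring :: "('v \<Rightarrow> 'v \<Rightarrow> 'f) ring" where
  "Q0_ring \<equiv> (matrix_ring V)\<lparr>carrier := Q0\<rparr>"

sublocale frac: ring Q0_ring
  by (rule mat.subring_is_ring[OF subring_Q0])

lemma centre_Q0: "ring_centre Q0_ring = scalar_matrix V ` K"
proof
  show "ring_centre Q0_ring \<subseteq> scalar_matrix V ` K"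
  proof
    fix M assume "M \<in> ring_centre Q0_ring"
    then have M: "M \<in> Q0" "\<And>N. N \<in> Q0 \<Longrightarrow> M \<otimes>\<^bsub>matrix_ring V\<^esub> N = N \<otimes>\<^bsub>matrix_ring V\<^esub> M"
      by (auto simp: ring_centre_def)
    then obtain c where "M = scalar_matrix V c"
      using commutant[of M] Q0_carrier B_subset_Q0 by blast
    then show "M \<in> scalar_matrix V ` K"
      using M(1) scalar_in_Q0_iff by auto
  qed
  show "scalar_matrix V ` K \<subseteq> ring_centre Q0_ring"
  proof
    fix M assume "M \<in> scalar_matrix V ` K"
    then obtain c where c: "M = scalar_matrix V c" "c \<in> K"
      by blast
    have "M \<otimes>\<^bsub>matrix_ring V\<^esub> N = N \<otimes>\<^bsub>matrix_ring V\<^esub> M" if "N \<in> Q0" for N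
      using scalar_matrix_central[OF fin subsetD[OF Q0_carrier that], of c] by (simp only: c(1))
    then show "M \<in> ring_centre Q0_ring"
      using c scalar_in_Q0_iff by (auto simp: ring_centre_def simp del: matrix_ring_simps)
  qed
qed

lemma scalar_mult: "scalar_matrix V c \<otimes>\<^bsub>matrix_ring V\<^esub> scalar_matrix V c' = scalar_matrix V (c * c')"
proof -
  have c': "scalar_matrix V c' \<in> carrier (matrix_ring V)"
    by (simp add: scalar_matrix_def)
  show ?thesis
    unfolding conjunct1[OF scalar_matrix_central[OF fin c']] by (auto simp: scalar_matrix_def fun_eq_iff)
qed

lemma scalar_add: "scalar_matrix V c \<oplus>\<^bsub>matrix_ring V\<^esub> scalar_matrix V c' = scalar_matrix V (c + c')"
  by (auto simp: scalar_matrix_def fun_eq_iff)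

lemma subfield_centre_Q0: "subfield (ring_centre Q0_ring) Q0_ring"
  unfolding centre_Q0
proof (rule frac.subfieldI)
  have "subring (scalar_matrix V ` K) Q0_ring"
  proof (rule frac.subringI)
    show "scalar_matrix V ` K \<subseteq> carrier Q0_ring"
      using scalar_in_Q0_iff by auto
    show "\<one>\<^bsub>Q0_ring\<^esub> \<in> scalar_matrix V ` K"
      using K_1 by simp
    fix M N :: "'v \<Rightarrow> 'v \<Rightarrow> 'f" assume MN: "M \<in> scalar_matrix V ` K" "N \<in> scalar_matrix V ` K"
    obtain c c' where c: "M = scalar_matrix V c" "c \<in> K" and c': "N = scalar_matrix V c'" "c' \<in> K"
      using MN by blast
    have "M \<otimes>\<^bsub>Q0_ring\<^esub> N = scalar_matrix V (c * c')" "M \<oplus>\<^bsub>Q0_ring\<^esub> N = scalar_matrix V (c + c')"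
      using scalar_mult[of c c'] scalar_add[of c c'] unfolding c c' by simp_all
    then show "M \<otimes>\<^bsub>Q0_ring\<^esub> N \<in> scalar_matrix V ` K" "M \<oplus>\<^bsub>Q0_ring\<^esub> N \<in> scalar_matrix V ` K"
      using c c' K_mult K_add by (simp_all only: imageI)
    have "\<ominus>\<^bsub>Q0_ring\<^esub> M = scalar_matrix V (- c)"
    proof (rule frac.minus_equality)
      show "scalar_matrix V (- c) \<oplus>\<^bsub>Q0_ring\<^esub> M = \<zero>\<^bsub>Q0_ring\<^esub>"
        using c scalar_add[of "- c" c] by (simp add: scalar_matrix_0)
    qed (use c K_minus scalar_in_Q0_iff in auto)
    then show "\<ominus>\<^bsub>Q0_ring\<^esub> M \<in> scalar_matrix V ` K"
      using c K_minus by simp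
  qed
  then show "subcring (scalar_matrix V ` K) Q0_ring"
  proof (rule frac.subcringI)
    fix M N :: "'v \<Rightarrow> 'v \<Rightarrow> 'f" assume "M \<in> scalar_matrix V ` K" "N \<in> scalar_matrix V ` K"
    then obtain c c' where "M = scalar_matrix V c" "N = scalar_matrix V c'"
      by blast
    then show "M \<otimes>\<^bsub>Q0_ring\<^esub> N = N \<otimes>\<^bsub>Q0_ring\<^esub> M"
      using scalar_mult[of c c'] scalar_mult[of c' c] by (simp add: mult.commute del: matrix_ring_simps)
  qed
  show "Units (Q0_ring\<lparr>carrier := scalar_matrix V ` K\<rparr>) = scalar_matrix V ` K - {\<zero>\<^bsub>Q0_ring\<^esub>}"
  proof (intro equalityI subsetI)
    fix M :: "'v \<Rightarrow> 'v \<Rightarrow> 'f" assume "M \<in> Units (Q0_ring\<lparr>carrier := scalar_matrix V ` K\<rparr>)"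
    then have "M \<in> scalar_matrix V ` K \<and> (\<exists>N. M \<otimes>\<^bsub>matrix_ring V\<^esub> N = \<one>\<^bsub>matrix_ring V\<^esub>)"
      by (simp add: Units_def del: matrix_ring_simps) blast
    then obtain N where M: "M \<in> scalar_matrix V ` K" "M \<otimes>\<^bsub>matrix_ring V\<^esub> N = \<one>\<^bsub>matrix_ring V\<^esub>"
      by blast
    have "M \<noteq> (\<lambda>_ _. 0)"
    proof
      assume "M = (\<lambda>_ _. 0)"
      then have "scalar_matrix V 0 = scalar_matrix V (1 :: 'f)"
        using M(2) by (simp add: scalar_matrix_0)
      then show False
        using scalar_matrix_eq_iff[OF ne, of 0 "1::'f"] by simp
    qed
    then show "M \<in> scalar_matrix V ` K - {\<zero>\<^bsub>Q0_ring\<^esub>}"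
      using M(1) by simp
  next
    fix M :: "'v \<Rightarrow> 'v \<Rightarrow> 'f" assume "M \<in> scalar_matrix V ` K - {\<zero>\<^bsub>Q0_ring\<^esub>}"
    then obtain c where c: "M = scalar_matrix V c" "c \<in> K" and "M \<noteq> (\<lambda>_ _. 0)"
      by auto
    then have "c \<noteq> 0"
      using scalar_matrix_0 by blast
    have MK: "M \<in> scalar_matrix V ` K"
      using c by simp
    have "scalar_matrix V (inverse c) \<otimes>\<^bsub>matrix_ring V\<^esub> M = \<one>\<^bsub>matrix_ring V\<^esub>"
      "M \<otimes>\<^bsub>matrix_ring V\<^esub> scalar_matrix V (inverse c) = \<one>\<^bsub>matrix_ring V\<^esub>"
      unfolding c(1) scalar_mult using \<open>c \<noteq> 0\<close> by simp_all
    then show "M \<in> Units (Q0_ring\<lparr>carrier := scalar_matrix V ` K\<rparr>)"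
      using K_inverse[OF c(2)] by (auto simp: Units_def MK simp del: matrix_ring_simps)
  qed
qed

text \<open>Positions are added one at a time: \<open>E P\<close> consists of the fractions
  supported on \<open>P\<close>, and each new position enlarges it by one line. The line is spanned
  by \<open>single_entry i j g\<close> with a nonzero g from \<open>ent i j\<close>, since the
  unscaled matrix unit may fail to lie in \<open>Q0\<close>; \<open>ent_ratio\<close> shows that one
  such g is enough.\<close>

lemma dimension_Q0: "frac.dimension ((card V)\<^sup>2) (ring_centre Q0_ring) Q0"
proof -
  define E where "E P = {M \<in> Q0. \<forall>i j. M i j \<noteq> 0 \<longrightarrow> (i, j) \<in> P}" for P
  have "frac.dimension (card P) (ring_centre Q0_ring) (E P)" if "P \<subseteq> V \<times> V" for P
    using finite_subset[OF that finite_cartesian_product[OF fin fin]] that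
  proof (induction P rule: finite_induct)
    case empty
    have "E {} = {\<zero>\<^bsub>Q0_ring\<^esub>}"
      using subringE(2)[OF subring_Q0] by (auto simp: E_def)
    then show ?case
      using frac.zero_dim by (simp only: card.empty)
  next
    case (insert x P)
    obtain i j where x: "x = (i, j)" "i \<in> V" "j \<in> V"
      using insert.prems by auto
    obtain g where g: "g \<in> ent i j" "g \<noteq> 0"
      using ent_nonzero x by blast
    have gQ: "single_entry i j g \<in> Q0"
      using g B_subset_Q0 by (auto simp: matrix_ent_def)
    have scal: "scalar_matrix V c \<otimes>\<^bsub>matrix_ring V\<^esub> single_entry i j g = single_entry i j (c * g)" for c
      using scalar_matrix_central[OF fin, of "single_entry i j g" c] x by (auto simp: single_entry_def fun_eq_iff)
    have scal': "(\<Sum>k\<in>V. scalar_matrix V c a k * single_entry i j g k b) = single_entry i j (c * g) a b"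
      for a b c
      using fun_cong[OF fun_cong[OF scal[of c]]] by simp
    have "frac.line_extension (ring_centre Q0_ring) (single_entry i j g) (E P) = E (insert x P)"
    proof (intro equalityI subsetI)
      fix M assume "M \<in> frac.line_extension (ring_centre Q0_ring) (single_entry i j g) (E P)"
      then obtain k N where kN: "k \<in> scalar_matrix V ` K" "N \<in> E P"
        "M = k \<otimes>\<^bsub>Q0_ring\<^esub> single_entry i j g \<oplus>\<^bsub>Q0_ring\<^esub> N"
        unfolding frac.line_extension_mem_iff centre_Q0 by blast
      then obtain c where k: "k = scalar_matrix V c" "c \<in> K"
        by blast
      have M: "c \<in> K" "N \<in> E P" "M = (\<lambda>k l. single_entry i j (c * g) k l + N k l)"
        using kN(2,3) k scal' by simp_all
      have "scalar_matrix V c \<otimes>\<^bsub>matrix_ring V\<^esub> single_entry i j g \<in> Q0"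
        using subringE(6)[OF subring_Q0 _ gQ] scalar_in_Q0_iff M(1) by blast
      then have "M \<in> Q0"
        using subringE(7)[OF subring_Q0, of "single_entry i j (c * g)" N] M scal by (simp add: E_def)
      then show "M \<in> E (insert x P)"
        using M(2,3) x by (auto simp: E_def single_entry_def)
    next
      fix M assume M: "M \<in> E (insert x P)"
      then obtain N z where N: "M = (\<lambda>i j. N i j / z)" "N \<in> B" "z \<in> Z" "z \<noteq> 0"
        unfolding E_def using Q0_E by blast
      define c where "c = M i j / g"
      have "N i j / g \<in> K" "inverse z \<in> K"
        using ent_ratio[OF x(2,3) entry_in_ent[OF N(2) x(2,3)] g] K_inverse[of z] K_I[OF N(3) Z_1] by auto
      then have c: "c \<in> K"
        using K_mult[of "N i j / g" "inverse z"] N(1) by (simp add: c_def field_simps)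
      define L where "L = (\<lambda>k l. M k l - single_entry i j (M i j) k l)"
      have "L = M \<ominus>\<^bsub>matrix_ring V\<^esub> single_entry i j (c * g)"
        using x mat_minus[of "single_entry i j (c * g)"] g
        by (auto simp: a_minus_def c_def L_def single_entry_def fun_eq_iff)
      moreover have "single_entry i j (c * g) \<in> Q0"
        using subringE(6)[OF subring_Q0 _ gQ, of "scalar_matrix V c"] scalar_in_Q0_iff c scal by simp
      ultimately have "L \<in> Q0"
        using M subringE(5)[OF subring_Q0] subringE(7)[OF subring_Q0]
        unfolding E_def a_minus_def by blast
      then have "L \<in> E P"
        using M x by (auto simp: E_def L_def single_entry_def)
      moreover have "M = scalar_matrix V c \<otimes>\<^bsub>Q0_ring\<^esub> single_entry i j g \<oplus>\<^bsub>Q0_ring\<^esub> L"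
        using scal[of c] g by (simp add: c_def L_def fun_eq_iff)
      ultimately show "M \<in> frac.line_extension (ring_centre Q0_ring) (single_entry i j g) (E P)"
        unfolding frac.line_extension_mem_iff centre_Q0 using c by blast
    qed
    moreover have "single_entry i j g \<notin> E P"
      using insert.hyps(2) x g by (auto simp: E_def single_entry_def)
    ultimately show ?case
      using frac.Suc_dim[of "single_entry i j g" "E P" "card P" "ring_centre Q0_ring"]
        insert gQ by simp
  qed
  moreover have "E (V \<times> V) = Q0"
    using Q0_carrier by (auto simp: E_def)
  ultimately show ?thesis
    using fin by (simp add: card_cartesian_product power2_eq_square) (metis card_cartesian_product order_refl)
qed

end


section \<open>Primeness and PI degree of an embedded ring\<close>

lemma ring_iso_centre:
  assumes h: "h \<in> ring_iso R S" and R: "ring R"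
  shows "ring_centre S = h ` ring_centre R"
proof -
  have bij: "bij_betw h (carrier R) (carrier S)"
    using h by (auto simp: ring_iso_def)
  then have S: "carrier S = h ` carrier R" and inj: "inj_on h (carrier R)"
    by (auto simp: bij_betw_def)
  have mult: "h (x \<otimes>\<^bsub>R\<^esub> y) = h x \<otimes>\<^bsub>S\<^esub> h y" if "x \<in> carrier R" "y \<in> carrier R" for x y
    using h that by (auto simp: ring_iso_def ring_hom_def)
  have "h x \<otimes>\<^bsub>S\<^esub> h y = h y \<otimes>\<^bsub>S\<^esub> h x \<longleftrightarrow> x \<otimes>\<^bsub>R\<^esub> y = y \<otimes>\<^bsub>R\<^esub> x"
    if "x \<in> carrier R" "y \<in> carrier R" for x y
    using that inj_onD[OF inj, of "x \<otimes>\<^bsub>R\<^esub> y" "y \<otimes>\<^bsub>R\<^esub> x"] ring.ring_simprules(5)[OF R]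
    by (metis mult)
  then show ?thesis
    unfolding ring_centre_def S by auto
qed

text \<open>Formulated for an abstract ring with image \<open>B\<close>, because it will be applied
  to a quotient of a path algebra, whose elements are cosets and not matrices.\<close>

theorem (in matrix_order) prime_PI_degree:
  fixes A :: "('a, 'b) ring_scheme"
  assumes A: "ring A" and hom: "h \<in> ring_hom A (matrix_ring V)"
    and inj: "inj_on h (carrier A)" and image: "h ` carrier A = B"
  shows "prime_ring A" "has_PI_degree A (card V)"
proof -
  interpret A: ring A
    by (rule A)
  interpret h: ring_hom_ring A "matrix_ring V" h
    by (rule ring_hom_ringI2[OF A mat.ring_axioms hom])
  have in_B: "h x \<in> B" if "x \<in> carrier A" for x
    using that image by blast
  have from_B: "\<exists>x\<in>carrier A. h x = N" if "N \<in> B" for N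
    using that unfolding image[symmetric] by auto
  have zero_iff: "h x = (\<lambda>_ _. 0) \<longleftrightarrow> x = \<zero>\<^bsub>A\<^esub>" if "x \<in> carrier A" for x
    using h.hom_zero inj_onD[OF inj _ that A.zero_closed] by auto
  have mult: "h (x \<otimes>\<^bsub>A\<^esub> y) = (\<lambda>i j. \<Sum>k\<in>V. h x i k * h y k j)" if "x \<in> carrier A" "y \<in> carrier A" for x y
    using h.hom_mult[OF that] by simp
  have one: "h \<one>\<^bsub>A\<^esub> = scalar_matrix V 1"
    using h.hom_one by simp
  have hcarr: "h x \<in> carrier (matrix_ring V)" if "x \<in> carrier A" for x
    using h.hom_closed[OF that] .
  have nonzero: "\<exists>i\<in>V. \<exists>j\<in>V. h x i j \<noteq> 0" if x: "x \<in> carrier A" "x \<noteq> \<zero>\<^bsub>A\<^esub>" for x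
  proof -
    obtain i j where "h x i j \<noteq> 0"
      using zero_iff[OF x(1)] x(2) by (auto simp: fun_eq_iff)
    then show ?thesis
      using B_carrier[OF in_B[OF x(1)]] by blast
  qed
  show prime: "prime_ring A"
    unfolding prime_ring_def
  proof (intro conjI allI impI)
    show "carrier A \<noteq> {\<zero>\<^bsub>A\<^esub>}"
    proof
      assume "carrier A = {\<zero>\<^bsub>A\<^esub>}"
      then have "\<one>\<^bsub>A\<^esub> = \<zero>\<^bsub>A\<^esub>"
        using A.one_closed by blast
      then have "scalar_matrix V 1 = scalar_matrix V (0 :: 'f)"
        using one h.hom_zero by (simp add: scalar_matrix_0)
      then show False
        using scalar_matrix_eq_iff[OF ne, of 1 "0 :: 'f"] by simp
    qed
  next
    fix I J assume I: "ideal I A" and J: "ideal J A" and IJ: "ideal_prod A I J = {\<zero>\<^bsub>A\<^esub>}"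
    show "I = {\<zero>\<^bsub>A\<^esub>} \<or> J = {\<zero>\<^bsub>A\<^esub>}"
    proof (rule ccontr)
      assume "\<not> ?thesis"
      then obtain x y where xy: "x \<in> I" "x \<noteq> \<zero>\<^bsub>A\<^esub>" "y \<in> J" "y \<noteq> \<zero>\<^bsub>A\<^esub>"
        using additive_subgroup.zero_closed[OF ideal.axioms(1)[OF I]]
          additive_subgroup.zero_closed[OF ideal.axioms(1)[OF J]] by blast
      have carr: "x \<in> carrier A" "y \<in> carrier A"
        using xy ideal.Icarr[OF I] ideal.Icarr[OF J] by auto
      obtain i j where ij: "i \<in> V" "j \<in> V" "h x i j \<noteq> 0"
        using nonzero[OF carr(1) xy(2)] by blast
      obtain k l where kl: "k \<in> V" "l \<in> V" "h y k l \<noteq> 0"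
        using nonzero[OF carr(2) xy(4)] by blast
      \<comment> \<open>An element \<open>w\<close> with the single entry g joins column j of x to
        row k of y, so that the (i, l) entry of the product x w y is a product of three nonzero
        field elements.\<close>
      obtain g where g: "g \<in> ent j k" "g \<noteq> 0"
        using ent_nonzero ij kl by blast
      obtain w where w: "w \<in> carrier A" "h w = single_entry j k g"
        using from_B[of "single_entry j k g"] g(1) by (auto simp: matrix_ent_def)
      have "x \<otimes>\<^bsub>A\<^esub> w \<otimes>\<^bsub>A\<^esub> y \<in> ideal_prod A I J"
        using ideal_prod.prod[OF ideal.I_r_closed[OF I xy(1) w(1)] xy(3)] .
      then have "h (x \<otimes>\<^bsub>A\<^esub> w \<otimes>\<^bsub>A\<^esub> y) i l = 0"
        using IJ h.hom_zero by simp
      moreover have "h (x \<otimes>\<^bsub>A\<^esub> w \<otimes>\<^bsub>A\<^esub> y) i l = (\<Sum>m\<in>V. (if m = k then h x i j * g else 0) * h y m l)"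
        by (simp add: mult[OF A.m_closed[OF carr(1) w(1)] carr(2)] mult[OF carr(1) w(1)] w(2)
            single_entry_mult(2)[OF fin ij(2)])
      moreover have "\<dots> = (\<Sum>m\<in>V. if m = k then h x i j * g * h y k l else 0)"
        by (rule sum.cong) auto
      ultimately show False
        using fin kl ij g by (simp add: sum.delta)
    qed
  qed (rule A)
  have centre: "ring_centre A = {x \<in> carrier A. \<exists>c\<in>Z. h x = scalar_matrix V c}"
  proof (intro equalityI subsetI)
    fix x assume x: "x \<in> ring_centre A"
    then have xc: "x \<in> carrier A"
      by (simp add: ring_centre_def)
    have "h x \<otimes>\<^bsub>matrix_ring V\<^esub> N = N \<otimes>\<^bsub>matrix_ring V\<^esub> h x" if N: "N \<in> B" for N
    proof -
      obtain y where "y \<in> carrier A" "N = h y"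
        using from_B[OF N] by blast
      moreover from this have "x \<otimes>\<^bsub>A\<^esub> y = y \<otimes>\<^bsub>A\<^esub> x"
        using x by (simp add: ring_centre_def)
      ultimately show ?thesis
        using xc h.hom_mult[of x y] h.hom_mult[of y x] by (simp del: matrix_ring_simps)
    qed
    from commutant[OF hcarr[OF xc] this] obtain c where c: "h x = scalar_matrix V c"
      by blast
    then have "c \<in> Z"
      using in_B[OF xc] scalar_in_B_iff by simp
    then show "x \<in> {x \<in> carrier A. \<exists>c\<in>Z. h x = scalar_matrix V c}"
      using xc c by blast
  next
    fix x assume "x \<in> {x \<in> carrier A. \<exists>c\<in>Z. h x = scalar_matrix V c}"
    then obtain c where x: "x \<in> carrier A" "h x = scalar_matrix V c"
      by blast
    have "x \<otimes>\<^bsub>A\<^esub> y = y \<otimes>\<^bsub>A\<^esub> x" if y: "y \<in> carrier A" for y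
    proof (rule inj_onD[OF inj])
      show "h (x \<otimes>\<^bsub>A\<^esub> y) = h (y \<otimes>\<^bsub>A\<^esub> x)"
        using scalar_matrix_central[OF fin hcarr[OF y], of c] h.hom_mult[OF x(1) y] h.hom_mult[OF y x(1)] x(2)
        by simp
    qed (use x y in auto)
    then show "x \<in> ring_centre A"
      using x by (simp add: ring_centre_def)
  qed
  have central: "\<exists>c. c \<in> Z \<and> c \<noteq> 0 \<and> h z = scalar_matrix V c"
    if z: "z \<in> ring_centre A - {\<zero>\<^bsub>A\<^esub>}" for z
  proof -
    obtain c where c: "z \<in> carrier A" "c \<in> Z" "h z = scalar_matrix V c"
      using z centre by blast
    moreover have "c \<noteq> 0"
      using c zero_iff[OF c(1)] z by (auto simp: scalar_matrix_0)
    ultimately show ?thesis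
      by blast
  qed
  have fraction: "\<exists>x z. x \<in> carrier A \<and> z \<in> ring_centre A - {\<zero>\<^bsub>A\<^esub>} \<and>
      h x = M \<otimes>\<^bsub>matrix_ring V\<^esub> h z" if M: "M \<in> Q0" for M
  proof -
    obtain N c where N: "M = (\<lambda>i j. N i j / c)" "N \<in> B" "c \<in> Z" "c \<noteq> 0"
      using M by (rule Q0_E)
    obtain x where x: "x \<in> carrier A" "h x = N"
      using from_B[OF N(2)] by blast
    obtain z where z: "z \<in> carrier A" "h z = scalar_matrix V c"
      using from_B[of "scalar_matrix V c"] N(3) scalar_in_B_iff by blast
    have "z \<noteq> \<zero>\<^bsub>A\<^esub>"
      using zero_iff[OF z(1)] z(2) N(4) scalar_matrix_eq_iff[OF ne, of c 0] by (auto simp: scalar_matrix_0)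
    then have "z \<in> ring_centre A - {\<zero>\<^bsub>A\<^esub>}"
      using z N(3) centre by blast
    moreover have "h x = M \<otimes>\<^bsub>matrix_ring V\<^esub> h z"
      using scalar_matrix_central[OF fin subsetD[OF Q0_carrier M], of c] N(4)
      unfolding x z N(1) by simp
    ultimately show ?thesis
      using x by blast
  qed
  text \<open>A matrix over the field of fractions is coded by the set of all its representations as a fraction.\<close>
  define t where "t M = {(x, z). x \<in> carrier A \<and> z \<in> ring_centre A - {\<zero>\<^bsub>A\<^esub>} \<and>
      h x = M \<otimes>\<^bsub>matrix_ring V\<^esub> h z}" for M
  have scale_right: "M \<otimes>\<^bsub>matrix_ring V\<^esub> scalar_matrix V c = (\<lambda>i j. c * M i j)" if "M \<in> Q0" for M c
    using scalar_matrix_central[OF fin subsetD[OF Q0_carrier that], of c] by blast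
  have inj_t: "inj_on t Q0"
  \<comment> \<open>One common representation (x, z) is enough: \<open>h z\<close> is a nonzero
    scalar matrix and can be cancelled.\<close>
  proof (rule inj_onI)
    fix M N assume MN: "M \<in> Q0" "N \<in> Q0" "t M = t N"
    obtain x z where xz: "x \<in> carrier A" "z \<in> ring_centre A - {\<zero>\<^bsub>A\<^esub>}" "h x = M \<otimes>\<^bsub>matrix_ring V\<^esub> h z"
      using fraction[OF MN(1)] by blast
    then have "(x, z) \<in> t M"
      by (simp add: t_def del: matrix_ring_simps)
    then have "(x, z) \<in> t N"
      unfolding MN(3) .
    then have "h x = N \<otimes>\<^bsub>matrix_ring V\<^esub> h z"
      by (simp add: t_def del: matrix_ring_simps)
    then have eq: "M \<otimes>\<^bsub>matrix_ring V\<^esub> h z = N \<otimes>\<^bsub>matrix_ring V\<^esub> h z"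
      unfolding xz(3) .
    obtain c where c: "c \<noteq> 0" "h z = scalar_matrix V c"
      using central[OF xz(2)] by blast
    have "(\<lambda>i j. c * M i j) = (\<lambda>i j. c * N i j)"
      using eq unfolding c(2) scale_right[OF MN(1)] scale_right[OF MN(2)] .
    then show "M = N"
      using c(1) by (simp add: fun_eq_iff)
  qed
  \<comment> \<open>\<open>has_PI_degree\<close> asks for a quotient ring whose elements are sets of
    pairs; the ring structure is carried over from \<open>Q0_ring\<close> along the injection
    \<open>t\<close>.\<close>
  define Q :: "('a \<times> 'a) set ring" where "Q = image_ring t Q0_ring"
  have iso: "t \<in> ring_iso Q0_ring Q"
    unfolding Q_def by (rule inj_imp_image_ring_iso) (simp add: inj_t)
  have Q: "ring Q"
    unfolding Q_def by (rule frac.inj_imp_image_ring_is_ring) (simp add: inj_t)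
  interpret t: ring_hom_ring Q0_ring Q t
    using iso by (intro ring_hom_ringI2[OF frac.ring_axioms Q]) (simp add: ring_iso_def)
  have carrier_Q: "carrier Q = t ` Q0"
    by (simp add: Q_def image_ring_carrier)
  have h_Q0: "h x \<in> Q0" if "x \<in> carrier A" for x
    using in_B[OF that] B_subset_Q0 by blast
  have hom_h: "h \<in> ring_hom A Q0_ring"
    using hom h_Q0 by (auto simp: ring_hom_def simp del: matrix_ring_simps)
  have th: "t \<circ> h \<in> ring_hom A Q"
    using ring_hom_trans[OF hom_h t.homh] .
  have inverse_Q: "t (h z) \<in> Units Q \<and> inv\<^bsub>Q\<^esub> t (h z) = t (scalar_matrix V (inverse c))"
    if c: "c \<in> Z" "c \<noteq> 0" "h z = scalar_matrix V c" for z c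
  proof -
    have Q0: "scalar_matrix V c \<in> Q0" "scalar_matrix V (inverse c) \<in> Q0"
      using c K_inverse K_I[OF c(1) Z_1] by (auto simp: scalar_in_Q0_iff)
    have "t (scalar_matrix V c) \<otimes>\<^bsub>Q\<^esub> t (scalar_matrix V (inverse c)) = \<one>\<^bsub>Q\<^esub>"
      "t (scalar_matrix V (inverse c)) \<otimes>\<^bsub>Q\<^esub> t (scalar_matrix V c) = \<one>\<^bsub>Q\<^esub>"
      using t.hom_mult[of "scalar_matrix V c" "scalar_matrix V (inverse c)"]
        t.hom_mult[of "scalar_matrix V (inverse c)" "scalar_matrix V c"] t.hom_one Q0 c(2)
      by (simp_all add: scalar_mult del: matrix_ring_simps(2))
    moreover have "t (scalar_matrix V c) \<in> carrier Q" "t (scalar_matrix V (inverse c)) \<in> carrier Q"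
      using Q0 carrier_Q by auto
    ultimately show ?thesis
      unfolding c(3) using t.S.inv_char by (auto simp: Units_def)
  qed
  have "central_quotient_ring A Q (t \<circ> h)"
    unfolding central_quotient_ring_def
  proof (intro conjI ballI)
    show "inj_on (t \<circ> h) (carrier A)"
      using inj inj_on_subset[OF inj_t B_subset_Q0] image by (auto intro: comp_inj_on)
    show "(t \<circ> h) z \<in> Units Q" if "z \<in> ring_centre A - {\<zero>\<^bsub>A\<^esub>}" for z
      using central[OF that] inverse_Q by auto
    have frac_eq: "t M = (t \<circ> h) x \<otimes>\<^bsub>Q\<^esub> inv\<^bsub>Q\<^esub> (t \<circ> h) z"
      if M: "M \<in> Q0" "x \<in> carrier A" "z \<in> ring_centre A - {\<zero>\<^bsub>A\<^esub>}" "h x = M \<otimes>\<^bsub>matrix_ring V\<^esub> h z" for M x z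
    proof -
      have "t (h x) = t M \<otimes>\<^bsub>Q\<^esub> t (h z)"
        using t.hom_mult[of M "h z"] M h_Q0 by (simp add: ring_centre_def del: matrix_ring_simps)
      moreover have "t (h z) \<in> Units Q"
        using central[OF M(3)] inverse_Q by auto
      moreover have "t M \<in> carrier Q"
        using M carrier_Q by blast
      ultimately show ?thesis
        using t.S.m_assoc[of "t M" "t (h z)" "inv\<^bsub>Q\<^esub> t (h z)"]
        by (simp add: t.S.Units_closed t.S.Units_inv_closed t.S.Units_r_inv)
    qed
    show "carrier Q = {(t \<circ> h) x \<otimes>\<^bsub>Q\<^esub> inv\<^bsub>Q\<^esub> (t \<circ> h) z |x z.
        x \<in> carrier A \<and> z \<in> ring_centre A - {\<zero>\<^bsub>A\<^esub>}}"
    proof (intro equalityI subsetI)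
      fix y assume "y \<in> carrier Q"
      then obtain M where M: "M \<in> Q0" "y = t M"
        unfolding carrier_Q by blast
      obtain x z where xz: "x \<in> carrier A" "z \<in> ring_centre A - {\<zero>\<^bsub>A\<^esub>}"
        "h x = M \<otimes>\<^bsub>matrix_ring V\<^esub> h z"
        using fraction[OF M(1)] by blast
      show "y \<in> {(t \<circ> h) x \<otimes>\<^bsub>Q\<^esub> inv\<^bsub>Q\<^esub> (t \<circ> h) z |x z.
          x \<in> carrier A \<and> z \<in> ring_centre A - {\<zero>\<^bsub>A\<^esub>}}"
        using frac_eq[OF M(1) xz] xz(1,2) M(2) by blast
    next
      fix y assume "y \<in> {(t \<circ> h) x \<otimes>\<^bsub>Q\<^esub> inv\<^bsub>Q\<^esub> (t \<circ> h) z |x z.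
          x \<in> carrier A \<and> z \<in> ring_centre A - {\<zero>\<^bsub>A\<^esub>}}"
      then obtain x z where xz: "y = t (h x) \<otimes>\<^bsub>Q\<^esub> inv\<^bsub>Q\<^esub> t (h z)" "x \<in> carrier A" "z \<in> ring_centre A - {\<zero>\<^bsub>A\<^esub>}"
        by auto
      have "t (h z) \<in> Units Q"
        using central[OF xz(3)] inverse_Q by auto
      moreover have "t (h x) \<in> carrier Q"
        using h_Q0[OF xz(2)] carrier_Q by simp
      ultimately show "y \<in> carrier Q"
        unfolding xz(1) using t.S.m_closed t.S.Units_inv_closed by simp
    qed
  qed (use Q th in auto)
  moreover have centre_Q: "ring_centre Q = t ` ring_centre Q0_ring"
    by (rule ring_iso_centre[OF iso frac.ring_axioms])
  moreover have one_Q: "\<one>\<^bsub>Q\<^esub> \<noteq> \<zero>\<^bsub>Q\<^esub>"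
  proof
    assume "\<one>\<^bsub>Q\<^esub> = \<zero>\<^bsub>Q\<^esub>"
    then have "t \<one>\<^bsub>Q0_ring\<^esub> = t \<zero>\<^bsub>Q0_ring\<^esub>"
      using t.hom_one t.hom_zero by simp
    then have "\<one>\<^bsub>Q0_ring\<^esub> = \<zero>\<^bsub>Q0_ring\<^esub>"
      using inj_onD[OF inj_t] frac.one_closed frac.zero_closed by simp
    then show False
      using subfieldE(6)[OF subfield_centre_Q0] by blast
  qed
  moreover have "subfield (t ` ring_centre Q0_ring) Q"
    by (rule t.img_is_subfield(2)[OF subfield_centre_Q0 one_Q])
  moreover have "ring.dimension Q ((card V)\<^sup>2) (t ` ring_centre Q0_ring) (carrier Q)"
    unfolding carrier_Q using t.inj_hom_dimension[OF subfield_centre_Q0 one_Q inj_t dimension_Q0] .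
  ultimately show "has_PI_degree A (card V)"
    unfolding has_PI_degree_def using prime by auto
qed

section \<open>Path algebras\<close>

text \<open>Used for associativity of the path product: cutting a path at positions l \<le> k is the
  same as choosing the length l of the first and m = k - l of the second piece.\<close>

lemma sum_triangle: "(\<Sum>k\<le>n. \<Sum>l\<le>k. a l k) = (\<Sum>l\<le>n. \<Sum>m\<le>n - l. a l (l + m))"
  for n :: nat and a :: "nat \<Rightarrow> nat \<Rightarrow> 'a::comm_monoid_add"
proof -
  have "(\<Sum>l\<le>n. \<Sum>m\<le>n - l. a l (l + m)) = (\<Sum>(l, m)\<in>(SIGMA l:{..n}. {..n - l}). a l (l + m))"
    by (simp add: sum.Sigma)
  also have "(SIGMA l:{..n}. {..n - l}) = {(l, m). l + m \<le> n}"
    by auto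
  also have "(\<Sum>(l, m)\<in>{(l, m). l + m \<le> n}. a l (l + m)) = (\<Sum>k\<le>n. \<Sum>l\<le>k. a l (l + (k - l)))"
    by (rule sum.triangle_reindex_eq)
  also have "\<dots> = (\<Sum>k\<le>n. \<Sum>l\<le>k. a l k)"
    by (intro sum.cong) auto
  finally show ?thesis ..
qed

definition coeff_support :: "('x \<Rightarrow> complex) \<Rightarrow> 'x set" where
  "coeff_support f = {x. f x \<noteq> 0}"

definition path_term :: "'v \<times> 'e list \<Rightarrow> complex \<Rightarrow> 'v \<times> 'e list \<Rightarrow> complex" where
  "path_term x c = (\<lambda>z. if z = x then c else 0)"

context pre_digraph
begin

abbreviation path_end :: "'a \<times> 'b list \<Rightarrow> 'a" where
  "path_end x \<equiv> awlast (fst x) (snd x)"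

lemma path_algebra_simps:
  "f \<in> carrier (path_algebra G) \<longleftrightarrow>
    finite (coeff_support f) \<and> coeff_support f \<subseteq> quiver_paths G"
  "f \<otimes>\<^bsub>path_algebra G\<^esub> g = (\<lambda>(u, x). \<Sum>k\<le>length x. f (u, take k x) * g (awlast u (take k x), drop k x))"
  "\<one>\<^bsub>path_algebra G\<^esub> = (\<lambda>(u, x). if u \<in> verts G \<and> x = [] then 1 else 0)"
  "\<zero>\<^bsub>path_algebra G\<^esub> = (\<lambda>_. 0)"
  "f \<oplus>\<^bsub>path_algebra G\<^esub> g = (\<lambda>x. f x + g x)"
  by (simp_all add: path_algebra_def coeff_support_def)

lemma awlast_append': "awlast u (x @ y) = awlast (awlast u x) y"
  by (simp add: awalk_verts_conv)

end

context wf_digraph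
begin

lemma quiver_paths_iff: "x \<in> quiver_paths G \<longleftrightarrow> awalk (fst x) (snd x) (path_end x)"
proof -
  have "awalk (fst x) (snd x) (path_end x)" if w: "awalk (fst x) (snd x) v" for v
  proof -
    have "path_end x = v"
      using w unfolding awalk_def by (intro awlast_if_cas) blast
    then show ?thesis
      using w by simp
  qed
  then show ?thesis
    unfolding quiver_paths_def by (cases x) auto
qed

text \<open>The product is defined by cutting z; here it becomes a sum over pairs of composable
  paths, which suits bilinear arguments. Arbitrary finite supersets of the supports are allowed, in
  particular the singletons belonging to \<open>path_term\<close>.\<close>

lemma path_mult_expand:
  assumes F: "finite F" "coeff_support f \<subseteq> F" and H: "finite H" "coeff_support g \<subseteq> H"
  shows "(f \<otimes>\<^bsub>path_algebra G\<^esub> g) z =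
    (\<Sum>x\<in>F. \<Sum>y\<in>H. if path_end x = fst y \<and> z = (fst x, snd x @ snd y) then f x * g y else 0)"
proof -
  obtain u w where z: "z = (u, w)"
    by (cases z)
  define c where "c = (\<lambda>(x, y). if path_end x = fst y \<and> z = (fst x, snd x @ snd y) then f x * g y else 0)"
  define a where "a k = f (u, take k w) * g (awlast u (take k w), drop k w)" for k
  define j where "j k = ((u, take k w), (awlast u (take k w), drop k w))" for k
  have "(f \<otimes>\<^bsub>path_algebra G\<^esub> g) z = (\<Sum>k\<le>length w. a k)"
    by (simp add: path_algebra_simps z a_def)
  also have "\<dots> = (\<Sum>b\<in>F \<times> H. c b)"
  \<comment> \<open>A cut at k corresponds to the pair of its two pieces. This is a bijection only
    between nonzero summands: a pair need not compose to z, and the pieces of a cut need not lie in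
    the supports.\<close>
  proof (rule sum.reindex_bij_witness_not_neutral[where j = j and i = "\<lambda>(x, y). length (snd x)"
        and S' = "{k. k \<le> length w \<and> a k = 0}" and T' = "{b \<in> F \<times> H. c b = 0}"])
    fix b assume b: "b \<in> F \<times> H - {b \<in> F \<times> H. c b = 0}"
    obtain x1 x2 y1 y2 where xy: "b = ((x1, x2), (y1, y2))"
      by (metis surj_pair)
    have ne: "awlast x1 x2 = y1" "u = x1" "w = x2 @ y2" "c b = f (x1, x2) * g (y1, y2)" "c b \<noteq> 0"
      using b unfolding xy c_def z by (auto split: if_splits)
    show "j ((\<lambda>(x, y). length (snd x)) b) = b"
      using ne by (simp add: xy j_def)
    show "(\<lambda>(x, y). length (snd x)) b \<in> {..length w} - {k. k \<le> length w \<and> a k = 0}"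
      using ne by (auto simp: xy a_def)
  next
    fix k assume k: "k \<in> {..length w}"
    have c: "c (j k) = a k"
      by (simp add: c_def j_def z a_def)
    show "c (j k) = a k"
      by (rule c)
  next
    fix k assume k: "k \<in> {..length w} - {k. k \<le> length w \<and> a k = 0}"
    then show "(\<lambda>(x, y). length (snd x)) (j k) = k"
      by (simp add: j_def)
    have c: "c (j k) = a k"
      by (simp add: c_def j_def z a_def)
    have "f (u, take k w) \<noteq> 0" "g (awlast u (take k w), drop k w) \<noteq> 0"
      using k by (auto simp: a_def)
    then have "j k \<in> F \<times> H"
      using F(2) H(2) by (auto simp: j_def coeff_support_def)
    then show "j k \<in> F \<times> H - {b \<in> F \<times> H. c b = 0}"
      using c k by auto
  qed (use F H in auto)
  also have "\<dots> = (\<Sum>x\<in>F. \<Sum>y\<in>H. c (x, y))"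
    by (simp add: sum.cartesian_product)
  finally show ?thesis
    by (simp add: c_def)
qed

lemma coeff_support_mult:
  assumes "finite (coeff_support f)" "finite (coeff_support g)"
  shows "coeff_support (f \<otimes>\<^bsub>path_algebra G\<^esub> g) \<subseteq>
    (\<lambda>(x, y). (fst x, snd x @ snd y)) ` {(x, y) \<in> coeff_support f \<times> coeff_support g. path_end x = fst y}"
proof
  fix z assume "z \<in> coeff_support (f \<otimes>\<^bsub>path_algebra G\<^esub> g)"
  then have "(\<Sum>x\<in>coeff_support f. \<Sum>y\<in>coeff_support g.
      if path_end x = fst y \<and> z = (fst x, snd x @ snd y) then f x * g y else 0) \<noteq> 0"
    using path_mult_expand[OF assms(1) subset_refl assms(2) subset_refl, of z]
    by (simp add: coeff_support_def)
  then obtain x where x: "x \<in> coeff_support f" "(\<Sum>y\<in>coeff_support g.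
      if path_end x = fst y \<and> z = (fst x, snd x @ snd y) then f x * g y else 0) \<noteq> 0"
    by (rule sum.not_neutral_contains_not_neutral)
  from x(2) obtain y where y: "y \<in> coeff_support g"
      "(if path_end x = fst y \<and> z = (fst x, snd x @ snd y) then f x * g y else 0) \<noteq> 0"
    by (rule sum.not_neutral_contains_not_neutral)
  have "path_end x = fst y" "z = (fst x, snd x @ snd y)"
    using y(2) by (auto split: if_splits)
  then show "z \<in> (\<lambda>(x, y). (fst x, snd x @ snd y)) `
      {(x, y) \<in> coeff_support f \<times> coeff_support g. path_end x = fst y}"
    using x(1) y(1) by (intro image_eqI[of _ _ "(x, y)"]) auto
qed

lemma path_mult_closed:
  assumes f: "f \<in> carrier (path_algebra G)" and g: "g \<in> carrier (path_algebra G)"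
  shows "f \<otimes>\<^bsub>path_algebra G\<^esub> g \<in> carrier (path_algebra G)"
proof -
  have fin: "finite (coeff_support f)" "finite (coeff_support g)"
    and sub: "coeff_support f \<subseteq> quiver_paths G" "coeff_support g \<subseteq> quiver_paths G"
    using f g by (auto simp: path_algebra_simps(1))
  have "finite {(x, y) \<in> coeff_support f \<times> coeff_support g. path_end x = fst y}"
    by (rule finite_subset[OF _ finite_cartesian_product[OF fin]]) auto
  moreover have "(\<lambda>(x, y). (fst x, snd x @ snd y)) `
      {(x, y) \<in> coeff_support f \<times> coeff_support g. path_end x = fst y} \<subseteq> quiver_paths G"
    using sub by (auto simp: quiver_paths_iff awlast_append' dest!: subsetD)
  ultimately show ?thesis
    unfolding path_algebra_simps(1) using coeff_support_mult[OF fin]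
    by (meson finite_imageI finite_subset subset_trans)
qed

lemma ring_path_algebra:
  assumes V: "finite (verts G)"
  shows "ring (path_algebra G)"
proof (rule ringI)
  show "abelian_group (path_algebra G)"
  proof (rule abelian_groupI)
    fix f g assume fg: "f \<in> carrier (path_algebra G)" "g \<in> carrier (path_algebra G)"
    have "coeff_support (\<lambda>x. f x + g x) \<subseteq> coeff_support f \<union> coeff_support g"
      by (auto simp: coeff_support_def)
    then show "f \<oplus>\<^bsub>path_algebra G\<^esub> g \<in> carrier (path_algebra G)"
      using fg unfolding path_algebra_simps by (meson finite_UnI finite_subset le_sup_iff subset_trans)
  next
    fix f assume f: "f \<in> carrier (path_algebra G)"
    have "coeff_support (\<lambda>x. - f x) = coeff_support f"
      by (auto simp: coeff_support_def)
    then have "(\<lambda>x. - f x) \<in> carrier (path_algebra G)"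
      using f by (simp add: path_algebra_simps)
    then show "\<exists>g\<in>carrier (path_algebra G). g \<oplus>\<^bsub>path_algebra G\<^esub> f = \<zero>\<^bsub>path_algebra G\<^esub>"
      by (rule bexI[rotated]) (simp add: path_algebra_simps)
  qed (auto simp: path_algebra_simps coeff_support_def add.assoc add.commute)
  show "monoid (path_algebra G)"
  proof (rule monoidI)
    have "coeff_support \<one>\<^bsub>path_algebra G\<^esub> \<subseteq> (\<lambda>v. (v, [])) ` verts G"
      by (auto simp: path_algebra_simps coeff_support_def split: if_splits)
    moreover have "(\<lambda>v. (v, [])) ` verts G \<subseteq> quiver_paths G"
      by (auto simp: quiver_paths_iff awalk_Nil_iff)
    ultimately show "\<one>\<^bsub>path_algebra G\<^esub> \<in> carrier (path_algebra G)"
      unfolding path_algebra_simps(1) using V by (meson finite_imageI finite_subset subset_trans)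
  next
    fix f g h :: "'a \<times> 'b list \<Rightarrow> complex"
    have "(f \<otimes>\<^bsub>path_algebra G\<^esub> g \<otimes>\<^bsub>path_algebra G\<^esub> h) (u, x) =
        (f \<otimes>\<^bsub>path_algebra G\<^esub> (g \<otimes>\<^bsub>path_algebra G\<^esub> h)) (u, x)" for u x
    proof -
      define a where "a l k = f (u, take l x) * g (awlast u (take l x), drop l (take k x)) *
          h (awlast u (take k x), drop k x)" for l k
      have "(f \<otimes>\<^bsub>path_algebra G\<^esub> g \<otimes>\<^bsub>path_algebra G\<^esub> h) (u, x) = (\<Sum>k\<le>length x. \<Sum>l\<le>k. a l k)"
        unfolding path_algebra_simps a_def sum_distrib_right prod.case
        by (intro sum.cong) (auto simp: min_absorb1 min_absorb2)
      also have "\<dots> = (\<Sum>l\<le>length x. \<Sum>m\<le>length x - l. a l (l + m))"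
        by (rule sum_triangle)
      also have "\<dots> = (f \<otimes>\<^bsub>path_algebra G\<^esub> (g \<otimes>\<^bsub>path_algebra G\<^esub> h)) (u, x)"
        unfolding path_algebra_simps a_def sum_distrib_left prod.case
      proof (intro sum.cong refl)
        fix l m assume lm: "l \<in> {..length x}" "m \<in> {..length (drop l x)}"
        have "take (l + m) x = take l x @ take m (drop l x)"
          by (simp add: take_add)
        then have "awlast u (take (l + m) x) = awlast (awlast u (take l x)) (take m (drop l x))"
          by (simp add: awlast_append')
        then show "f (u, take l x) * g (awlast u (take l x), drop l (take (l + m) x)) *
            h (awlast u (take (l + m) x), drop (l + m) x) =
          f (u, take l x) * (g (awlast u (take l x), take m (drop l x)) *
            h (awlast (awlast u (take l x)) (take m (drop l x)), drop m (drop l x)))"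
          by (simp add: take_drop add.commute mult.assoc)
      qed simp
      finally show ?thesis .
    qed
    then show "f \<otimes>\<^bsub>path_algebra G\<^esub> g \<otimes>\<^bsub>path_algebra G\<^esub> h = f \<otimes>\<^bsub>path_algebra G\<^esub> (g \<otimes>\<^bsub>path_algebra G\<^esub> h)"
      by (intro ext) (metis surj_pair)
  next
    fix f assume f: "f \<in> carrier (path_algebra G)"
    \<comment> \<open>The unit is supported on trivial paths at vertices of \<open>G\<close>, so the
      unit laws need the ends of every path in the support of f to be vertices.\<close>
    have walk: "awalk u x (awlast u x)" if "f (u, x) \<noteq> 0" for u x
    proof -
      have "(u, x) \<in> quiver_paths G"
        using f that by (auto simp: path_algebra_simps coeff_support_def)
      then show ?thesis
        by (simp add: quiver_paths_iff)
    qed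
    have "(\<one>\<^bsub>path_algebra G\<^esub> \<otimes>\<^bsub>path_algebra G\<^esub> f) (u, x) = f (u, x)" for u x
    proof -
      have "(\<one>\<^bsub>path_algebra G\<^esub> \<otimes>\<^bsub>path_algebra G\<^esub> f) (u, x) =
          (\<Sum>k\<le>length x. if k = 0 then (if u \<in> verts G then f (u, x) else 0) else 0)"
        unfolding path_algebra_simps prod.case by (rule sum.cong) auto
      also have "\<dots> = f (u, x)"
        using walk[of u x] by (auto simp: sum.delta awalk_def)
      finally show ?thesis .
    qed
    then show "\<one>\<^bsub>path_algebra G\<^esub> \<otimes>\<^bsub>path_algebra G\<^esub> f = f"
      by (intro ext) (metis surj_pair)
    have "(f \<otimes>\<^bsub>path_algebra G\<^esub> \<one>\<^bsub>path_algebra G\<^esub>) (u, x) = f (u, x)" for u x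
    proof -
      have "(f \<otimes>\<^bsub>path_algebra G\<^esub> \<one>\<^bsub>path_algebra G\<^esub>) (u, x) =
          (\<Sum>k\<le>length x. if k = length x then (if awlast u x \<in> verts G then f (u, x) else 0) else 0)"
        unfolding path_algebra_simps prod.case by (rule sum.cong) auto
      also have "\<dots> = f (u, x)"
        using walk[of u x] by (auto simp: sum.delta dest: awalk_last_in_verts)
      finally show ?thesis .
    qed
    then show "f \<otimes>\<^bsub>path_algebra G\<^esub> \<one>\<^bsub>path_algebra G\<^esub> = f"
      by (intro ext) (metis surj_pair)
  qed (rule path_mult_closed)
qed (auto simp: path_algebra_simps fun_eq_iff algebra_simps sum.distrib)

lemma path_minus:
  assumes "finite (verts G)" "f \<in> carrier (path_algebra G)" "g \<in> carrier (path_algebra G)"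
  shows "f \<ominus>\<^bsub>path_algebra G\<^esub> g = (\<lambda>x. f x - g x)"
proof -
  interpret ring "path_algebra G"
    by (rule ring_path_algebra[OF assms(1)])
  have "coeff_support (\<lambda>x. - g x) = coeff_support g"
    by (auto simp: coeff_support_def)
  then have "(\<lambda>x. - g x) \<in> carrier (path_algebra G)"
    using assms(3) by (simp add: path_algebra_simps)
  then have "\<ominus>\<^bsub>path_algebra G\<^esub> g = (\<lambda>x. - g x)"
    using assms(3) by (intro minus_equality) (auto simp: path_algebra_simps)
  then show ?thesis
    by (simp add: a_minus_def path_algebra_simps)
qed

lemma coeff_support_path_term: "coeff_support (path_term x c) \<subseteq> {x}"
  by (auto simp: coeff_support_def path_term_def)

lemma path_term_carrier: "x \<in> quiver_paths G \<Longrightarrow> path_term x c \<in> carrier (path_algebra G)"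
  using coeff_support_path_term[of x c] by (auto simp: path_algebra_simps intro: finite_subset)

lemma path_term_mult:
  assumes "path_end x = fst y"
  shows "path_term x c \<otimes>\<^bsub>path_algebra G\<^esub> path_term y d = path_term (fst x, snd x @ snd y) (c * d)"
proof
  fix z
  show "(path_term x c \<otimes>\<^bsub>path_algebra G\<^esub> path_term y d) z = path_term (fst x, snd x @ snd y) (c * d) z"
    using path_mult_expand[OF _ coeff_support_path_term _ coeff_support_path_term, of x y c d z] assms
    by (simp add: path_term_def)
qed

end

section \<open>The weight representation\<close>

context weighted_relations
begin

text \<open>In C[x][y] the inner variable x carries the \<open>p\<close>-weight and the outer
  variable y the \<open>q\<close>-weight.\<close>

definition path_monomial :: "'v \<times> 'e list \<Rightarrow> complex \<Rightarrow> complex poly poly" where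
  "path_monomial x c = monom (monom c (path_weight p (snd x))) (path_weight q (snd x))"

definition entry_sum :: "('v \<times> 'e list \<Rightarrow> complex) \<Rightarrow> 'v \<Rightarrow> 'v \<Rightarrow> complex poly poly" where
  "entry_sum f i j =
    (\<Sum>x\<in>coeff_support f. if fst x = i \<and> path_end x = j then path_monomial x (f x) else 0)"

lemma path_monomial_0 [simp]: "path_monomial x 0 = 0"
  by (simp add: path_monomial_def)

lemma path_monomial_add: "path_monomial x (c + d) = path_monomial x c + path_monomial x d"
  by (simp add: path_monomial_def add_monom)

lemma path_monomial_sum: "path_monomial x (sum f T) = (\<Sum>t\<in>T. path_monomial x (f t))"
  by (induction T rule: infinite_finite_induct) (simp_all add: path_monomial_add)

lemma path_monomial_mult:
  "path_monomial (u, snd x @ snd y) (c * d) = path_monomial x c * path_monomial y d"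
  by (simp add: path_monomial_def mult_monom)

lemma entry_sum_superset:
  assumes "finite T" "coeff_support f \<subseteq> T"
  shows "entry_sum f i j = (\<Sum>x\<in>T. if fst x = i \<and> path_end x = j then path_monomial x (f x) else 0)"
  unfolding entry_sum_def
  by (rule sum.mono_neutral_left) (use assms in \<open>auto simp: coeff_support_def\<close>)

lemma entry_sum_add:
  assumes "finite (coeff_support f)" "finite (coeff_support g)"
  shows "entry_sum (\<lambda>x. f x + g x) i j = entry_sum f i j + entry_sum g i j"
proof -
  let ?T = "coeff_support f \<union> coeff_support g"
  have "coeff_support (\<lambda>x. f x + g x) \<subseteq> ?T"
    by (auto simp: coeff_support_def)
  then show ?thesis
    using assms
    by (simp add: entry_sum_superset[of ?T] flip: sum.distrib)
      (rule sum.cong, auto simp: path_monomial_add)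
qed

lemma entry_sum_path_term:
  "entry_sum (path_term x c) i j = (if fst x = i \<and> path_end x = j then path_monomial x c else 0)"
  using entry_sum_superset[OF _ coeff_support_path_term, of x c i j] by (auto simp: path_term_def)

text \<open>A coefficient collects exactly the parallel paths of one weight; this is what makes the
  kernel accessible.\<close>

lemma coeff_entry_sum:
  "coeff (coeff (entry_sum f i j) b) a =
    (\<Sum>x\<in>coeff_support f. if fst x = i \<and> path_end x = j \<and>
      path_weight p (snd x) = a \<and> path_weight q (snd x) = b then f x else 0)"
  unfolding entry_sum_def coeff_sum
  by (rule sum.cong) (auto simp: path_monomial_def)

text \<open>Both sides equal the sum of \<open>M x y\<close> over pairs of paths: the left side
  groups the pairs by their concatenation z, the right side by the vertex k at which they
  meet.\<close>

lemma entry_sum_mult: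
  assumes V: "finite (verts G)"
    and f: "f \<in> carrier (path_algebra G)" and g: "g \<in> carrier (path_algebra G)"
  shows "entry_sum (f \<otimes>\<^bsub>path_algebra G\<^esub> g) i j = (\<Sum>k\<in>verts G. entry_sum f i k * entry_sum g k j)"
proof -
  let ?F = "coeff_support f" and ?H = "coeff_support g"
  have fin: "finite ?F" "finite ?H"
    using f g by (auto simp: path_algebra_simps(1))
  have end_verts: "path_end x \<in> verts G" if "x \<in> ?F" for x
  proof -
    have "x \<in> quiver_paths G"
      using f that by (auto simp: path_algebra_simps(1))
    then show ?thesis
      by (auto simp: quiver_paths_iff dest: awalk_last_in_verts)
  qed
  define T where "T = (\<lambda>(x, y). (fst x, snd x @ snd y)) ` (?F \<times> ?H)"
  have finT: "finite T"
    using fin by (simp add: T_def)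
  have supp: "coeff_support (f \<otimes>\<^bsub>path_algebra G\<^esub> g) \<subseteq> T"
    using coeff_support_mult[OF fin] unfolding T_def by (rule order_trans) auto
  define M where "M x y = (if fst x = i \<and> path_end x = fst y \<and> path_end y = j
      then path_monomial x (f x) * path_monomial y (g y) else 0)" for x y
  have if_mult: "(if k = e then (if s = i \<and> e = t \<and> e' = j then a * b else 0) else 0) =
      (if s = i \<and> e = k then a else 0) * (if t = k \<and> e' = j then b else 0)"
    for k e s t e' :: 'v and a b :: "complex poly poly"
    by auto
  have "entry_sum (f \<otimes>\<^bsub>path_algebra G\<^esub> g) i j =
      (\<Sum>z\<in>T. \<Sum>x\<in>?F. \<Sum>y\<in>?H. if z = (fst x, snd x @ snd y) then M x y else 0)"
    unfolding entry_sum_superset[OF finT supp]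
  proof (rule sum.cong)
    fix z assume "z \<in> T"
    have if_sum: "(if C then (\<Sum>x\<in>?F. \<Sum>y\<in>?H. t x y) else 0) =
        (\<Sum>x\<in>?F. \<Sum>y\<in>?H. if C then t x y else 0)" for C and t :: "_ \<Rightarrow> _ \<Rightarrow> complex poly poly"
      by simp
    have "path_monomial z ((f \<otimes>\<^bsub>path_algebra G\<^esub> g) z) =
        (\<Sum>x\<in>?F. \<Sum>y\<in>?H. path_monomial z
          (if path_end x = fst y \<and> z = (fst x, snd x @ snd y) then f x * g y else 0))"
      unfolding path_mult_expand[OF fin(1) subset_refl fin(2) subset_refl] path_monomial_sum ..
    then have "(if fst z = i \<and> path_end z = j then path_monomial z ((f \<otimes>\<^bsub>path_algebra G\<^esub> g) z) else 0) =
        (\<Sum>x\<in>?F. \<Sum>y\<in>?H. if fst z = i \<and> path_end z = j then path_monomial z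
          (if path_end x = fst y \<and> z = (fst x, snd x @ snd y) then f x * g y else 0) else 0)"
      by (simp only: if_sum)
    also have "\<dots> = (\<Sum>x\<in>?F. \<Sum>y\<in>?H. if z = (fst x, snd x @ snd y) then M x y else 0)"
      by (intro sum.cong refl) (auto simp: M_def path_monomial_mult awlast_append')
    finally show "(if fst z = i \<and> path_end z = j then path_monomial z ((f \<otimes>\<^bsub>path_algebra G\<^esub> g) z) else 0) =
        (\<Sum>x\<in>?F. \<Sum>y\<in>?H. if z = (fst x, snd x @ snd y) then M x y else 0)" .
  qed simp
  also have "\<dots> = (\<Sum>x\<in>?F. \<Sum>y\<in>?H. \<Sum>z\<in>T. if z = (fst x, snd x @ snd y) then M x y else 0)"
    by (subst sum.swap) (intro sum.cong refl sum.swap)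
  also have "\<dots> = (\<Sum>x\<in>?F. \<Sum>y\<in>?H. M x y)"
  proof (intro sum.cong refl)
    fix x y assume "x \<in> ?F" "y \<in> ?H"
    then have "(fst x, snd x @ snd y) \<in> T"
      unfolding T_def by (intro image_eqI[of _ _ "(x, y)"]) auto
    then show "(\<Sum>z\<in>T. if z = (fst x, snd x @ snd y) then M x y else 0) = M x y"
      using finT by (simp add: sum.delta)
  qed
  also have "\<dots> = (\<Sum>x\<in>?F. \<Sum>y\<in>?H. \<Sum>k\<in>verts G. if k = path_end x then M x y else 0)"
    using V end_verts by (intro sum.cong refl) (simp add: sum.delta)
  also have "\<dots> = (\<Sum>k\<in>verts G. \<Sum>x\<in>?F. \<Sum>y\<in>?H. if k = path_end x then M x y else 0)"
    by (subst sum.swap[of _ "verts G"]) (intro sum.cong refl sum.swap)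
  also have "\<dots> = (\<Sum>k\<in>verts G. entry_sum f i k * entry_sum g k j)"
    unfolding entry_sum_def sum_product
    unfolding M_def by (intro sum.cong refl) (rule if_mult)
  finally show ?thesis .
qed

text \<open>The entries are polynomials; they are placed in the fraction field because
  \<open>matrix_order\<close> works over a field.\<close>

definition weight_matrix :: "('v \<times> 'e list \<Rightarrow> complex) \<Rightarrow> 'v \<Rightarrow> 'v \<Rightarrow> complex poly poly fract" where
  "weight_matrix f i j = to_fract (entry_sum f i j)"

lemma to_fract_sum: "to_fract (sum f T) = (\<Sum>t\<in>T. to_fract (f t))"
  by (induction T rule: infinite_finite_induct) simp_all

lemma weight_matrix_hom:
  assumes V: "finite (verts G)"
  shows "weight_matrix \<in> ring_hom (path_algebra G) (matrix_ring (verts G))"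
proof (rule ring_hom_memI)
  fix f assume f: "f \<in> carrier (path_algebra G)"
  show "weight_matrix f \<in> carrier (matrix_ring (verts G))"
    unfolding matrix_ring_simps
  proof (intro allI impI)
    fix i j assume "weight_matrix f i j \<noteq> 0"
    then have "entry_sum f i j \<noteq> 0"
      by (simp add: weight_matrix_def)
    then obtain x where x: "x \<in> coeff_support f"
        "(if fst x = i \<and> path_end x = j then path_monomial x (f x) else 0) \<noteq> 0"
      unfolding entry_sum_def by (rule sum.not_neutral_contains_not_neutral)
    have "x \<in> quiver_paths G"
      using x f by (auto simp: path_algebra_simps(1))
    then have "fst x \<in> verts G" "path_end x \<in> verts G"
      by (auto simp: quiver_paths_iff dest: awalk_last_in_verts awalk_hd_in_verts)
    then show "i \<in> verts G \<and> j \<in> verts G"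
      using x(2) by (auto split: if_splits)
  qed
  fix g assume g: "g \<in> carrier (path_algebra G)"
  show "weight_matrix (f \<otimes>\<^bsub>path_algebra G\<^esub> g) =
      weight_matrix f \<otimes>\<^bsub>matrix_ring (verts G)\<^esub> weight_matrix g"
    by (intro ext) (simp add: weight_matrix_def entry_sum_mult[OF V f g] to_fract_sum)
  show "weight_matrix (f \<oplus>\<^bsub>path_algebra G\<^esub> g) =
      weight_matrix f \<oplus>\<^bsub>matrix_ring (verts G)\<^esub> weight_matrix g"
    using f g by (intro ext) (simp add: weight_matrix_def entry_sum_add path_algebra_simps)
next
  have "coeff_support \<one>\<^bsub>path_algebra G\<^esub> \<subseteq> (\<lambda>v. (v, [])) ` verts G"
    by (auto simp: path_algebra_simps coeff_support_def split: if_splits)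
  moreover have "inj_on (\<lambda>v. (v, [] :: 'e list)) (verts G)"
    by (auto intro: inj_onI)
  ultimately have "entry_sum \<one>\<^bsub>path_algebra G\<^esub> i j = (\<Sum>v\<in>verts G. if v = i \<and> v = j then 1 else 0)" for i j
    using V by (subst entry_sum_superset[of "(\<lambda>v. (v, [])) ` verts G"])
      (auto simp: sum.reindex path_algebra_simps path_monomial_def intro!: sum.cong)
  then have "entry_sum \<one>\<^bsub>path_algebra G\<^esub> i j = (if i = j \<and> i \<in> verts G then 1 else 0)" for i j
    using V by (cases "i = j") (auto simp: sum.delta intro!: sum.neutral)
  then show "weight_matrix \<one>\<^bsub>path_algebra G\<^esub> = \<one>\<^bsub>matrix_ring (verts G)\<^esub>"
    by (auto simp: weight_matrix_def scalar_matrix_def fun_eq_iff)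
qed


text \<open>A generator multiplied by path terms on both sides is the difference of two paths in
  context. The coefficient c is absorbed by the left factor and kept arbitrary, so that symmetry
  amounts to replacing c by -c, and transitivity to adding two differences.\<close>

lemma path_cong_difference:
  assumes V: "finite (verts G)" and I: "ideal I (path_algebra G)"
    and S: "\<And>x y. (x, y) \<in> S \<Longrightarrow> path_elem G x \<ominus>\<^bsub>path_algebra G\<^esub> path_elem G y \<in> I"
  shows "path_cong S x y \<Longrightarrow> awalk u x v \<Longrightarrow> (\<lambda>z. path_term (u, x) c z - path_term (u, y) c z) \<in> I"
proof (induction arbitrary: u v c rule: path_cong.induct)
  interpret ideal I "path_algebra G"
    by (rule I)
  {
    case (path_cong_rel x y a b)
    let ?v = "awlast u a" and ?w = "awlast (awlast u a) x"
    have xy: "path_cong S x y"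
      using path_cong.path_cong_rel[OF path_cong_rel(1), of "[]" "[]"] by simp
    have walks: "awalk u a ?v" "awalk ?v x ?w" "awalk ?v y ?w" "awalk ?w b v"
      using path_cong_rel(2) path_cong_awalk_iff[OF xy] by auto
    have ne: "x \<noteq> []" "y \<noteq> []"
      using rel_ne[OF path_cong_rel(1)] by auto
    have "path_elem G x = path_term (?v, x) 1" "path_elem G y = path_term (?v, y) 1"
      using awalk_ne_ends(1)[OF walks(2) ne(1)] awalk_ne_ends(1)[OF walks(3) ne(2)]
      by (auto simp: path_elem_def path_term_def fun_eq_iff)
    then have "path_term (?v, x) 1 \<ominus>\<^bsub>path_algebra G\<^esub> path_term (?v, y) 1 \<in> I"
      using S[OF path_cong_rel(1)] by simp
    moreover have carr: "path_term (u, a) c \<in> carrier (path_algebra G)"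
      "path_term (?v, x) 1 \<in> carrier (path_algebra G)" "path_term (?v, y) 1 \<in> carrier (path_algebra G)"
      "path_term (?w, b) 1 \<in> carrier (path_algebra G)"
      using walks by (auto intro!: path_term_carrier simp: quiver_paths_def)
    ultimately have "path_term (u, a) c \<otimes>\<^bsub>path_algebra G\<^esub>
        (path_term (?v, x) 1 \<ominus>\<^bsub>path_algebra G\<^esub> path_term (?v, y) 1) \<otimes>\<^bsub>path_algebra G\<^esub>
        path_term (?w, b) 1 \<in> I"
      by (intro I_r_closed I_l_closed)
    also have "path_term (u, a) c \<otimes>\<^bsub>path_algebra G\<^esub>
        (path_term (?v, x) 1 \<ominus>\<^bsub>path_algebra G\<^esub> path_term (?v, y) 1) \<otimes>\<^bsub>path_algebra G\<^esub>
        path_term (?w, b) 1 =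
        path_term (u, a) c \<otimes>\<^bsub>path_algebra G\<^esub> path_term (?v, x) 1 \<otimes>\<^bsub>path_algebra G\<^esub> path_term (?w, b) 1
        \<ominus>\<^bsub>path_algebra G\<^esub>
        path_term (u, a) c \<otimes>\<^bsub>path_algebra G\<^esub> path_term (?v, y) 1 \<otimes>\<^bsub>path_algebra G\<^esub> path_term (?w, b) 1"
      using carr unfolding a_minus_def by (simp add: l_distr r_distr l_minus r_minus)
    also have "path_term (u, a) c \<otimes>\<^bsub>path_algebra G\<^esub> path_term (?v, x) 1 \<otimes>\<^bsub>path_algebra G\<^esub>
        path_term (?w, b) 1 = path_term (u, a @ x @ b) c"
      by (simp add: path_term_mult awlast_append')
    also have "path_term (u, a) c \<otimes>\<^bsub>path_algebra G\<^esub> path_term (?v, y) 1 \<otimes>\<^bsub>path_algebra G\<^esub>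
        path_term (?w, b) 1 = path_term (u, a @ y @ b) c"
    proof -
      have "awlast ?v y = ?w"
        using walks(3) by (auto elim: awalkE)
      then show ?thesis
        by (simp add: path_term_mult awlast_append')
    qed
    also have "path_term (u, a @ x @ b) c \<ominus>\<^bsub>path_algebra G\<^esub> path_term (u, a @ y @ b) c =
        (\<lambda>z. path_term (u, a @ x @ b) c z - path_term (u, a @ y @ b) c z)"
    proof (rule path_minus[OF V])
      have "awalk u (a @ x @ b) v" "awalk u (a @ y @ b) v"
        using path_cong_rel(2) path_cong_awalk_iff[OF path_cong_ctxt[OF xy]] by auto
      then show "path_term (u, a @ x @ b) c \<in> carrier (path_algebra G)"
        "path_term (u, a @ y @ b) c \<in> carrier (path_algebra G)"
        unfolding quiver_paths_def by (blast intro!: path_term_carrier[unfolded quiver_paths_def])+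
    qed
    finally show ?case .
  next
    case (path_cong_refl x)
    then show ?case
      using additive_subgroup.zero_closed[OF additive_subgroup_axioms] by (simp add: path_algebra_simps)
  next
    case (path_cong_sym x y)
    have "awalk u x v"
      using path_cong_awalk_iff[OF path_cong_sym(1)] path_cong_sym(3) by simp
    from path_cong_sym.IH[OF this, of "- c"]
    have "(\<lambda>z. path_term (u, x) (- c) z - path_term (u, y) (- c) z) \<in> I" .
    also have "(\<lambda>z. path_term (u, x) (- c) z - path_term (u, y) (- c) z) =
        (\<lambda>z. path_term (u, y) c z - path_term (u, x) c z)"
      by (auto simp: path_term_def)
    finally show ?case .
  next
    case (path_cong_trans x y z)
    have "awalk u y v"
      using path_cong_awalk_iff[OF path_cong_trans(1)] path_cong_trans(5) by simp
    from additive_subgroup.a_closed[OF additive_subgroup_axioms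
        path_cong_trans.IH(1)[OF path_cong_trans(5), of c] path_cong_trans.IH(2)[OF this, of c]]
    show ?case
      by (simp add: path_algebra_simps)
  }
qed

end

section \<open>The ideal of the relations as the kernel of the weight representation\<close>

locale separated_relations = weighted_relations +
  assumes finite_verts: "finite (verts G)" and verts_ne: "verts G \<noteq> {}"
    and connected: "u \<in> verts G \<Longrightarrow> v \<in> verts G \<Longrightarrow> \<exists>x. awalk u x v"
    and separated: "awalk u x v \<Longrightarrow> awalk u y v \<Longrightarrow> path_weight p x = path_weight p y \<Longrightarrow>
      path_weight q x = path_weight q y \<Longrightarrow> path_cong S x y"
begin

text \<open>
  An element of the kernel has, for any path in its support, another parallel path of the same
  weight in its support; subtracting a multiple of their difference shrinks the support.
\<close>

lemma weight_matrix_kernel: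
  assumes I: "ideal I (path_algebra G)"
    and S: "\<And>x y. (x, y) \<in> S \<Longrightarrow> path_elem G x \<ominus>\<^bsub>path_algebra G\<^esub> path_elem G y \<in> I"
    and f: "f \<in> carrier (path_algebra G)" "\<And>i j. entry_sum f i j = 0"
  shows "f \<in> I"
  using f
proof (induction "card (coeff_support f)" arbitrary: f rule: less_induct)
  case less
  interpret ideal I "path_algebra G"
    by (rule I)
  have fin: "finite (coeff_support f)" and sub: "coeff_support f \<subseteq> quiver_paths G"
    using less.prems(1) by (auto simp: path_algebra_simps(1))
  show ?case
  proof (cases "coeff_support f = {}")
    case True
    then have "f = \<zero>\<^bsub>path_algebra G\<^esub>"
      by (auto simp: coeff_support_def path_algebra_simps fun_eq_iff)
    then show ?thesis
      using additive_subgroup.zero_closed[OF additive_subgroup_axioms] by simp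
  next
    case False
    then obtain x where x: "x \<in> coeff_support f"
      by blast
    let ?P = "\<lambda>y. fst y = fst x \<and> path_end y = path_end x \<and>
      path_weight p (snd y) = path_weight p (snd x) \<and> path_weight q (snd y) = path_weight q (snd x)"
    \<comment> \<open>If x were the only path in the support with its ends and weights, the
      corresponding coefficient of the entry would be \<open>f x\<close>, which is nonzero.\<close>
    obtain y where y: "y \<in> coeff_support f" "y \<noteq> x" "?P y"
    proof (rule ccontr)
      assume "\<not> thesis"
      then have "?P y \<longleftrightarrow> y = x" if "y \<in> coeff_support f" for y
        using that x \<open>\<And>y. \<lbrakk>y \<in> coeff_support f; y \<noteq> x; ?P y\<rbrakk> \<Longrightarrow> thesis\<close> by blast
      then have "(\<Sum>y\<in>coeff_support f. if ?P y then f y else 0) =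
          (\<Sum>y\<in>coeff_support f. if y = x then f x else 0)"
        by (intro sum.cong) auto
      also have "\<dots> = f x"
        using fin x by (simp add: sum.delta)
      finally have "coeff (coeff (entry_sum f (fst x) (path_end x)) (path_weight q (snd x))) (path_weight p (snd x)) = f x"
        unfolding coeff_entry_sum .
      then show False
        using less.prems(2) x by (simp add: coeff_support_def)
    qed
    define g where "g = (\<lambda>z. path_term x (f x) z - path_term y (f x) z)"
    have "x \<in> quiver_paths G" "y \<in> quiver_paths G"
      using sub x y(1) by auto
    then have walks: "awalk (fst x) (snd x) (path_end x)" "awalk (fst x) (snd y) (path_end x)"
      using y(3) unfolding quiver_paths_iff by metis+
    then have cong: "path_cong S (snd x) (snd y)"
      using separated y(3) by simp
    have "(\<lambda>z. path_term (fst x, snd x) (f x) z - path_term (fst x, snd y) (f x) z) \<in> I"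
      by (rule path_cong_difference[OF finite_verts I S cong walks(1)])
    moreover have "(fst x, snd y) = y"
      using y(3) by (metis prod.collapse)
    ultimately have g: "g \<in> I"
      by (simp add: g_def)
    then have gc: "g \<in> carrier (path_algebra G)"
      by (rule Icarr)
    have g_eq: "g = (\<lambda>z. path_term x (f x) z + path_term y (- f x) z)"
      by (auto simp: g_def path_term_def)
    have entry_g: "entry_sum g i j = 0" for i j
    proof -
      have "path_monomial y (- f x) = - path_monomial x (f x)"
        using y(3) by (simp add: path_monomial_def minus_monom)
      then show ?thesis
        unfolding g_eq using y(3)
        by (subst entry_sum_add)
          (auto simp: entry_sum_path_term intro: finite_subset[OF coeff_support_path_term])
    qed
    define h where "h = f \<ominus>\<^bsub>path_algebra G\<^esub> g"
    have hc: "h \<in> carrier (path_algebra G)"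
      using less.prems(1) gc by (simp add: h_def)
    have h: "h = (\<lambda>z. f z - g z)"
      unfolding h_def by (rule path_minus[OF finite_verts less.prems(1) gc])
    have f_eq: "f = (\<lambda>z. h z + g z)"
      by (simp add: h)
    have "entry_sum h i j = 0" for i j
    proof -
      have "entry_sum f i j = entry_sum h i j + entry_sum g i j"
        using hc gc unfolding f_eq[symmetric]
        by (subst f_eq, intro entry_sum_add) (auto simp: path_algebra_simps(1))
      then show ?thesis
        using less.prems(2) entry_g by simp
    qed
    moreover have "coeff_support h \<subset> coeff_support f"
    proof -
      have "h z = 0" if "f z = 0" for z
        using that x y by (auto simp: h g_def path_term_def coeff_support_def)
      moreover have "h x = 0"
        using y(2) by (simp add: h g_def path_term_def)
      ultimately show ?thesis
        using x by (auto simp: coeff_support_def)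
    qed
    ultimately have "h \<in> I"
      using less.hyps[of h] psubset_card_mono[OF fin] hc by simp
    then have "h \<oplus>\<^bsub>path_algebra G\<^esub> g \<in> I"
      using g by (rule additive_subgroup.a_closed[OF additive_subgroup_axioms])
    then show ?thesis
      using f_eq by (simp add: path_algebra_simps)
  qed
qed

text \<open>By the first isomorphism theorem the quotient is isomorphic to the image of
  \<open>weight_matrix\<close>. In this image the trivial paths are the diagonal idempotents, and
  any path from i to j gives a nonzero entry at (i, j).\<close>

theorem path_algebra_mod_prime_PI_degree:
  shows "prime_ring (path_algebra_mod G S)" "has_PI_degree (path_algebra_mod G S) (card (verts G))"
proof -
  let ?A = "path_algebra G" and ?M = "matrix_ring (verts G) :: ('a \<Rightarrow> 'a \<Rightarrow> complex poly poly fract) ring"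
  let ?D = "{path_elem G x \<ominus>\<^bsub>?A\<^esub> path_elem G y |x y. (x, y) \<in> S}"
  interpret A: ring ?A
    by (rule ring_path_algebra[OF finite_verts])
  interpret h: ring_hom_ring ?A ?M weight_matrix
    by (rule ring_hom_ringI2[OF A.ring_axioms ring_matrix_ring[OF finite_verts] weight_matrix_hom[OF finite_verts]])
  have path_elem: "path_elem G x = path_term (u, x) 1 \<and> path_elem G x \<in> carrier ?A"
    if "awalk u x v" "x \<noteq> []" for u x v
  proof -
    have "path_elem G x = path_term (u, x) 1"
      using awalk_ne_ends(1)[OF that] by (auto simp: path_elem_def path_term_def fun_eq_iff)
    then show ?thesis
      using that(1) path_term_carrier[of "(u, x)" 1] by (auto simp: quiver_paths_def)
  qed
  have D: "?D \<subseteq> carrier ?A \<inter> a_kernel ?A ?M weight_matrix"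
  proof
    fix f assume "f \<in> ?D"
    then obtain x y where xy: "(x, y) \<in> S" "f = path_elem G x \<ominus>\<^bsub>?A\<^esub> path_elem G y"
      by blast
    obtain u v where w: "awalk u x v" "awalk u y v"
      using rel_parallel[OF xy(1)] by blast
    have px: "path_elem G x = path_term (u, x) 1" "path_elem G x \<in> carrier ?A"
      and py: "path_elem G y = path_term (u, y) 1" "path_elem G y \<in> carrier ?A"
      using path_elem[OF w(1)] path_elem[OF w(2)] rel_ne[OF xy(1)] by auto
    have "awlast u x = v" "awlast u y = v"
      using w by (auto elim: awalkE)
    moreover have "path_monomial (u, x) 1 = path_monomial (u, y) 1"
      by (simp add: path_monomial_def rel_p[OF xy(1)] rel_q[OF xy(1)])
    ultimately have "weight_matrix (path_elem G x) = weight_matrix (path_elem G y)"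
      unfolding px py weight_matrix_def by (intro ext) (auto simp: entry_sum_path_term)
    then have "weight_matrix f = \<zero>\<^bsub>?M\<^esub>"
      unfolding xy(2) a_minus_def using px(2) py(2) h.S.r_neg[of "weight_matrix (path_elem G y)"]
      by (simp del: matrix_ring_simps)
    moreover have "f \<in> carrier ?A"
      unfolding xy(2) by (rule A.minus_closed[OF px(2) py(2)])
    ultimately show "f \<in> carrier ?A \<inter> a_kernel ?A ?M weight_matrix"
      unfolding a_kernel_def' by (intro IntI CollectI conjI)
  qed
  note D_carrier = subset_trans[OF D Int_lower1] and D_kernel = subset_trans[OF D Int_lower2]
  have I: "ideal (Idl\<^bsub>?A\<^esub> ?D) ?A"
    by (rule A.genideal_ideal[OF D_carrier])
  \<comment> \<open>The relations lie in the kernel because their sides are parallel and of equal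
    weights; the converse inclusion is \<open>weight_matrix_kernel\<close>.\<close>
  have kernel: "Idl\<^bsub>?A\<^esub> ?D = a_kernel ?A ?M weight_matrix"
  proof
    show "Idl\<^bsub>?A\<^esub> ?D \<subseteq> a_kernel ?A ?M weight_matrix"
      by (rule A.genideal_minimal[OF h.kernel_is_ideal D_kernel])
    show "a_kernel ?A ?M weight_matrix \<subseteq> Idl\<^bsub>?A\<^esub> ?D"
    proof
      fix f assume "f \<in> a_kernel ?A ?M weight_matrix"
      then have f: "f \<in> carrier ?A" "weight_matrix f = \<zero>\<^bsub>?M\<^esub>"
        unfolding a_kernel_def' mem_Collect_eq by simp_all
      have "entry_sum f i j = 0" for i j
        using fun_cong[OF fun_cong[OF f(2)], of i j] by (simp add: weight_matrix_def)
      moreover have "path_elem G x \<ominus>\<^bsub>?A\<^esub> path_elem G y \<in> Idl\<^bsub>?A\<^esub> ?D" if "(x, y) \<in> S" for x y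
        by (rule subsetD[OF A.genideal_self[OF D_carrier]], rule CollectI) (use that in blast)
      ultimately show "f \<in> Idl\<^bsub>?A\<^esub> ?D"
        by (intro weight_matrix_kernel[OF I _ f(1)])
    qed
  qed
  have quotient: "path_algebra_mod G S = ?A Quot a_kernel ?A ?M weight_matrix"
    unfolding path_algebra_mod_def kernel ..
  interpret order: matrix_order "verts G" "weight_matrix ` carrier ?A"
  proof (rule matrix_order.intro)
    show "finite (verts G)" "verts G \<noteq> {}"
      by (rule finite_verts, rule verts_ne)
    show "subring (weight_matrix ` carrier ?A) ?M"
      by (rule h.img_is_subring[OF A.carrier_is_subring])
  next
    fix i assume "i \<in> verts G"
    then have "path_term (i, []) 1 \<in> carrier ?A"
      by (intro path_term_carrier) (auto simp: quiver_paths_def awalk_Nil_iff)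
    moreover have "weight_matrix (path_term (i, []) 1) = single_entry i i 1"
      by (intro ext) (auto simp: weight_matrix_def entry_sum_path_term path_monomial_def single_entry_def)
    ultimately show "single_entry i i 1 \<in> weight_matrix ` carrier ?A"
      by (metis imageI)
  next
    fix i j assume "i \<in> verts G" "j \<in> verts G"
    then obtain x where x: "awalk i x j"
      using connected by blast
    then have "path_term (i, x) 1 \<in> carrier ?A"
      by (intro path_term_carrier) (auto simp: quiver_paths_def)
    moreover have "awlast i x = j"
      using x by (auto elim: awalkE)
    then have "weight_matrix (path_term (i, x) 1) i j \<noteq> 0"
      by (simp add: weight_matrix_def entry_sum_path_term path_monomial_def)
    ultimately show "\<exists>M\<in>weight_matrix ` carrier ?A. M i j \<noteq> 0"
      by blast
  qed
  let ?h = "\<lambda>X. the_elem (weight_matrix ` X)"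
  have "ring (?A Quot a_kernel ?A ?M weight_matrix)"
    by (rule ideal.quotient_is_ring[OF h.kernel_is_ideal])
  moreover have "?h \<in> ring_hom (?A Quot a_kernel ?A ?M weight_matrix) ?M"
    by (rule h.the_elem_hom)
  moreover have "inj_on ?h (carrier (?A Quot a_kernel ?A ?M weight_matrix))"
    by (rule inj_onI) (rule h.the_elem_inj)
  moreover have "?h ` carrier (?A Quot a_kernel ?A ?M weight_matrix) = weight_matrix ` carrier ?A"
    by (rule h.the_elem_surj)
  ultimately show "prime_ring (path_algebra_mod G S)"
    "has_PI_degree (path_algebra_mod G S) (card (verts G))"
    unfolding quotient by (rule order.prime_PI_degree)+
qed

end


sublocale staircase_quiver \<subseteq> separated_relations G S p q
proof
  show "finite (verts G)" "verts G \<noteq> {}"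
    by (simp_all add: verts_eq)
qed (use strongly_connected parallel_paths_cong in blast)+

section \<open>Reconstruction algebras\<close>

lemma quiver_one_prime_PI_degree:
  assumes m: "2 \<le> m"
  shows "prime_ring (path_algebra_mod (quiver_one m) (rels_one m))"
    and "has_PI_degree (path_algebra_mod (quiver_one m) (rels_one m)) 2"
proof -
  \<comment> \<open>The arrows from 1 to 0 in the order \<open>c_1\<close>, \<open>c_2\<close>,
    \<open>k_1\<close>, \<open>k_2\<close>, ... carry x^(m-1-j) y^j for j = 0, ..., m-1, while
    \<open>a_1\<close> carries x and \<open>a_2\<close> carries y.\<close>
  define p where "p = case_arrow (\<lambda>i. m - i) (\<lambda>i. if i = 1 then 1 else 0) (\<lambda>t. m - 2 - t)"
  define q where "q = case_arrow (\<lambda>i. i - 1) (\<lambda>i. if i = 1 then 0 else 1) (\<lambda>t. t + 1)"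
  define d :: "nat \<Rightarrow> nat" where "d t = (if t = 0 then 1 else m - 1)" for t
  \<comment> \<open>Here \<open>a_1\<close> and \<open>c_1\<close> act as the clockwise arrows and
    \<open>a_2\<close> as the anticlockwise arrow at 0. At vertex 1 the top arrow is the last of the
    \<open>k_t\<close>, or \<open>c_2\<close> if m = 2, and returns to 0 as \<open>a_n0\<close> does
    in general.\<close>
  define e where "e t k = (if t = 0 then if k = 0 then Acw 1 else Acw 2
      else if k = 0 then Cw 1 else if k = 1 then Cw 2 else Ex (k - 1))" for t k :: nat
  have e_0: "e 0 0 = Acw 1" "e 0 (Suc 0) = Acw 2"
    by (simp_all add: e_def)
  interpret wf_digraph "quiver_one m"
    by standard (auto simp: quiver_one_def)
  have G: "verts (quiver_one m) = {0, 1}"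
    "\<And>i. Acw i \<in> arcs (quiver_one m) \<longleftrightarrow> i = 1 \<or> i = 2"
    "\<And>i. Cw i \<in> arcs (quiver_one m) \<longleftrightarrow> i = 1 \<or> i = 2"
    "\<And>t. Ex t \<in> arcs (quiver_one m) \<longleftrightarrow> 1 \<le> t \<and> t \<le> m - 2"
    "\<And>i. tail (quiver_one m) (Acw i) = 0" "\<And>i. head (quiver_one m) (Acw i) = 1"
    "\<And>i. tail (quiver_one m) (Cw i) = 1" "\<And>i. head (quiver_one m) (Cw i) = 0"
    "\<And>t. tail (quiver_one m) (Ex t) = 1" "\<And>t. head (quiver_one m) (Ex t) = 0"
    by (auto simp: quiver_one_def)
  have walks: "awalk 0 x 0 \<and> awalk 0 y 0 \<or> awalk 1 x 1 \<and> awalk 1 y 1" if "(x, y) \<in> rels_one m" for x y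
    using that by (auto simp: rels_one_def awalk_simps G split: if_splits)
  have weights: "x \<noteq> [] \<and> y \<noteq> [] \<and> path_weight p x = path_weight p y \<and> path_weight q x = path_weight q y"
    if "(x, y) \<in> rels_one m" for x y
    using that m by (auto simp: rels_one_def p_def q_def split: if_splits)
  have rels: "x \<noteq> [] \<and> y \<noteq> [] \<and> (\<exists>u v. awalk u x v \<and> awalk u y v) \<and>
      path_weight p x = path_weight p y \<and> path_weight q x = path_weight q y"
    if "(x, y) \<in> rels_one m" for x y
    using walks[OF that] weights[OF that] by blast
  have cong: "path_cong (rels_one m) x y" if "(x, y) \<in> rels_one m \<or> (y, x) \<in> rels_one m" for x y
    using path_cong_rel[of x y "rels_one m" "[]" "[]"] path_cong_rel[of y x "rels_one m" "[]" "[]"] that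
    by (auto intro: path_cong_sym)
  \<comment> \<open>The three families of relations become one because \<open>c_1\<close>,
    \<open>c_2\<close>, \<open>k_1\<close>, ... form a single sequence; k = 0, k = 1 and k \<ge> 2
    pick out the families.\<close>
  have step: "path_cong (rels_one m) [e 1 k, Acw 2] [e 1 (Suc k), Acw 1] \<and>
      path_cong (rels_one m) [Acw 1, e 1 (Suc k)] [Acw 2, e 1 k]" if "Suc k < m" for k
  proof -
    consider "k = 0" | "k = 1" | j where "k = Suc (Suc j)"
      by (metis One_nat_def not0_implies_Suc)
    then have "([e 1 (Suc k), Acw 1], [e 1 k, Acw 2]) \<in> rels_one m \<and>
        ([Acw 1, e 1 (Suc k)], [Acw 2, e 1 k]) \<in> rels_one m"
      using that by cases (auto simp: e_def rels_one_def)
    then show ?thesis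
      using cong by blast
  qed
  interpret staircase_quiver "quiver_one m" "rels_one m" p q 1 d e
  proof
    show "arcs (quiver_one m) = {e t k |t k. t \<le> 1 \<and> k \<le> d t}" (is "_ = ?E")
    proof
      have mem: "e t k \<in> ?E" if "t \<le> 1" "k \<le> d t" for t k
        using that by blast
      have "e 0 0 \<in> ?E" "e 0 1 \<in> ?E" "e 1 0 \<in> ?E" "e 1 1 \<in> ?E"
        using mem[of 0 0] mem[of 0 1] mem[of 1 0] mem[of 1 1] m by (simp_all add: d_def)
      then have "Acw 1 \<in> ?E" "Acw 2 \<in> ?E" "Cw 1 \<in> ?E" "Cw 2 \<in> ?E"
        by (simp_all only: e_def) simp_all
      moreover have "Ex t \<in> ?E" if "1 \<le> t" "t \<le> m - 2" for t
        using mem[of 1 "t + 1"] that by (simp add: d_def e_def)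
      ultimately show "arcs (quiver_one m) \<subseteq> ?E"
        unfolding quiver_one_def by auto
      have "e t k \<in> arcs (quiver_one m)" if "t \<le> 1" "k \<le> d t" for t k
        using that by (auto simp: e_def d_def G split: if_splits)
      then show "?E \<subseteq> arcs (quiver_one m)"
        by blast
    qed
    fix t k assume t: "1 \<le> t" "t \<le> (1::nat)"
    then have t1: "t = 1"
      by simp
    show "\<exists>x. path_cong (rels_one m) [e t 0, e (t - 1) (d (t - 1))] (e t 1 # x)"
      using step[of 0] m by (auto simp: t1 d_def e_0)
    show "\<exists>x. path_cong (rels_one m) (e t k # acw_path_from e d t) (e t (Suc k) # x)"
      if "0 < k" "k < d t" for k
    proof -
      have "Suc k < m"
        using that by (simp add: t1 d_def)
      then show ?thesis
        using step[of k] by (auto simp: t1 d_def e_0)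
    qed
    show "\<exists>x. path_cong (rels_one m) (cw_path_from e 1 t @ [e t k]) (e 0 1 # x)"
      if "0 < k" "k \<le> d t" for k
    proof -
      have "Suc (k - 1) < m"
        using that by (auto simp: t1 d_def)
      then show ?thesis
        using step[of "k - 1"] that(1) by (auto simp: t1 d_def e_0)
    qed
    show "q (e t (Suc k)) = q (e t k) + path_weight q (acw_path_from e d t)" if "0 < k" "k < d t" for k
      using that by (simp add: t1 d_def e_def q_def)
  qed (use m rels in \<open>auto simp: G e_def d_def p_def q_def le_Suc_eq split: if_splits\<close>)
  have "card (verts (quiver_one m)) = 2"
    by (simp add: quiver_one_def)
  then show "prime_ring (path_algebra_mod (quiver_one m) (rels_one m))"
    "has_PI_degree (path_algebra_mod (quiver_one m) (rels_one m)) 2"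
    using path_algebra_mod_prime_PI_degree by simp_all
qed

text \<open>The differences of the continued fraction sequence: for b k = \<alpha>_k - 2 the partial
  sums S_k of the first k terms satisfy S_0 = 0, S_1 = 1 and S_(k+1) = \<alpha>_k S_k - S_(k-1).
  Recursion on the differences avoids subtraction of natural numbers.\<close>

fun staircase_gap :: "(nat \<Rightarrow> nat) \<Rightarrow> nat \<Rightarrow> nat" where
  "staircase_gap b 0 = 1"
| "staircase_gap b (Suc k) = staircase_gap b k + b (Suc k) * (\<Sum>s\<le>k. staircase_gap b s)"

lemma staircase_gap_pos: "0 < staircase_gap b k"
  by (induction k) auto

section \<open>Several entries: numbering of the extra arrows\<close>

locale many_entries =
  fixes \<alpha> :: "nat list" and n :: nat
  assumes n: "length \<alpha> = n" "2 \<le> n"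
    and entries: "x \<in> set \<alpha> \<Longrightarrow> 2 \<le> x"
begin

definition b :: "nat \<Rightarrow> nat" where
  "b t = \<alpha> ! (t - 1) - 2"

text \<open>The number of extra arrows at vertices before t, so that those at t are
  \<open>k_s\<close> with off t < s \<le> off t + b t.\<close>

definition off :: "nat \<Rightarrow> nat" where
  "off t = sum b {1..<t}"

lemma entry_ge: "1 \<le> t \<Longrightarrow> t \<le> n \<Longrightarrow> 2 \<le> \<alpha> ! (t - 1)"
  using entries[of "\<alpha> ! (t - 1)"] n by simp

lemma entry_eq_2_iff: "1 \<le> t \<Longrightarrow> t \<le> n \<Longrightarrow> \<alpha> ! (t - 1) = 2 \<longleftrightarrow> b t = 0"
  using entry_ge[of t] by (auto simp: b_def)

lemma off_1 [simp]: "off (Suc 0) = 0"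
  by (simp add: off_def)

lemma off_Suc: "1 \<le> t \<Longrightarrow> off (Suc t) = off t + b t"
  by (simp add: off_def)

lemma off_mono: "s \<le> t \<Longrightarrow> off s \<le> off t"
  unfolding off_def by (rule sum_mono2) auto

lemma num_extra: "num_extra \<alpha> = off (Suc n)"
proof -
  have "num_extra \<alpha> = (\<Sum>i = 0..<n. \<alpha> ! i - 2)"
    using n by (simp add: num_extra_def sum_list_sum_nth)
  also have "\<dots> = (\<Sum>i = Suc 0..<Suc n. b i)"
    unfolding b_def by (subst sum.shift_bounds_Suc_ivl) simp
  finally show ?thesis
    by (simp add: off_def)
qed

lemma off_top: "off n + b n = num_extra \<alpha>"
  using off_Suc[of n] n num_extra by simp

lemma extra_tail_0: "extra_tail \<alpha> 0 = 1"
  by (simp add: extra_tail_def)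

lemma length_groups: "length (concat (map (\<lambda>i. replicate (b i) i) [1..<k])) = off k"
  by (simp add: length_concat o_def off_def interv_sum_list_conv_sum_set_nat del: One_nat_def upt_Suc)

text \<open>The list behind \<open>extra_tail\<close> begins with the tail of \<open>k_0\<close>;
  this shift by one makes off t + m, with m counted from 1, the right index.\<close>

lemma extra_tail_group:
  assumes "1 \<le> t" "t \<le> n" "0 < m" "m \<le> b t"
  shows "extra_tail \<alpha> (off t + m) = t"
proof -
  let ?L = "\<lambda>xs. concat (map (\<lambda>i. replicate (b i) i) xs)"
  have "[1..<n + 1] = [1..<t] @ [t..<n + 1]"
    using assms upt_add_eq_append[of 1 t "n + 1 - t"] by (simp del: upt_Suc)
  also have "[t..<n + 1] = t # [Suc t..<n + 1]"
    using assms by (simp add: upt_conv_Cons del: upt_Suc)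
  finally have "?L [1..<n + 1] = ?L [1..<t] @ replicate (b t) t @ ?L [Suc t..<n + 1]"
    by (simp del: upt_Suc)
  moreover have "extra_tail \<alpha> (off t + m) = ([1] @ ?L [1..<n + 1] @ [n]) ! (off t + m)"
    using n by (simp add: extra_tail_def b_def del: upt_Suc)
  ultimately show ?thesis
    using assms length_groups[of t] by (cases m) (simp_all add: nth_append del: upt_Suc)
qed

lemma extra_tail_top: "extra_tail \<alpha> (num_extra \<alpha> + 1) = n"
proof -
  let ?L = "concat (map (\<lambda>i. replicate (b i) i) [1..<n + 1])"
  have "length ?L = num_extra \<alpha>"
    using length_groups[of "n + 1"] num_extra by (simp del: upt_Suc)
  moreover have "extra_tail \<alpha> (num_extra \<alpha> + 1) = ([1] @ ?L @ [n]) ! (num_extra \<alpha> + 1)"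
    using n by (simp add: extra_tail_def b_def del: upt_Suc)
  ultimately show ?thesis
    by (simp add: nth_append del: upt_Suc)
qed

lemma extra_group:
  assumes "0 < s" "s \<le> num_extra \<alpha>"
  obtains t m where "1 \<le> t" "t \<le> n" "0 < m" "m \<le> b t" "s = off t + m"
proof -
  have "\<exists>t. 1 \<le> t \<and> t \<le> k \<and> off t < s \<and> s \<le> off (Suc t)" if "s \<le> off (Suc k)" for k
    using that
  proof (induction k)
    case 0
    then show ?case
      using assms by simp
  next
    case (Suc k)
    show ?case
    proof (cases "s \<le> off (Suc k)")
      case True
      then show ?thesis
        using Suc.IH by (meson le_SucI)
    qed (use Suc.prems in auto)
  qed
  from this[of n] obtain t where t: "1 \<le> t" "t \<le> n" "off t < s" "s \<le> off (Suc t)"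
    using assms num_extra by auto
  then show thesis
    using that[of t "s - off t"] off_Suc[of t] by simp
qed

lemma extra_cases:
  assumes "s \<le> num_extra \<alpha> + 1"
  obtains "s = 0" "extra_tail \<alpha> s = 1"
  | t m where "1 \<le> t" "t \<le> n" "0 < m" "m \<le> b t" "s = off t + m" "extra_tail \<alpha> s = t"
  | "s = num_extra \<alpha> + 1" "extra_tail \<alpha> s = n"
proof -
  consider "s = 0" | "0 < s" "s \<le> num_extra \<alpha>" | "s = num_extra \<alpha> + 1"
    using assms by linarith
  then show thesis
  proof cases
    case 2
    then obtain t m where "1 \<le> t" "t \<le> n" "0 < m" "m \<le> b t" "s = off t + m"
      by (rule extra_group)
    then show ?thesis
      using that(2) extra_tail_group by blast
  qed (use that extra_tail_0 extra_tail_top in auto)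
qed

lemma extra_tail_range: "s \<le> num_extra \<alpha> + 1 \<Longrightarrow> 1 \<le> extra_tail \<alpha> s \<and> extra_tail \<alpha> s \<le> n"
  using n by (rule_tac extra_cases[of s]) auto

text \<open>Tails increase weakly, so a bound on the tail is a bound on the index. Since t < n, the
  final arrow \<open>a_n0\<close> with tail n stays above the bound.\<close>

lemma extra_tail_le_iff:
  assumes "s \<le> num_extra \<alpha> + 1" "1 \<le> t" "t < n"
  shows "extra_tail \<alpha> s \<le> t \<longleftrightarrow> s \<le> off (Suc t)"
  using assms(1)
proof (cases rule: extra_cases)
  case (2 t' m)
  show ?thesis
  proof (cases "t' \<le> t")
    case True
    then have "off t' + b t' \<le> off (Suc t)"
      using off_mono[of "Suc t'" "Suc t"] off_Suc[of t'] 2 by simp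
    then show ?thesis
      using 2 True by simp
  next
    case False
    then have "off (Suc t) \<le> off t'"
      using off_mono[of "Suc t" t'] by simp
    then show ?thesis
      using 2 False by simp
  qed
next
  case 3
  then show ?thesis
    using off_mono[of "Suc t" "Suc n"] num_extra assms by auto
qed (use assms in auto)

text \<open>The groups at 1 and at n are enlarged by \<open>k_0\<close>, which is
  \<open>c_10\<close>, and by the last arrow \<open>a_n0\<close>; all boundary cases of the index
  conventions stem from these two.\<close>

lemma group_eq:
  assumes "1 \<le> t" "t \<le> n"
  shows "{j. j \<le> num_extra \<alpha> + 1 \<and> extra_tail \<alpha> j = t} =
    {if t = 1 then 0 else off t + 1..if t = n then num_extra \<alpha> + 1 else off t + b t}"
proof (intro Set.set_eqI)
  fix j
  show "j \<in> {j. j \<le> num_extra \<alpha> + 1 \<and> extra_tail \<alpha> j = t} \<longleftrightarrow>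
    j \<in> {if t = 1 then 0 else off t + 1..if t = n then num_extra \<alpha> + 1 else off t + b t}"
  proof (cases "j \<le> num_extra \<alpha> + 1")
    case True
    note range = extra_tail_range[OF True]
    have upper: "extra_tail \<alpha> j \<le> t \<longleftrightarrow> (t < n \<longrightarrow> j \<le> off t + b t)"
      using extra_tail_le_iff[OF True, of t] off_Suc[of t] assms range by (cases "t < n") auto
    have lower: "t \<le> extra_tail \<alpha> j \<longleftrightarrow> t = 1 \<or> off t < j"
    proof (cases "t = 1")
      case False
      then have "extra_tail \<alpha> j \<le> t - 1 \<longleftrightarrow> j \<le> off t"
        using extra_tail_le_iff[OF True, of "t - 1"] assms by simp
      then show ?thesis
        using False assms by linarith
    qed (use range in simp)
    have "extra_tail \<alpha> j = t \<longleftrightarrow> (t < n \<longrightarrow> j \<le> off t + b t) \<and> (t = 1 \<or> off t < j)"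
      using upper lower by auto
    then show ?thesis
      using True assms by (auto split: if_splits)
  next
    case False
    have "off t + b t \<le> num_extra \<alpha>"
      using off_mono[of "Suc t" "Suc n"] off_Suc[of t] num_extra assms by simp
    then show ?thesis
      using False by auto
  qed
qed

text \<open>For 1 < t < n without extra arrows the group is empty and its minimum has no meaning; at
  n it always contains \<open>a_n0\<close>.\<close>

lemma v_idx: "1 < t \<Longrightarrow> t \<le> n \<Longrightarrow> 0 < b t \<or> t = n \<Longrightarrow> v_idx \<alpha> t = off t + 1"
  unfolding v_idx_def
  by (subst group_eq) (use off_top in \<open>auto intro!: Min_eqI\<close>)

lemma u_idx: "1 \<le> t \<Longrightarrow> t < n \<Longrightarrow> 0 < b t \<Longrightarrow> u_idx \<alpha> t = off t + b t"
  unfolding u_idx_def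
  by (subst group_eq) (auto intro!: Max_eqI)

lemma u_idx_n: "u_idx \<alpha> n = num_extra \<alpha> + 1"
  unfolding u_idx_def
  by (subst group_eq) (use n off_top in \<open>auto intro!: Max_eqI\<close>)

text \<open>No case distinction on extra arrows is needed: \<open>k_0\<close> always lies before t,
  so the maximum is taken over a nonempty initial segment.\<close>

lemma V_idx: "1 < t \<Longrightarrow> t \<le> n \<Longrightarrow> V_idx \<alpha> t = off t"
proof -
  assume t: "1 < t" "t \<le> n"
  have "off t \<le> num_extra \<alpha>"
    using off_mono[of t "Suc n"] num_extra t by simp
  moreover have "extra_tail \<alpha> j < t \<longleftrightarrow> j \<le> off t" if "j \<le> num_extra \<alpha> + 1" for j
  proof -
    have "extra_tail \<alpha> j < t \<longleftrightarrow> extra_tail \<alpha> j \<le> t - 1"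
      using t by linarith
    also have "\<dots> \<longleftrightarrow> j \<le> off t"
      using extra_tail_le_iff[OF that, of "t - 1"] t by simp
    finally show ?thesis .
  qed
  ultimately have "{j. j \<le> num_extra \<alpha> + 1 \<and> extra_tail \<alpha> j < t} = {..off t}"
    by auto
  then show ?thesis
    using t by (simp add: V_idx_def) (auto intro!: Max_eqI)
qed


section \<open>The arrows in staircase order\<close>

definition d :: "nat \<Rightarrow> nat" where
  "d t = (if t = 0 then 1 else b t + 1)"

definition e :: "nat \<Rightarrow> nat \<Rightarrow> arrow" where
  "e t m = (if m = 0 then Cw t else if m = d t then Acw t else Ex (off t + m))"

lemma e_0 [simp]: "e t 0 = Cw t"
  by (simp add: e_def)

lemma d_pos': "1 \<le> d t"
  by (simp add: d_def)

lemma e_d [simp]: "e t (d t) = Acw t"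
  using d_pos'[of t] by (simp add: e_def)

lemma d_Suc: "1 \<le> t \<Longrightarrow> d t = b t + 1"
  by (simp add: d_def)

lemma e_Ex: "1 \<le> t \<Longrightarrow> 0 < m \<Longrightarrow> m \<le> b t \<Longrightarrow> e t m = Ex (off t + m)"
  by (simp add: e_def d_def)

lemma off_le: "1 \<le> t \<Longrightarrow> t \<le> n \<Longrightarrow> off t + b t \<le> num_extra \<alpha>"
  using off_mono[of "Suc t" "Suc n"] off_Suc[of t] num_extra by simp

text \<open>The range of m includes the top arrow at n, since \<open>a_n0\<close> counts as the last
  \<open>k_s\<close>, but not the top arrow \<open>a_(t,t+1)\<close> at t < n, which is none of the
  \<open>k_s\<close>.\<close>

lemma extra_eq:
  assumes "1 \<le> t" "t \<le> n" "0 < m" "m \<le> d t" "t < n \<Longrightarrow> m < d t"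
  shows "extra \<alpha> (off t + m) = e t m"
proof (cases "m = d t")
  case True
  then have "t = n"
    using assms by (cases "t < n") auto
  then have "off t + m = num_extra \<alpha> + 1"
    using True off_top d_Suc[of n] n by simp
  then show ?thesis
    using True \<open>t = n\<close> n by (simp add: extra_def)
next
  case False
  then have "m \<le> b t"
    using assms d_Suc[of t] by simp
  then show ?thesis
    using False off_le[of t] assms by (simp add: extra_def e_Ex)
qed

lemma extra_0: "extra \<alpha> 0 = Cw 1"
  by (simp add: extra_def)

lemma extra_tail_e:
  assumes "1 \<le> t" "t \<le> n" "0 < m" "m \<le> d t" "t < n \<Longrightarrow> m < d t"
  shows "extra_tail \<alpha> (off t + m) = t"
proof (cases "m = d t")
  case True
  then have "t = n"
    using assms by (cases "t < n") auto
  then show ?thesis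
    using True off_top d_Suc[of n] n extra_tail_top by simp
qed (use assms d_Suc[of t] in \<open>auto intro!: extra_tail_group\<close>)

lemma acw_path_eq: "acw_path t = acw_path_from e d t"
  by (simp add: acw_path_def acw_path_from_def)

lemma cw_path_eq: "cw_path \<alpha> t = cw_path_from e n t"
  using n by (simp add: cw_path_def cw_path_from_def)

abbreviation acw :: "nat \<Rightarrow> arrow list" where
  "acw \<equiv> acw_path_from e d"

abbreviation cw :: "nat \<Rightarrow> arrow list" where
  "cw \<equiv> cw_path_from e n"

abbreviation Q :: "(nat, arrow) pre_digraph" where
  "Q \<equiv> quiver_many \<alpha>"

lemma quiver_simps:
  "verts Q = {0..n}"
  "Cw i \<in> arcs Q \<longleftrightarrow> i \<le> n" "Acw i \<in> arcs Q \<longleftrightarrow> i \<le> n"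
  "Ex s \<in> arcs Q \<longleftrightarrow> 1 \<le> s \<and> s \<le> num_extra \<alpha>"
  "tail Q (Cw i) = i" "tail Q (Acw i) = i" "tail Q (Ex s) = extra_tail \<alpha> s"
  "head Q (Cw i) = (if i = 0 then n else i - 1)" "head Q (Acw i) = (if i = n then 0 else i + 1)"
  "head Q (Ex s) = 0"
  using n by (auto simp: quiver_many_def Let_def)

lemma wf_quiver: "wf_digraph Q"
proof
  fix x assume x: "x \<in> arcs Q"
  show "tail Q x \<in> verts Q" "head Q x \<in> verts Q"
    using x extra_tail_range by (cases x; auto simp: quiver_simps)+
qed

lemma Acw_0: "e 0 (Suc 0) = Acw 0"
  using e_d[of 0] by (simp add: d_def)

lemma staircase_arrows_quiver: "staircase_arrows Q n d e"
proof (intro staircase_arrows.intro wf_quiver staircase_arrows_axioms.intro)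
  show "arcs Q = {e t m |t m. t \<le> n \<and> m \<le> d t}" (is "_ = ?E")
  proof
    have mem: "e t m \<in> ?E" if "t \<le> n" "m \<le> d t" for t m
      using that by blast
    show "arcs Q \<subseteq> ?E"
    proof
      fix x assume x: "x \<in> arcs Q"
      show "x \<in> ?E"
      proof (cases x)
        case (Cw t)
        then show ?thesis
          using mem[of t 0] x by (simp add: quiver_simps)
      next
        case (Acw t)
        then show ?thesis
          using mem[of t "d t"] x by (simp add: quiver_simps)
      next
        case (Ex s)
        then have "0 < s" "s \<le> num_extra \<alpha>"
          using x by (auto simp: quiver_simps)
        then obtain t m where tm: "1 \<le> t" "t \<le> n" "0 < m" "m \<le> b t" "s = off t + m"
          by (rule extra_group)
        then show ?thesis
          using mem[of t m] Ex by (simp add: d_Suc e_Ex)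
      qed
    qed
    have "e t m \<in> arcs Q" if "t \<le> n" "m \<le> d t" for t m
    proof (cases "m = 0 \<or> m = d t")
      case True
      then show ?thesis
        using that by (auto simp: quiver_simps)
    next
      case False
      then have "1 \<le> t" "m \<le> b t" "0 < m"
        using that by (auto simp: d_def split: if_splits)
      then show ?thesis
        using off_le[of t] that by (simp add: e_Ex quiver_simps)
    qed
    then show "?E \<subseteq> arcs Q"
      by blast
  qed
  show "tail Q (e t m) = t" if "t \<le> n" "m \<le> d t" for t m
  proof (cases "m = 0 \<or> m = d t")
    case False
    then have "1 \<le> t" "m \<le> b t" "0 < m"
      using that by (auto simp: d_def split: if_splits)
    then show ?thesis
      using that by (simp add: e_Ex quiver_simps extra_tail_group)
  qed (auto simp: quiver_simps)
  show "head Q (e t m) = 0" if "1 \<le> t" "t \<le> n" "0 < m" "m \<le> d t" "t < n \<Longrightarrow> m < d t" for t m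
  proof (cases "m = d t")
    case True
    then show ?thesis
      using that by (cases "t < n") (auto simp: quiver_simps)
  next
    case False
    then show ?thesis
      using that by (simp add: d_Suc e_Ex quiver_simps)
  qed
  show "head Q (e t (d t)) = t + 1" if "t < n" for t
    using that by (simp add: quiver_simps)
qed (use n in \<open>auto simp: quiver_simps d_def\<close>)

sublocale staircase_arrows Q n d e
  by (rule staircase_arrows_quiver)

text \<open>
  The relations have two shapes: those between cycles at a vertex \<open>t \<ge> 1\<close> that start with
  neighbouring arrows, and those between neighbouring cycles at 0.
\<close>

definition vertex_rel :: "nat \<Rightarrow> nat \<Rightarrow> arrow list \<times> arrow list" where
  "vertex_rel t m =
    (e t m # (if m = 0 then [Acw (t - 1)] else acw t),
     e t (Suc m) # (if Suc m = d t then [Cw (if t = n then 0 else t + 1)] else cw t))"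

definition origin_rel :: "nat \<Rightarrow> arrow list \<times> arrow list" where
  "origin_rel s =
    (acw (extra_tail \<alpha> s) @ [extra \<alpha> s], cw (extra_tail \<alpha> (Suc s)) @ [extra \<alpha> (Suc s)])"

section \<open>The relations of each step in the two uniform shapes\<close>

definition step_rels :: "nat \<Rightarrow> (arrow list \<times> arrow list) set" where
  "step_rels t = (if t = 1 then step_first \<alpha> else if t = n then step_last \<alpha> else step_mid \<alpha> t)"

lemma rels_many_eq: "rels_many \<alpha> = (\<Union>t\<in>{1..n}. step_rels t)"
proof -
  have "{1..n} = {1} \<union> {1<..<n} \<union> {n}"
    using n by auto
  moreover have "(\<Union>t\<in>{1<..<n}. step_rels t) = (\<Union>t\<in>{1<..<n}. step_mid \<alpha> t)"
    by (simp add: step_rels_def)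
  moreover have "step_rels 1 = step_first \<alpha>" "step_rels n = step_last \<alpha>"
    using n by (simp_all add: step_rels_def)
  ultimately show ?thesis
    using n by (simp add: rels_many_def Un_ac)
qed

lemma UN_pair: "(\<Union>x\<in>X. {f x, g x}) = f ` X \<union> g ` X"
  by auto

text \<open>At vertex 1 the clockwise arrow is \<open>k_0\<close>, so the \<open>k_s\<close> run
  uniformly from s = 0 and no relation refers to an earlier vertex.\<close>

lemma step_rels_1: "step_rels 1 = vertex_rel 1 ` {..<d 1} \<union> origin_rel ` {0..<b 1}"
proof (cases "b 1 = 0")
  case True
  then have "{..<d 1} = {0}"
    by (auto simp: d_def)
  moreover have "e 1 1 = Acw 1"
    using True by (simp add: e_def d_def)
  ultimately show ?thesis
    using True n entry_eq_2_iff[of 1] d_Suc[of 1]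
    by (simp add: vertex_rel_def step_rels_def step_first_def)
next
  case False
  have ex: "extra \<alpha> k = e 1 k" if "k \<le> b 1" for k
    using extra_eq[of 1 k] extra_0 that n by (cases "k = 0") (simp_all add: d_Suc)
  have tail: "extra_tail \<alpha> k = 1" if "k \<le> b 1" for k
    using extra_tail_group[of 1 k] extra_tail_0 that n by (cases "k = 0") simp_all
  have d: "{..<d 1} = insert (b 1) {0..<b 1}"
    by (auto simp: d_Suc)
  have acw: "acw 1 = [Acw 0]"
    using e_d[of 0] by simp
  have "vertex_rel 1 m = ([extra \<alpha> m, Acw 0], [extra \<alpha> (m + 1)] @ cw_path \<alpha> 1)"
    and "origin_rel m = ([Acw 0, extra \<alpha> m], cw_path \<alpha> 1 @ [extra \<alpha> (m + 1)])" if "m < b 1" for m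
    using that ex[of m] ex[of "Suc m"] tail[of m] tail[of "Suc m"] acw
    by (simp_all add: vertex_rel_def origin_rel_def cw_path_eq d_Suc)
  moreover have "vertex_rel 1 (b 1) = ([extra \<alpha> (b 1), Acw 0], [Acw 1, Cw 2])"
    using ex[of "b 1"] False n acw e_d[of 1] by (simp add: vertex_rel_def d_Suc numeral_2_eq_2)
  moreover have "u_idx \<alpha> 1 = b 1"
    using u_idx[of 1] False n by simp
  moreover have "\<alpha> ! 0 \<noteq> 2"
    using entry_eq_2_iff[of 1] False n by simp
  ultimately show ?thesis
    unfolding step_rels_def step_first_def d UN_pair by simp
qed

text \<open>The relation between \<open>C_0t\<close> followed by the first extra arrow at t and the
  cycle through the preceding \<open>k_s\<close> is the origin relation with index off t, stated
  with its sides exchanged; hence \<open>prod.swap\<close>. Without extra arrows at t there is no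
  origin relation in this step.\<close>

lemma step_rels_mid:
  assumes t: "1 < t" "t < n"
  shows "step_rels t = vertex_rel t ` {..<d t} \<union>
    (if b t = 0 then {} else (\<lambda>m. origin_rel (off t + m)) ` {1..<b t} \<union> {prod.swap (origin_rel (off t))})"
proof (cases "b t = 0")
  case True
  then have "{..<d t} = {0}"
    using t by (auto simp: d_def)
  then show ?thesis
    using True t entry_eq_2_iff[of t] e_d[of t] d_Suc[of t]
    by (simp add: vertex_rel_def step_rels_def step_mid_def)
next
  case False
  have ex: "extra \<alpha> (off t + k) = e t k" if "0 < k" "k \<le> b t" for k
    using extra_eq[of t k] that t by (simp add: d_Suc)
  have tail: "extra_tail \<alpha> (off t + k) = t" if "0 < k" "k \<le> b t" for k
    using extra_tail_group[of t k] that t by simp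
  have d: "{..<d t} = insert 0 (insert (b t) {1..<b t})"
    using t False by (auto simp: d_Suc)
  have vr: "vertex_rel t m = ([extra \<alpha> (off t + m)] @ acw_path t, [extra \<alpha> (off t + m + 1)] @ cw_path \<alpha> t)"
    and orr: "origin_rel (off t + m) =
      (acw_path t @ [extra \<alpha> (off t + m)], cw_path \<alpha> t @ [extra \<alpha> (off t + m + 1)])" if "m \<in> {1..<b t}" for m
    using that ex[of m] ex[of "Suc m"] tail[of m] tail[of "Suc m"] t
    by (simp_all add: vertex_rel_def origin_rel_def cw_path_eq acw_path_eq d_Suc)
  have rels: "vertex_rel t ` {1..<b t} = (\<lambda>m. ([extra \<alpha> (off t + m)] @ acw_path t, [extra \<alpha> (off t + m + 1)] @ cw_path \<alpha> t)) ` {1..<b t}"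
    "(\<lambda>m. origin_rel (off t + m)) ` {1..<b t} =
      (\<lambda>m. (acw_path t @ [extra \<alpha> (off t + m)], cw_path \<alpha> t @ [extra \<alpha> (off t + m + 1)])) ` {1..<b t}"
    by (rule image_cong[OF refl], erule vr) (rule image_cong[OF refl], erule orr)
  have zero: "vertex_rel t 0 = ([Cw t, Acw (t - 1)], [extra \<alpha> (off t + 1)] @ cw_path \<alpha> t)"
    using ex[of 1] False t by (simp add: vertex_rel_def cw_path_eq d_Suc)
  have top: "vertex_rel t (b t) = ([extra \<alpha> (off t + b t)] @ acw_path t, [Acw t, Cw (t + 1)])"
    using ex[of "b t"] False t e_d[of t] by (simp add: vertex_rel_def acw_path_eq d_Suc)
  have origin: "prod.swap (origin_rel (off t)) = (cw_path \<alpha> t @ [extra \<alpha> (off t + 1)],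
      acw_path (extra_tail \<alpha> (off t)) @ [extra \<alpha> (off t)])"
    using tail[of 1] False by (simp add: origin_rel_def cw_path_eq acw_path_eq)
  have idx: "v_idx \<alpha> t = off t + 1" "u_idx \<alpha> t = off t + b t" "V_idx \<alpha> t = off t"
    using v_idx[of t] u_idx[of t] V_idx[of t] False t by auto
  have range: "{off t + 1..<off t + b t} = (+) (off t) ` {1..<b t}"
    by (simp add: image_add_atLeastLessThan add.commute)
  have "\<alpha> ! (t - 1) \<noteq> 2"
    using entry_eq_2_iff[of t] False t by simp
  then have "step_rels t = {vertex_rel t 0, prod.swap (origin_rel (off t))} \<union>
      (vertex_rel t ` {1..<b t} \<union> (\<lambda>m. origin_rel (off t + m)) ` {1..<b t}) \<union> {vertex_rel t (b t)}"
    unfolding step_rels_def step_mid_def idx range UN_pair image_image rels zero top origin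
    using t by simp
  then show ?thesis
    using False unfolding d by auto
qed

text \<open>The group at n ends with \<open>a_n0\<close>, so the origin relations run up to m = b n
  instead of stopping one earlier. The path \<open>cw n\<close> is the single arrow
  \<open>c_0n\<close>, which brings both kinds of right side in \<open>vertex_rel\<close> into one
  form.\<close>

lemma step_rels_n:
  "step_rels n = vertex_rel n ` {..<d n} \<union> (\<lambda>m. origin_rel (off n + m)) ` {1..<d n} \<union>
    {prod.swap (origin_rel (off n))}"
proof -
  have n1: "1 < n"
    using n by simp
  have ex: "extra \<alpha> (off n + k) = e n k" if "0 < k" "k \<le> d n" for k
    using extra_eq[of n k] that n1 by simp
  have tail: "extra_tail \<alpha> (off n + k) = n" if "0 < k" "k \<le> d n" for k
    using extra_tail_e[of n k] that n1 by simp
  have d: "{..<d n} = insert 0 {1..<d n}"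
    using d_Suc[of n] n1 by auto
  have vr: "vertex_rel n m = ([extra \<alpha> (off n + m)] @ acw_path n, [extra \<alpha> (off n + m + 1), Cw 0])"
    and orr: "origin_rel (off n + m) =
      (acw_path n @ [extra \<alpha> (off n + m)], [Cw 0, extra \<alpha> (off n + m + 1)])" if "m \<in> {1..<d n}" for m
    using that ex[of m] ex[of "Suc m"] tail[of m] tail[of "Suc m"]
    by (simp_all add: vertex_rel_def origin_rel_def acw_path_eq)
  have rels: "vertex_rel n ` {1..<d n} = (\<lambda>m. ([extra \<alpha> (off n + m)] @ acw_path n, [extra \<alpha> (off n + m + 1), Cw 0])) ` {1..<d n}"
    "(\<lambda>m. origin_rel (off n + m)) ` {1..<d n} =
      (\<lambda>m. (acw_path n @ [extra \<alpha> (off n + m)], [Cw 0, extra \<alpha> (off n + m + 1)])) ` {1..<d n}"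
    by (rule image_cong[OF refl], erule vr) (rule image_cong[OF refl], erule orr)
  have zero: "vertex_rel n 0 = ([Cw n, Acw (n - 1)], [extra \<alpha> (off n + 1), Cw 0])"
    using ex[of 1] n1 d_pos'[of n] by (simp add: vertex_rel_def)
  have origin: "prod.swap (origin_rel (off n)) = ([Cw 0, extra \<alpha> (off n + 1)],
      acw_path (extra_tail \<alpha> (off n)) @ [extra \<alpha> (off n)])"
    using tail[of 1] d_pos'[of n] by (simp add: origin_rel_def acw_path_eq)
  have V: "V_idx \<alpha> n = off n"
    using V_idx[of n] n1 by simp
  show ?thesis
  proof (cases "b n = 0")
    case True
    then have d1: "d n = 1"
      using d_Suc[of n] n1 by simp
    then have "extra \<alpha> (off n + 1) = Acw n"
      using ex[of 1] e_d[of n] by simp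
    moreover have "\<alpha> ! (n - 1) = 2"
      using entry_eq_2_iff[of n] True n1 by simp
    ultimately show ?thesis
      using n n1 unfolding step_rels_def step_last_def Let_def V d image_insert zero origin
      by (simp add: d1 V insert_commute)
  next
    case False
    have idx: "v_idx \<alpha> n = off n + 1" "u_idx \<alpha> n = off n + d n"
      using v_idx[of n] u_idx_n off_top d_Suc[of n] n1 by auto
    have range: "{off n + 1..<off n + d n} = (+) (off n) ` {1..<d n}"
      by (simp add: image_add_atLeastLessThan add.commute)
    have "\<alpha> ! (n - 1) \<noteq> 2"
      using entry_eq_2_iff[of n] False n1 by simp
    then have "step_rels n = {vertex_rel n 0, prod.swap (origin_rel (off n))} \<union>
        (vertex_rel n ` {1..<d n} \<union> (\<lambda>m. origin_rel (off n + m)) ` {1..<d n})"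
      unfolding step_rels_def step_last_def Let_def n(1) V idx range UN_pair image_image rels zero origin
      using n1 by simp
    then show ?thesis
      unfolding d by auto
  qed
qed

lemma vertex_rel_in_rels: "1 \<le> t \<Longrightarrow> t \<le> n \<Longrightarrow> m < d t \<Longrightarrow> vertex_rel t m \<in> rels_many \<alpha>"
proof -
  assume t: "1 \<le> t" "t \<le> n" and m: "m < d t"
  consider "t = 1" | "1 < t" "t < n" | "t = n"
    using t by linarith
  then have "vertex_rel t ` {..<d t} \<subseteq> step_rels t"
    by cases (use step_rels_1 step_rels_mid step_rels_n in auto)
  then have "vertex_rel t m \<in> step_rels t"
    using m by auto
  then show ?thesis
    using t unfolding rels_many_eq by auto
qed

lemma origin_rel_in_rels:
  assumes t: "1 \<le> t" "t \<le> n" and m: "m < d t" "t < n \<Longrightarrow> m < b t"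
  shows "origin_rel (off t + m) \<in> rels_many \<alpha> \<or> prod.swap (origin_rel (off t + m)) \<in> rels_many \<alpha>"
proof -
  consider "t = 1" | "1 < t" "t < n" | "1 < t" "t = n"
    using t by linarith
  then have "origin_rel (off t + m) \<in> step_rels t \<or> prod.swap (origin_rel (off t + m)) \<in> step_rels t"
  proof cases
    case 1
    then show ?thesis
      using m n step_rels_1 by auto
  next
    case 2
    then show ?thesis
      using m step_rels_mid[of t] by (cases "m = 0") auto
  next
    case 3
    then show ?thesis
      using m step_rels_n by (cases "m = 0") auto
  qed
  then show ?thesis
    using t rels_many_eq by auto
qed

lemma rels_many_cases:
  assumes "z \<in> rels_many \<alpha>"
  obtains t m where "1 \<le> t" "t \<le> n" "m < d t" "z = vertex_rel t m"
  | t m where "1 \<le> t" "t \<le> n" "m < d t" "t < n \<Longrightarrow> m < b t"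
      "z = origin_rel (off t + m) \<or> z = prod.swap (origin_rel (off t + m))"
proof -
  obtain t where t: "1 \<le> t" "t \<le> n" "z \<in> step_rels t"
    using assms rels_many_eq by auto
  have "(\<exists>m<d t. z = vertex_rel t m) \<or> (\<exists>m<d t. (t < n \<longrightarrow> m < b t) \<and>
      (z = origin_rel (off t + m) \<or> z = prod.swap (origin_rel (off t + m))))"
  proof -
    consider "t = 1" | "1 < t" "t < n" | "1 < t" "t = n"
      using t by linarith
    then show ?thesis
    proof cases
      case 1
      then have "(\<exists>m<d 1. z = vertex_rel 1 m) \<or> (\<exists>m<b 1. z = origin_rel m)"
        using t(3) step_rels_1 by auto
      then show ?thesis
        using 1 d_Suc[of 1] by (metis One_nat_def add_0 less_add_one less_trans off_1 order_refl)
    next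
      case 2
      then have "(\<exists>m<d t. z = vertex_rel t m) \<or> (\<exists>m<b t. z = origin_rel (off t + m)) \<or>
          0 < b t \<and> z = prod.swap (origin_rel (off t + 0))"
        using t(3) step_rels_mid[of t] by (auto split: if_splits)
      moreover have "m < d t" if "m < b t" for m
        using that d_Suc[of t] t(1) by simp
      ultimately show ?thesis
        by blast
    next
      case 3
      then have "(\<exists>m<d t. z = vertex_rel t m) \<or> (\<exists>m<d t. z = origin_rel (off t + m)) \<or>
          z = prod.swap (origin_rel (off t + 0))"
        using t(3) step_rels_n by auto
      then show ?thesis
        using 3(2) d_pos'[of t] by (metis less_irrefl less_le_trans zero_less_one)
    qed
  qed
  then show thesis
    using that t(1,2) by blast
qed


section \<open>The sides of each relation as parallel walks\<close>

lemma awalk_extra: "s \<le> num_extra \<alpha> + 1 \<Longrightarrow> awalk (extra_tail \<alpha> s) [extra \<alpha> s] 0"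
  using n extra_tail_range[of s] extra_tail_top extra_tail_0
  by (auto simp: extra_def awalk_simps quiver_simps)

lemma origin_rel_walks:
  assumes "s \<le> num_extra \<alpha>"
  shows "awalk 0 (fst (origin_rel s)) 0" "awalk 0 (snd (origin_rel s)) 0"
proof -
  have walk: "awalk 0 (x @ [extra \<alpha> s']) 0" if "awalk 0 x (extra_tail \<alpha> s')" "s' \<le> num_extra \<alpha> + 1" for x s'
  proof -
    have "awlast 0 x = extra_tail \<alpha> s'"
      using that(1) by (auto elim: awalkE)
    then show ?thesis
      using that(1) awalk_extra[OF that(2)] by simp
  qed
  show "awalk 0 (fst (origin_rel s)) 0" "awalk 0 (snd (origin_rel s)) 0"
    using walk[OF awalk_acw, of s] walk[OF awalk_cw, of "Suc s"]
      extra_tail_range[of s] extra_tail_range[of "Suc s"] assms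
    by (simp_all add: origin_rel_def)
qed

lemma vertex_rel_walks:
  assumes t: "1 \<le> t" "t \<le> n" and m: "m < d t"
  shows "awalk t (fst (vertex_rel t m)) t" "awalk t (snd (vertex_rel t m)) t"
proof -
  show "awalk t (fst (vertex_rel t m)) t"
  proof (cases "m = 0")
    case True
    then show ?thesis
      using t by (auto simp: vertex_rel_def awalk_simps quiver_simps)
  next
    case False
    then show ?thesis
      using t m awalk_arrow[of t m] head_extra[of t m] awalk_acw[of t] by (simp add: vertex_rel_def)
  qed
  show "awalk t (snd (vertex_rel t m)) t"
  proof (cases "Suc m = d t")
    case True
    then show ?thesis
      using t by (auto simp: vertex_rel_def awalk_simps quiver_simps)
  next
    case False
    then show ?thesis
      using t m awalk_arrow[of t "Suc m"] head_extra[of t "Suc m"] awalk_cw[of t]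
      by (simp add: vertex_rel_def)
  qed
qed

section \<open>Exponents of the arrows\<close>

definition x_gap :: "nat \<Rightarrow> nat" where
  "x_gap = staircase_gap (\<lambda>k. b (n + 1 - k))"

definition y_gap :: "nat \<Rightarrow> nat" where
  "y_gap = staircase_gap b"

text \<open>The exponent of x carried by \<open>C_0t\<close>; it satisfies the continued fraction
  recursion read downwards from vertex n.\<close>

definition x_sum :: "nat \<Rightarrow> nat" where
  "x_sum t = (\<Sum>s<n + 1 - t. x_gap s)"

definition y_sum :: "nat \<Rightarrow> nat" where
  "y_sum t = (\<Sum>s<t. y_gap s)"

text \<open>The relation \<open>k_s A_0t = k_(s+1) C_0t\<close> forces the exponents of x along the
  extra arrows at t to fall by \<open>x_sum t\<close>, and those of y to rise by
  \<open>y_sum t\<close>. The arrow \<open>c_0n\<close> is the path \<open>C_0n\<close> itself and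
  therefore gets the exponent \<open>x_sum n\<close>, which is 1.\<close>

definition x_weight :: "arrow \<Rightarrow> nat" where
  "x_weight = case_arrow (\<lambda>t. if t = 0 then 1 else x_gap (n + 1 - t)) (\<lambda>_. 0)
    (\<lambda>s. let t = extra_tail \<alpha> s in x_gap (n - t) + (b t - (s - off t)) * x_sum t)"

definition y_weight :: "arrow \<Rightarrow> nat" where
  "y_weight = case_arrow (\<lambda>_. 0) y_gap
    (\<lambda>s. let t = extra_tail \<alpha> s in y_gap (t - 1) + (s - off t - 1) * y_sum t)"

lemma x_gap_0: "x_gap 0 = 1"
  by (simp add: x_gap_def)

lemma x_gap_step:
  assumes "1 \<le> t" "t \<le> n"
  shows "x_gap (n + 1 - t) = x_gap (n - t) + b t * x_sum t"
proof -
  have eq: "n + 1 - t = Suc (n - t)" "n + 1 - Suc (n - t) = t"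
    using assms by auto
  show ?thesis
    unfolding x_sum_def x_gap_def eq(1) staircase_gap.simps eq(2) lessThan_Suc_atMost by simp
qed

lemma y_gap_step:
  assumes "1 \<le> t"
  shows "y_gap t = y_gap (t - 1) + b t * y_sum t"
  using assms unfolding y_gap_def y_sum_def by (cases t) (simp_all add: lessThan_Suc_atMost)

lemma x_sum_step: "t \<le> n \<Longrightarrow> x_sum t = x_sum (t + 1) + x_gap (n - t)"
  by (simp add: x_sum_def Suc_diff_le)

lemma x_sum_n: "x_sum n = 1"
  by (simp add: x_sum_def x_gap_0)

text \<open>By \<open>x_gap_step\<close> the clockwise arrow fits the progression at m = 0. The top
  arrow is excluded: its exponent is 0, whereas truncated subtraction would leave
  \<open>x_gap (n - t)\<close>.\<close>

lemma x_weight_arrow: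
  assumes "1 \<le> t" "t \<le> n" "m \<le> b t"
  shows "x_weight (e t m) = x_gap (n - t) + (b t - m) * x_sum t"
proof (cases "m = 0")
  case True
  then show ?thesis
    using x_gap_step[of t] assms by (simp add: x_weight_def)
next
  case False
  then show ?thesis
    using assms by (simp add: e_Ex x_weight_def extra_tail_group)
qed

text \<open>Dually, \<open>y_gap_step\<close> makes the anticlockwise arrow the last term of the
  progression, and the clockwise arrow is excluded.\<close>

lemma y_weight_arrow:
  assumes "1 \<le> t" "t \<le> n" "0 < m" "m \<le> d t"
  shows "y_weight (e t m) = y_gap (t - 1) + (m - 1) * y_sum t"
proof (cases "m = d t")
  case True
  show ?thesis
    unfolding True e_d using y_gap_step[of t] d_Suc[of t] assms by (simp add: y_weight_def)
next
  case False
  then show ?thesis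
    using assms by (simp add: d_Suc e_Ex y_weight_def extra_tail_group)
qed

lemma weight_Acw [simp]: "x_weight (Acw t) = 0" "y_weight (Acw t) = y_gap t"
  and weight_Cw [simp]: "x_weight (Cw t) = (if t = 0 then 1 else x_gap (n + 1 - t))" "y_weight (Cw t) = 0"
  by (simp_all add: x_weight_def y_weight_def)

lemma weight_acw: "path_weight x_weight (acw t) = 0" "path_weight y_weight (acw t) = y_sum t"
  by (induction t) (simp_all add: y_sum_def)

lemma weight_cw: "t \<le> n \<Longrightarrow> path_weight x_weight (cw t) = x_sum t \<and> path_weight y_weight (cw t) = 0"
proof (induction t rule: inc_induct)
  case (step t)
  then show ?case
    using cw_path_from_step[of t n e] x_sum_step[of t] by simp
qed (simp add: x_sum_n)

lemma vertex_rel_weights: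
  assumes t: "1 \<le> t" "t \<le> n" and m: "m < d t"
  shows "path_weight x_weight (fst (vertex_rel t m)) = path_weight x_weight (snd (vertex_rel t m))"
    and "path_weight y_weight (fst (vertex_rel t m)) = path_weight y_weight (snd (vertex_rel t m))"
proof -
  have mb: "m \<le> b t"
    using m d_Suc[OF t(1)] by simp
  have lhs: "path_weight x_weight (fst (vertex_rel t m)) = x_gap (n - t) + (b t - m) * x_sum t"
    using x_weight_arrow[OF t mb] weight_acw(1)[of t] by (simp add: vertex_rel_def del: e_0)
  have rhs: "path_weight x_weight (snd (vertex_rel t m)) = x_gap (n - t) + (b t - m) * x_sum t"
  proof (cases "Suc m = d t")
    case True
    then have "m = b t"
      using d_Suc[OF t(1)] by simp
    then show ?thesis
      using True t x_gap_0 by (auto simp: vertex_rel_def)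
  next
    case False
    then have "Suc m \<le> b t"
      using m d_Suc[OF t(1)] by simp
    then have "b t - m = Suc (b t - Suc m)"
      by simp
    then show ?thesis
      using False x_weight_arrow[OF t \<open>Suc m \<le> b t\<close>] weight_cw[OF t(2)] by (simp add: vertex_rel_def)
  qed
  show "path_weight x_weight (fst (vertex_rel t m)) = path_weight x_weight (snd (vertex_rel t m))"
    unfolding lhs rhs ..
  have "path_weight y_weight (snd (vertex_rel t m)) = y_gap (t - 1) + m * y_sum t"
    using y_weight_arrow[OF t, of "Suc m"] m weight_cw[OF t(2)] by (simp add: vertex_rel_def)
  moreover have "path_weight y_weight (fst (vertex_rel t m)) = y_gap (t - 1) + m * y_sum t"
    using y_weight_arrow[OF t, of m] m by (cases m) (simp_all add: vertex_rel_def weight_acw)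
  ultimately show "path_weight y_weight (fst (vertex_rel t m)) = path_weight y_weight (snd (vertex_rel t m))"
    by simp
qed

text \<open>The tail of the \<open>k_s\<close> with s = off t can lie several vertices before t when
  entries equal 2. Passing such a vertex changes neither the cycle nor the two gaps; otherwise the
  last extra arrow at t determines the weight. The result is the joint weight of
  \<open>c_(t,t-1)\<close> and \<open>a_(t-1,t)\<close>.\<close>

lemma origin_weight:
  assumes "1 \<le> t" "t \<le> n"
  shows "path_weight x_weight (acw (extra_tail \<alpha> (off t)) @ [extra \<alpha> (off t)]) = x_gap (n + 1 - t) \<and>
    path_weight y_weight (acw (extra_tail \<alpha> (off t)) @ [extra \<alpha> (off t)]) = y_gap (t - 1)"
  using assms
proof (induction t rule: dec_induct)
  case base
  then show ?case
    using extra_0 extra_tail_0 by (simp add: weight_acw y_sum_def)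
next
  case (step t)
  have off: "off (Suc t) = off t + b t" and gap: "y_gap t = y_gap (t - 1) + b t * y_sum t"
    using off_Suc[of t] y_gap_step[of t] step by auto
  show ?case
  proof (cases "b t = 0")
    case True
    then show ?thesis
      using step off gap x_gap_step[of t] by simp
  next
    case False
    then have "extra_tail \<alpha> (off t + b t) = t" "extra \<alpha> (off t + b t) = e t (b t)"
      using step extra_tail_group[of t "b t"] extra_eq[of t "b t"] d_Suc[of t] by auto
    then show ?thesis
      using step False gap x_weight_arrow[of t "b t"] y_weight_arrow[of t "b t"] d_Suc[of t]
      by (cases "b t") (simp_all add: off weight_acw)
  qed
qed

lemma origin_rel_weights:
  assumes t: "1 \<le> t" "t \<le> n" and m: "m < d t" "t < n \<Longrightarrow> m < b t"
  shows "path_weight x_weight (fst (origin_rel (off t + m))) = path_weight x_weight (snd (origin_rel (off t + m)))"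
    and "path_weight y_weight (fst (origin_rel (off t + m))) = path_weight y_weight (snd (origin_rel (off t + m)))"
proof -
  have m': "t < n \<Longrightarrow> Suc m < d t"
    using m d_Suc[OF t(1)] by simp
  have tail: "extra_tail \<alpha> (Suc (off t + m)) = t" and ex: "extra \<alpha> (Suc (off t + m)) = e t (Suc m)"
    using extra_tail_e[OF t, of "Suc m"] extra_eq[OF t, of "Suc m"] m m' by auto
  have "path_weight x_weight (snd (origin_rel (off t + m))) = x_sum t + x_weight (e t (Suc m))"
    using weight_cw[OF t(2)] by (simp add: origin_rel_def tail ex)
  also have "\<dots> = x_gap (n - t) + (b t - m) * x_sum t"
  proof (cases "Suc m \<le> b t")
    case True
    then have "b t - m = Suc (b t - Suc m)"
      by simp
    then show ?thesis
      using x_weight_arrow[OF t True] by simp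
  next
    case False
    then have "m = b t" "t = n"
      using m t d_Suc[OF t(1)] by (cases "t < n"; simp)+
    then have "e t (Suc m) = Acw t"
      using d_Suc[OF t(1)] e_d[of t] by simp
    then show ?thesis
      using \<open>m = b t\<close> \<open>t = n\<close> x_sum_n x_gap_0 by simp
  qed
  finally have x_snd: "path_weight x_weight (snd (origin_rel (off t + m))) = x_gap (n - t) + (b t - m) * x_sum t" .
  have y_snd: "path_weight y_weight (snd (origin_rel (off t + m))) = y_gap (t - 1) + m * y_sum t"
    using y_weight_arrow[OF t, of "Suc m"] m weight_cw[OF t(2)] by (simp add: origin_rel_def tail ex)
  have "path_weight x_weight (fst (origin_rel (off t + m))) = x_gap (n - t) + (b t - m) * x_sum t \<and>
      path_weight y_weight (fst (origin_rel (off t + m))) = y_gap (t - 1) + m * y_sum t"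
  proof (cases "m = 0")
    case True
    then show ?thesis
      using origin_weight[OF t] x_gap_step[OF t] by (simp add: origin_rel_def)
  next
    case False
    then have "extra_tail \<alpha> (off t + m) = t" "extra \<alpha> (off t + m) = e t m"
      using extra_tail_e[OF t, of m] extra_eq[OF t, of m] m by auto
    then show ?thesis
      using False x_weight_arrow[OF t, of m] y_weight_arrow[OF t, of m] m d_Suc[OF t(1)]
      by (cases m) (simp_all add: origin_rel_def weight_acw)
  qed
  then show "path_weight x_weight (fst (origin_rel (off t + m))) = path_weight x_weight (snd (origin_rel (off t + m)))"
    "path_weight y_weight (fst (origin_rel (off t + m))) = path_weight y_weight (snd (origin_rel (off t + m)))"
    using x_snd y_snd by simp_all
qed

lemma rels_many_properties:
  assumes "(x, y) \<in> rels_many \<alpha>"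
  shows "x \<noteq> [] \<and> y \<noteq> [] \<and> (\<exists>u v. awalk u x v \<and> awalk u y v) \<and>
    path_weight x_weight x = path_weight x_weight y \<and> path_weight y_weight x = path_weight y_weight y"
  using assms
proof (cases rule: rels_many_cases)
  case (1 t m)
  then have xy: "x = fst (vertex_rel t m)" "y = snd (vertex_rel t m)"
    by (metis fst_conv, metis snd_conv)
  have "x \<noteq> []" "y \<noteq> []"
    by (simp_all add: xy vertex_rel_def)
  then show ?thesis
    using vertex_rel_walks[OF 1(1-3)] vertex_rel_weights[OF 1(1-3)] unfolding xy by blast
next
  case (2 t m)
  let ?r = "origin_rel (off t + m)"
  have xy: "x = fst ?r \<and> y = snd ?r \<or> x = snd ?r \<and> y = fst ?r"
    using 2(5) by (metis fst_conv snd_conv fst_swap snd_swap)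
  have "off t + m \<le> num_extra \<alpha>"
    using off_le[OF 2(1,2)] 2(3) d_Suc[OF 2(1)] by simp
  note walks = origin_rel_walks[OF this]
  have "fst ?r \<noteq> []" "snd ?r \<noteq> []"
    by (simp_all add: origin_rel_def)
  moreover note origin_rel_weights[OF 2(1-4)]
  ultimately show ?thesis
    using xy walks by (elim disjE conjE) (simp_all, blast+)
qed

section \<open>The staircase conditions for several entries\<close>

sublocale staircase_quiver Q "rels_many \<alpha>" x_weight y_weight n d e
proof
  fix t m
  have cong: "path_cong (rels_many \<alpha>) x y" if "(x, y) \<in> rels_many \<alpha> \<or> (y, x) \<in> rels_many \<alpha>" for x y
    using path_cong_rel[of x y "rels_many \<alpha>" "[]" "[]"] path_cong_rel[of y x "rels_many \<alpha>" "[]" "[]"] that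
    by (auto intro: path_cong_sym)
  {
    assume t: "t \<le> n"
    show "0 < x_weight (e t m) + y_weight (e t m)" if "m \<le> d t"
    proof (cases "m = d t")
      case True
      then show ?thesis
        using staircase_gap_pos by (simp add: y_gap_def)
    next
      case False
      show ?thesis
      proof (cases "t = 0")
        case True
        then show ?thesis
          using False that by (cases m) (auto simp: d_def)
      next
        case t0: False
        then have "x_weight (e t m) = x_gap (n - t) + (b t - m) * x_sum t"
          using False that t by (intro x_weight_arrow) (auto simp: d_Suc)
        then show ?thesis
          using staircase_gap_pos by (simp add: x_gap_def)
      qed
    qed
    show "y_weight (e t 0) = 0"
      by simp
  }
  show "y_weight (e 0 1) = 1"
    using Acw_0 by (simp add: y_gap_def)
  assume t: "1 \<le> t" "t \<le> n"
  show "y_weight (e t 1) = y_weight (e (t - 1) (d (t - 1)))"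
    using y_weight_arrow[OF t, of 1] d_pos'[of t] by simp
  have "vertex_rel t 0 \<in> rels_many \<alpha>"
    using vertex_rel_in_rels[OF t, of 0] d_pos'[of t] by simp
  then show "\<exists>x. path_cong (rels_many \<alpha>) [e t 0, e (t - 1) (d (t - 1))] (e t 1 # x)"
    using cong by (auto simp: vertex_rel_def)
  {
    assume m: "0 < m" "m < d t"
    show "y_weight (e t (Suc m)) = y_weight (e t m) + path_weight y_weight (acw t)"
      using y_weight_arrow[OF t, of m] y_weight_arrow[OF t, of "Suc m"] m
      by (cases m) (simp_all add: weight_acw)
    have "vertex_rel t m \<in> rels_many \<alpha>"
      by (rule vertex_rel_in_rels[OF t m(2)])
    then show "\<exists>x. path_cong (rels_many \<alpha>) (e t m # acw t) (e t (Suc m) # x)"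
      using cong m by (auto simp: vertex_rel_def)
  }
  {
    assume m: "0 < m" "m \<le> d t" "t < n \<Longrightarrow> m < d t"
    have ex: "extra \<alpha> (off t + m) = e t m" and tail: "extra_tail \<alpha> (off t + m) = t"
      using extra_eq[OF t m] extra_tail_e[OF t m] by auto
    have le: "off t + (m - 1) \<le> num_extra \<alpha>"
      using off_le[OF t] m d_Suc[OF t(1)] by simp
    \<comment> \<open>The tail of the preceding \<open>k_s\<close> is at least 1, so the
      anticlockwise path to it is nonempty and begins with \<open>e 0 1\<close>, as
      \<open>cycle_0\<close> demands.\<close>
    obtain l where l: "extra_tail \<alpha> (off t + (m - 1)) = Suc l"
      using extra_tail_range[of "off t + (m - 1)"] le by (cases "extra_tail \<alpha> (off t + (m - 1))") auto
    have "acw (Suc l) = e 0 1 # map (\<lambda>s. e s (d s)) [1..<Suc l]"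
      unfolding acw_path_from_def by (simp add: upt_conv_Cons Acw_0 del: upt_Suc)
    moreover have "Suc (off t + (m - 1)) = off t + m"
      using m by simp
    ultimately have origin: "origin_rel (off t + (m - 1)) =
        (e 0 1 # map (\<lambda>s. e s (d s)) [1..<Suc l] @ [extra \<alpha> (off t + (m - 1))], cw t @ [e t m])"
      unfolding origin_rel_def l by (simp only: ex tail append_Cons)
    have "m - 1 < d t" "t < n \<Longrightarrow> m - 1 < b t"
      using m d_Suc[OF t(1)] by auto
    from origin_rel_in_rels[OF t this]
    have "path_cong (rels_many \<alpha>) (cw t @ [e t m])
        (e 0 1 # map (\<lambda>s. e s (d s)) [1..<Suc l] @ [extra \<alpha> (off t + (m - 1))])"
      unfolding origin by (intro cong) auto
    then show "\<exists>x. path_cong (rels_many \<alpha>) (cw t @ [e t m]) (e 0 1 # x)"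
      by blast
  }
qed (use rels_many_properties in blast)+

end

theorem lemma6p2:
  fixes r a :: nat and \<alpha> :: "nat list"
  assumes "1 \<le> a" and "a < r" and "coprime r a"
    and "\<alpha> \<noteq> []" and "\<forall>x\<in>set \<alpha>. 2 \<le> x"
    and "of_nat r / of_nat a = hj_frac \<alpha>"
  shows "prime_ring (reconstruction_algebra \<alpha>) \<and>
    has_PI_degree (reconstruction_algebra \<alpha>) (length \<alpha> + 1)"
proof (cases "length \<alpha> = 1")
  case True
  then have "length \<alpha> + 1 = 2"
    by simp
  then show ?thesis
    using True quiver_one_prime_PI_degree[of "\<alpha> ! 0"] assms(5) by (simp only: reconstruction_algebra_def) simp
next
  case False
  interpret many_entries \<alpha> "length \<alpha>"
    using False assms(4,5) by unfold_locales (auto simp: Suc_le_eq numeral_2_eq_2 neq_Nil_conv)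
  have "card (verts (quiver_many \<alpha>)) = length \<alpha> + 1"
    by (simp add: quiver_simps)
  then show ?thesis
    using path_algebra_mod_prime_PI_degree False by (simp add: reconstruction_algebra_def)
qed

end
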